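(* Let $\varepsilon>0$ and let $f_0^{\pm}\in C_0^\infty(\mathbb{R}^3\times\mathbb{R}^3)$ satisfy $f_0^{\pm}\ge 0$ and $f_0^{\pm}(x,v)=0$ whenever $|x|\ge r_0$ or $|v|\ge r_0$, for some fixed $r_0>0$. Let $f^{\pm}$ be the solution on $[0,\infty[$ of the Vlasov-Poisson system with damping (VPD) with data $f^{\pm}(t=0)=f_0^{\pm}$. Then $$\dot{\mathcal{E}}(t)=-\varepsilon\,|D^{[2]}(t)|^2 .$$ Moreover, the following estimates hold for $t\in[0,\infty[$: (a) $\|\rho^{\pm}(t)\|_{p;x}\le C(1+t)^{-\frac{3(p-1)}{2p}}$ for $p\in[1,\frac53]$; (b) $\|\nabla U(t)\|_{p;x}\le C(1+t)^{-\frac{5p-3}{7p}}$ for $p\in[2,\frac{15}{4}]$; (c) $|D^{[2]}(t)|\le C(1+t)^{-\frac87}$. In particular, (VPD) does not admit nontrivial static solutions (i.e. solutions $f^\pm(t)\equiv f_0^\pm$ independent of $t$, with $f_0^{\pm}\in C_0^\infty(\mathbb{R}^3\times\mathbb{R}^3)$, $f_0^{\pm}\ge 0$, and $f_0^{\pm}(x,v)=0$ whenever $|x|\ge r_0$ or $|v|\ge r_0$ for some $r_0>0$, other than $f^\pm\equiv 0$), and the kinetic energy satisfies $\mathcal{E}_{\rm kin}(t)\to\mathcal{E}_\infty$ as $t\to\infty$ for some $\mathcal{E}_\infty\ge 0$. Moreover, if $\mathcal{E}(0)>0$ and $\varepsilon>0$ is small enough (depending on $f_0^{\pm}$), then $\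mathcal{E}_\infty>0$.
   Context: All integrals $\int$ are over $\mathbb{R}^3$. For a fixed parameter $\varepsilon>0$, the system (VPD) for the two densities $f^{\pm}=f^{\pm}(t,x,v)$, $x,v\in\mathbb{R}^3$, is $$\partial_t f^+ +(v+\varepsilon D^{[2]}(t))\cdot\nabla_x f^+ +\nabla U\cdot\nabla_v f^+=0,$$ $$\partial_t f^- +(v-\varepsilon D^{[2]}(t))\cdot\nabla_x f^- -\nabla U\cdot\nabla_v f^-=0,$$ $$\Delta U=4\pi\rho=4\pi(\rho^+-\rho^-),\quad \lim_{|x|\to\infty}U(t,x)=0,\quad \rho^{\pm}(t,x)=\int f^{\pm}(t,x,v)\,dv,$$ $$D^{[2]}(t)=\int \nabla U(t,x)\,(\rho^+(t,x)+\rho^-(t,x))\,dx,$$ where $\nabla U=\nabla_x U$; that is, $U(t,x)=-\int |x-y|^{-1}\rho(t,y)\,dy$. A solution on a time interval $I$ is a pair $f^{\pm}\in C^1(I\times\mathbb{R}^3\times\mathbb{R}^3)$ satisfying these equations pointwise and such that, for every compact $J\subset I$, the functions $f^{\pm}(t,\cdot,\cdot)$, $t\in J$, are supported in a common compact set. (For nonnegative data $f_0^{\pm}\in C_0^\infty(\mathbb{R}^3\times\mathbb{R}^3)$, a unique solution on $[0,\infty[$ exists.) The energies are $$\mathcal{E}(t)=\mathcal{E}_{\rm kin}(t)+\mathcal{E}_{\rm pot}(t),\quad \mathcal{E}_{\rm kin}(t)=\frac12\int\!\!\int |v|^2(f^+ +f^-)(t,x,v)\,dx\,dv,\quad \mathcal{E}_{\rm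 pot}(t)=\frac1{8\pi}\int|\nabla U(t,x)|^2dx.$$ $\|\varphi(t)\|_{p;x}$ denotes the $L^p(\mathbb{R}^3)$-norm of $\varphi(t,\cdot)$. $C$ denotes constants independent of $t$ depending only on $f_0^{\pm}$ (and the exponent); they may be chosen independent of $\varepsilon$ for $\varepsilon\in\,]0,1]$, and for $\varepsilon>1$ may also depend on $\varepsilon$. *)

theory Defs
  imports "HOL-Analysis.Analysis"
begin

type_synonym vec3 = "real ^ 3"

text \<open>A density on phase space at a fixed time, as a curried function of position and velocity.\<close>

type_synonym density = "vec3 \<Rightarrow> vec3 \<Rightarrow> real"

primrec Ck :: "nat \<Rightarrow> ('a::euclidean_space \<Rightarrow> real) \<Rightarrow> bool" where
  "Ck 0 f \<longleftrightarrow> continuous_on UNIV f"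
| "Ck (Suc k) f \<longleftrightarrow>
     (\<forall>x. f differentiable (at x)) \<and> (\<forall>h. Ck k (\<lambda>x. frechet_derivative f (at x) h))"

definition Cc_infinity :: "('a::euclidean_space \<Rightarrow> real) \<Rightarrow> bool" where
  "Cc_infinity f \<longleftrightarrow> (\<forall>k. Ck k f) \<and> compact (closure {x. f x \<noteq> 0})"

text \<open>The derivatives are taken within \<open>S\<close>, so that they are one-sided at boundary points
  belonging to \<open>S\<close>, such as \<open>t = 0\<close> for the time interval \<open>{0..}\<close>.\<close>

definition C1_on :: "'a::euclidean_space set \<Rightarrow> ('a \<Rightarrow> real) \<Rightarrow> bool" where
  "C1_on S f \<longleftrightarrow>
     (\<exists>f'. (\<forall>z\<in>S. (f has_derivative blinfun_apply (f' z)) (at z within S)) \<and> continuous_on S f')"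

definition grad :: "(vec3 \<Rightarrow> real) \<Rightarrow> vec3 \<Rightarrow> vec3" where
  "grad \<phi> x = (THE D. GDERIV \<phi> x :> D)"

definition laplacian :: "(vec3 \<Rightarrow> real) \<Rightarrow> vec3 \<Rightarrow> real" where
  "laplacian \<phi> x = (\<Sum>i\<in>UNIV. frechet_derivative (grad \<phi>) (at x) (axis i 1) $ i)"

text \<open>Functions that are not \<open>p\<close>-integrable have norm \<open>\<infinity>\<close>, so a finite bound on the norm
  includes the membership in \<open>L\<^sup>p\<close>.\<close>

definition Lp_norm :: "real \<Rightarrow> (vec3 \<Rightarrow> 'b::real_normed_vector) \<Rightarrow> ennreal" where
  "Lp_norm p \<phi> =
     (if \<phi> \<in> borel_measurable lborel \<and> integrable lborel (\<lambda>x. norm (\<phi> x) powr p)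
      then ennreal ((LINT x|lborel. norm (\<phi> x) powr p) powr (1 / p)) else \<infinity>)"

definition rho :: "density \<Rightarrow> vec3 \<Rightarrow> real" where
  "rho f x = (LINT v|lborel. f x v)"

definition potential :: "density \<Rightarrow> density \<Rightarrow> vec3 \<Rightarrow> real" where
  "potential fp fm x = - (LINT y|lborel. (rho fp y - rho fm y) / norm (x - y))"

definition D2 :: "density \<Rightarrow> density \<Rightarrow> vec3" where
  "D2 fp fm = (LINT x|lborel. (rho fp x + rho fm x) *\<^sub>R grad (potential fp fm) x)"

definition E_kin :: "density \<Rightarrow> density \<Rightarrow> real" where
  "E_kin fp fm = 1 / 2 * (LINT v|lborel. LINT x|lborel. (norm v)\<^sup>2 * (fp x v + fm x v))"

definition E_pot :: "density \<Rightarrow> density \<Rightarrow> real" where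
  "E_pot fp fm = 1 / (8 * pi) * (LINT x|lborel. (norm (grad (potential fp fm) x))\<^sup>2)"

definition energy :: "density \<Rightarrow> density \<Rightarrow> real" where
  "energy fp fm = E_kin fp fm + E_pot fp fm"

definition locally_uniform_compact_support :: "real set \<Rightarrow> (real \<Rightarrow> density) \<Rightarrow> bool" where
  "locally_uniform_compact_support I f \<longleftrightarrow>
     (\<forall>J. compact J \<and> J \<subseteq> I \<longrightarrow>
        (\<exists>K. compact K \<and> (\<forall>t\<in>J. \<forall>x v. (x, v) \<notin> K \<longrightarrow> f t x v = 0)))"

text \<open>For densities of the required regularity, the two conditions on the differentiability of
  the potential, the Poisson equation and the decay at infinity all follow from the definition
  of \<^const>\<open>potential\<close> as an integral.  They are listed because they are part of the system.\<close>

definition VPD_solution ::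
    "real \<Rightarrow> real set \<Rightarrow> (real \<Rightarrow> density) \<Rightarrow> (real \<Rightarrow> density) \<Rightarrow> bool" where
  "VPD_solution \<epsilon> I fp fm \<longleftrightarrow>
     C1_on (I \<times> UNIV \<times> UNIV) (\<lambda>(t, x, v). fp t x v) \<and>
     C1_on (I \<times> UNIV \<times> UNIV) (\<lambda>(t, x, v). fm t x v) \<and>
     locally_uniform_compact_support I fp \<and>
     locally_uniform_compact_support I fm \<and>
     (\<forall>t\<in>I.
        let U = potential (fp t) (fm t); D = D2 (fp t) (fm t) in
          (\<forall>x v.
             vector_derivative (\<lambda>s. fp s x v) (at t within I)
               + (v + \<epsilon> *\<^sub>R D) \<bullet> grad (\<lambda>y. fp t y v) x
               + grad U x \<bullet> grad (\<lambda>w. fp t x w) v = 0) \<and>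
          (\<forall>x v.
             vector_derivative (\<lambda>s. fm s x v) (at t within I)
               + (v - \<epsilon> *\<^sub>R D) \<bullet> grad (\<lambda>y. fm t y v) x
               - grad U x \<bullet> grad (\<lambda>w. fm t x w) v = 0) \<and>
          (\<forall>x. U differentiable (at x)) \<and>
          (\<forall>x. grad U differentiable (at x)) \<and>
          (\<forall>x. laplacian U x = 4 * pi * (rho (fp t) x - rho (fm t) x)) \<and>
          (U \<longlongrightarrow> 0) at_infinity)"

definition VPD_ivp ::
    "real \<Rightarrow> density \<Rightarrow> density \<Rightarrow> (real \<Rightarrow> density) \<Rightarrow> (real \<Rightarrow> density) \<Rightarrow> bool" where
  "VPD_ivp \<epsilon> f0p f0m fp fm \<longleftrightarrow> VPD_solution \<epsilon> {0..} fp fm \<and> fp 0 = f0p \<and> fm 0 = f0m"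

definition VPD_data :: "density \<Rightarrow> density \<Rightarrow> bool" where
  "VPD_data f0p f0m \<longleftrightarrow>
     Cc_infinity (\<lambda>(x, v). f0p x v) \<and> Cc_infinity (\<lambda>(x, v). f0m x v) \<and>
     (\<forall>x v. 0 \<le> f0p x v \<and> 0 \<le> f0m x v) \<and>
     (\<exists>r0>0. \<forall>x v. norm x \<ge> r0 \<or> norm v \<ge> r0 \<longrightarrow> f0p x v = 0 \<and> f0m x v = 0)"

text \<open>A constant that may depend on \<open>\<epsilon>\<close> for \<open>\<epsilon> > 1\<close> but is uniform for \<open>\<epsilon> \<in> ]0, 1]\<close>.\<close>

definition admissible_constant :: "(real \<Rightarrow> real) \<Rightarrow> bool" where
  "admissible_constant C \<longleftrightarrow> (\<forall>\<epsilon>\<in>{0<..1}. C \<epsilon> = C 1)"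

end

theory Submission
  imports Defs
begin

text \<open>Put \<open>s = 1 + t\<close> and \<open>h = \<integral>\<integral> |x - s v|\<^sup>2 / 2 (f\<^sup>+ + f\<^sup>-) dx dv + s\<^sup>2 E\<^sub>p\<^sub>o\<^sub>t\<close>.  By the transport
  equations and the virial identity \<open>\<integral> \<rho> x \<cdot> \<nabla>U dx = E\<^sub>p\<^sub>o\<^sub>t\<close>, the derivative of \<open>h\<close> is
  \<open>s E\<^sub>p\<^sub>o\<^sub>t - \<epsilon> s\<^sup>2 |D|\<^sup>2\<close> plus a cross term \<open>\<epsilon> D \<cdot> \<integral>\<integral> (x - s v) (f\<^sup>+ - f\<^sup>-)\<close>, which Young's inequality
  absorbs into the damping.  Hence \<open>h' \<le> h / s + c \<epsilon> h / s\<^sup>2\<close> and \<open>h = O(s)\<close>, so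
  \<open>E\<^sub>p\<^sub>o\<^sub>t = O(1 / s)\<close> and \<open>\<integral>\<integral> |v - x / s|\<^sup>2 f = O(1 / s)\<close>.  The latter bounds the \<open>L\<^bsup>5/3\<^esup>\<close>-norm of the densities,
  the Hardy--Littlewood--Sobolev inequality turns this into the \<open>L\<^bsup>15/4\<^esup>\<close>-bound for \<open>\<nabla>U\<close>, and all other
  exponents follow by interpolation.\<close>

section \<open>Differentiation under the integral sign\<close>

text \<open>The obstacle is the damping drift. It carries the two species in opposite directions, so
  the dispersion identity of the undamped system acquires a term with \<open>D\<close>, whose decay
  is not known at that stage. The way out is that the damping of the potential energy, multiplied by
  s^2, supplies -\<epsilon> s^2 |D|^2, and Young's inequality can be weighted so as to spend no more
  than this. The price c \<epsilon> h / s^2 has an integrable factor, so it costs a bounded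
  exponential and leaves the growth rate O(s) of the undamped system without loss in the exponent.
  Using 1 + t instead of t keeps 1 / s^2 integrable down to t = 0, so the comparison starts from the
  value of \<open>h\<close> at time 0. In the growth bound \<epsilon> enters only through
  exp(\<epsilon> (mass + 1) / 2), which for \<epsilon> \<le> 1 is at most its value at 1; this is
  why constants are evaluated at max 1 \<epsilon>. The resulting time integral of |D|^2 is bounded
  uniformly in \<epsilon> \<le> 1, and therefore kinetic energy is left over when \<epsilon> is
  small.\<close>

lemma has_real_derivative_integral:
  fixes F F' :: "real \<Rightarrow> 'a \<Rightarrow> real"
  assumes T: "convex T" "t \<in> T" "t islimpt T"
    and int: "\<And>s. s \<in> T \<Longrightarrow> integrable M (F s)"
    and der: "\<And>s z. s \<in> T \<Longrightarrow> z \<in> space M \<Longrightarrow> ((\<lambda>s. F s z) has_real_derivative F' s z) (at s within T)"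
    and bnd: "\<And>s z. s \<in> T \<Longrightarrow> z \<in> space M \<Longrightarrow> \<bar>F' s z\<bar> \<le> g z"
    and g: "integrable M g"
  shows "integrable M (F' t)"
    and "((\<lambda>s. \<integral>z. F s z \<partial>M) has_real_derivative (\<integral>z. F' t z \<partial>M)) (at t within T)"
proof -
  \<comment> \<open>The mean value inequality on the convex set \<open>T\<close> bounds all
    difference quotients by the majorant of the derivative, as dominated convergence
    requires.\<close>
  have q: "\<bar>(F s z - F t z) / (s - t)\<bar> \<le> g z" if "s \<in> T" "z \<in> space M" for s z
  proof -
    have "norm (F s z - F t z) \<le> g z * norm (s - t)"
      by (rule field_differentiable_bound[OF T(1), of "\<lambda>s. F s z" "\<lambda>s. F' s z"])
        (use that T(2) der bnd in auto)
    moreover have "0 \<le> g z" using bnd[OF that] by linarith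
    ultimately show ?thesis by (cases "s = t") (auto simp: abs_divide divide_le_eq)
  qed
  have lim: "(\<lambda>n. (F (X n) z - F t z) / (X n - t)) \<longlonglongrightarrow> F' t z"
    if X: "\<forall>n. X n \<in> T - {t}" "X \<longlonglongrightarrow> t" and z: "z \<in> space M" for X z
    using der[OF T(2) z] X
    unfolding has_field_derivative_iff tendsto_at_iff_sequentially by (auto simp: comp_def)
  \<comment> \<open>Limits are tested along sequences because dominated convergence is sequential;
    the same sequence of quotients gives the measurability of the derivative.\<close>
  have *: "integrable M (F' t) \<and>
      (\<lambda>n. ((\<integral>z. F (X n) z \<partial>M) - (\<integral>z. F t z \<partial>M)) / (X n - t)) \<longlonglongrightarrow> (\<integral>z. F' t z \<partial>M)"
    if X: "\<forall>n. X n \<in> T - {t}" "X \<longlonglongrightarrow> t" for X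
  proof -
    define G where "G n z = (F (X n) z - F t z) / (X n - t)" for n z
    have Gm: "G n \<in> borel_measurable M" for n
      unfolding G_def using X int[of "X n"] int[OF T(2)] by auto
    have F'm: "F' t \<in> borel_measurable M"
      by (rule borel_measurable_LIMSEQ_metric[OF Gm]) (use lim[OF X] in \<open>auto simp: G_def\<close>)
    have ae: "AE z in M. (\<lambda>n. G n z) \<longlonglongrightarrow> F' t z" "\<And>n. AE z in M. norm (G n z) \<le> g z"
      using lim[OF X] q X by (auto simp: G_def)
    note 1 = integrable_dominated_convergence[OF F'm Gm g ae] integral_dominated_convergence[OF F'm Gm g ae]
    have "(\<integral>z. G n z \<partial>M) = ((\<integral>z. F (X n) z \<partial>M) - (\<integral>z. F t z \<partial>M)) / (X n - t)" for n
      unfolding G_def using X int[of "X n"] int[OF T(2)] by simp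
    with 1 show ?thesis by simp
  qed
  obtain X where "\<forall>n. X n \<in> T - {t}" "X \<longlonglongrightarrow> t"
    using T(3) unfolding islimpt_sequential by blast
  with * show "integrable M (F' t)" by blast
  show "((\<lambda>s. \<integral>z. F s z \<partial>M) has_real_derivative (\<integral>z. F' t z \<partial>M)) (at t within T)"
    unfolding has_field_derivative_iff tendsto_at_iff_sequentially using * by (auto simp: comp_def)
qed

section \<open>Translation, reflection and integration by parts for Lebesgue measure\<close>

lemma borel_measurable_balls [measurable]:
  fixes x :: "'a::euclidean_space"
  shows "ball x r \<in> sets borel" "cball x r \<in> sets borel"
  by (simp_all add: borel_open borel_closed)

lemma lborel_integral_translate:
  fixes f :: "'a::euclidean_space \<Rightarrow> 'b::{banach,second_countable_topology}"
  assumes "f \<in> borel_measurable borel"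
  shows "(\<integral>x. f (a + x) \<partial>lborel) = (\<integral>x. f x \<partial>lborel)"
  using integral_distr[of "(+) a" lborel borel f] assms by (simp add: lborel_distr_plus)

lemma lborel_integrable_translate:
  fixes f :: "'a::euclidean_space \<Rightarrow> 'b::{banach,second_countable_topology}"
  assumes "integrable lborel f"
  shows "integrable lborel (\<lambda>x. f (a + x))"
  using integrable_distr[of "(+) a" lborel borel f] assms by (simp add: lborel_distr_plus)

lemma lborel_distr_reflect:
  "distr lborel borel (\<lambda>x. a - x) = (lborel :: 'a::euclidean_space measure)"
  by (subst (2) lborel_affine[of "-1" a]) (auto simp: density_1)

lemma lborel_integral_reflect:
  fixes f :: "'a::euclidean_space \<Rightarrow> 'b::{banach,second_countable_topology}"
  assumes "f \<in> borel_measurable borel"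
  shows "(\<integral>x. f (a - x) \<partial>lborel) = (\<integral>x. f x \<partial>lborel)"
  using integral_distr[of "\<lambda>x. a - x" lborel borel f] assms by (simp add: lborel_distr_reflect)

lemma lborel_integrable_reflect:
  fixes f :: "'a::euclidean_space \<Rightarrow> 'b::{banach,second_countable_topology}"
  assumes "integrable lborel f"
  shows "integrable lborel (\<lambda>x. f (a - x))"
  using integrable_distr[of "\<lambda>x. a - x" lborel borel f] assms by (simp add: lborel_distr_reflect)

lemma lborel_nn_integral_reflect:
  fixes f :: "'a::euclidean_space \<Rightarrow> ennreal"
  assumes "f \<in> borel_measurable borel"
  shows "(\<integral>\<^sup>+x. f (a - x) \<partial>lborel) = (\<integral>\<^sup>+x. f x \<partial>lborel)"
  using nn_integral_distr[of "\<lambda>x. a - x" lborel borel f] assms by (simp add: lborel_distr_reflect)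

lemma integrable_bounded_support:
  fixes f :: "'a::euclidean_space \<Rightarrow> 'b::{banach,second_countable_topology}"
  assumes "f \<in> borel_measurable borel" "\<And>x. norm (f x) \<le> B" "\<And>x. norm x > R \<Longrightarrow> f x = 0"
  shows "integrable lborel f"
proof (rule Bochner_Integration.integrable_bound)
  show "integrable lborel (\<lambda>x::'a. B * indicator (cball 0 R) x)"
    using emeasure_lborel_cball_finite by (auto intro!: integrable_mult_right integrable_real_indicator)
  have "0 \<le> B" using assms(2)[of 0] norm_ge_zero order_trans by blast
  then show "AE x in lborel. norm (f x) \<le> norm (B * indicator (cball 0 R) x)"
    using assms(2,3) by (auto simp: indicator_def not_le intro!: AE_I2)
qed (use assms in auto)

text \<open>By translation invariance the integral of \<phi> (x + s a) does not depend on
  \<open>s\<close>, and its derivative at 0 is the integral of \<open>\<phi>'\<close>. Every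
  integration by parts of the development reduces to this, in place of the divergence
  theorem.\<close>

lemma integral_directional_derivative_eq_0:
  fixes \<phi> \<phi>' :: "'a::euclidean_space \<Rightarrow> real"
  assumes int: "integrable lborel \<phi>"
    and der: "\<And>x. ((\<lambda>s. \<phi> (x + s *\<^sub>R a)) has_real_derivative \<phi>' x) (at 0)"
    and bnd: "\<And>x. \<bar>\<phi>' x\<bar> \<le> B" and supp: "\<And>x. norm x > R \<Longrightarrow> \<phi>' x = 0"
  shows "integrable lborel \<phi>'" "(\<integral>x. \<phi>' x \<partial>lborel) = 0"
proof -
  let ?T = "{-1..1::real}"
  \<comment> \<open>For |s| \<le> 1 the shifted supports stay in the ball enlarged by the length of
    \<open>a\<close>, so one majorant serves all \<open>s\<close>.\<close>
  let ?g = "\<lambda>x::'a. B * indicator (cball 0 (\<bar>R\<bar> + norm a)) x"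
  have 0: "0 \<in> ?T" "convex ?T" "0 islimpt ?T"
    by (auto simp: islimpt_Icc)
  have B: "0 \<le> B" using bnd[of 0] by linarith
  have d: "((\<lambda>s. \<phi> (s *\<^sub>R a + x)) has_real_derivative \<phi>' (s *\<^sub>R a + x)) (at s within X)" for s x X
  proof -
    have "((\<lambda>u. \<phi> ((x + s *\<^sub>R a) + u *\<^sub>R a)) has_real_derivative \<phi>' (s *\<^sub>R a + x)) (at 0)"
      using der[of "x + s *\<^sub>R a"] by (simp add: add.commute)
    then have "((\<lambda>u. \<phi> ((x + s *\<^sub>R a) + (u - s) *\<^sub>R a)) has_real_derivative \<phi>' (s *\<^sub>R a + x)) (at s)"
      using DERIV_shift[of "\<lambda>u. \<phi> (x + s *\<^sub>R a + (u - s) *\<^sub>R a)" _ 0 s] by (simp add: add.commute)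
    then show ?thesis
      by (auto simp: algebra_simps intro: has_field_derivative_at_within)
  qed
  have b: "\<bar>\<phi>' (s *\<^sub>R a + x)\<bar> \<le> ?g x" if "s \<in> ?T" for s x
  proof (cases "norm x \<le> \<bar>R\<bar> + norm a")
    case False
    have "norm (s *\<^sub>R a) \<le> norm a" using that by (auto simp: mult_left_le_one_le)
    then have "norm (s *\<^sub>R a + x) > R" using False norm_diff_ineq[of x "s *\<^sub>R a"] by (simp add: add.commute)
    then show ?thesis using supp B by simp
  qed (use bnd in auto)
  note * = has_real_derivative_integral[where T="?T" and t=0 and M=lborel and g="?g" and
      F="\<lambda>s x. \<phi> (s *\<^sub>R a + x)" and F'="\<lambda>s x. \<phi>' (s *\<^sub>R a + x)", OF 0(2,1,3)]
  have g: "integrable lborel ?g"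
    using emeasure_lborel_cball_finite by (auto intro!: integrable_mult_right integrable_real_indicator)
  show "integrable lborel \<phi>'"
    using *(1) lborel_integrable_translate[OF int] d b g by simp
  have "((\<lambda>s. \<integral>x. \<phi> (s *\<^sub>R a + x) \<partial>lborel) has_real_derivative (\<integral>x. \<phi>' x \<partial>lborel)) (at 0 within ?T)"
    using *(2) lborel_integrable_translate[OF int] d b g by simp
  moreover have "(\<integral>x. \<phi> (s *\<^sub>R a + x) \<partial>lborel) = (\<integral>x. \<phi> x \<partial>lborel)" for s
    using int by (intro lborel_integral_translate) auto
  ultimately have "((\<lambda>s. \<integral>x. \<phi> x \<partial>lborel) has_real_derivative (\<integral>x. \<phi>' x \<partial>lborel)) (at 0)"
    by (simp add: at_within_Icc_at)
  then show "(\<integral>x. \<phi>' x \<partial>lborel) = 0"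
    using DERIV_const DERIV_unique by blast
qed

section \<open>Radial integrals and the Hardy--Littlewood--Sobolev inequality\<close>

abbreviation \<kappa> :: real where "\<kappa> \<equiv> unit_ball_vol 3"

lemma \<kappa>_pos: "0 < \<kappa>" by (rule unit_ball_vol_pos) simp

lemma emeasure_ball_vec3:
  "0 \<le> r \<Longrightarrow> emeasure lborel (ball (a::vec3) r) = ennreal (\<kappa> * r ^ 3)"
  "0 \<le> r \<Longrightarrow> emeasure lborel (cball (a::vec3) r) = ennreal (\<kappa> * r ^ 3)"
  by (simp_all add: emeasure_ball emeasure_cball)

lemma nn_integral_powr_tail:
  fixes p a :: real
  assumes "0 < p" "0 < a"
  shows "(\<integral>\<^sup>+s. ennreal (p * s powr (- p - 1)) * indicator {a..} s \<partial>lborel) = ennreal (a powr - p)"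
proof -
  have "((\<lambda>s. - (s powr - p)) \<longlongrightarrow> - 0) at_top"
    by (intro tendsto_minus tendsto_neg_powr filterlim_ident) (use assms in auto)
  then have "(\<integral>\<^sup>+s. ennreal (p * s powr (- p - 1)) * indicator {a..} s \<partial>lborel) = ennreal (0 - (- (a powr - p)))"
    by (intro nn_integral_FTC_atLeast)
       (use assms in \<open>auto intro!: derivative_eq_intros simp: algebra_simps\<close>)
  then show ?thesis by simp
qed

lemma nn_integral_powr_from_0:
  fixes p c :: real
  assumes "-1 < p" "0 \<le> c"
  shows "(\<integral>\<^sup>+s. ennreal (s powr p) * indicator {0..c} s \<partial>lborel) = ennreal (c powr (p + 1) / (p + 1))"
  by (rule nn_integral_has_integral_lebesgue') (use has_integral_powr_from_0[OF assms] in auto)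

text \<open>Writing |x|^(-p) as the integral of p s^(-p-1) over s \<ge> |x| and exchanging integrals
  reduces radial integrals to volumes of \<open>S\<close> cut by balls; this takes the place of
  polar coordinates. The origin, where \<open>powr\<close> returns 0, is a null set.\<close>

lemma layer_cake_norm:
  fixes S :: "vec3 set"
  assumes p: "0 < p" and S[measurable]: "S \<in> sets borel"
  shows "(\<integral>\<^sup>+x. ennreal (norm x powr - p) * indicator S x \<partial>lborel)
    = (\<integral>\<^sup>+s. ennreal (p * s powr (- p - 1)) * indicator {0<..} s * emeasure lborel (S \<inter> cball 0 s) \<partial>lborel)"
proof -
  have "(\<integral>\<^sup>+x. ennreal (norm x powr - p) * indicator S x \<partial>lborel)
     = (\<integral>\<^sup>+x. (\<integral>\<^sup>+s. ennreal (p * s powr (- p - 1)) * indicator {0<..} s * (indicator S x * indicator {norm x..} s) \<partial>lborel) \<partial>lborel)"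
  proof (rule nn_integral_cong_AE)
    show "AE x::vec3 in lborel. ennreal (norm x powr - p) * indicator S x =
      (\<integral>\<^sup>+s. ennreal (p * s powr (- p - 1)) * indicator {0<..} s * (indicator S x * indicator {norm x..} s) \<partial>lborel)"
      using AE_lborel_singleton[of 0]
    proof eventually_elim
      case (elim x)
      then have "ennreal (norm x powr - p) = (\<integral>\<^sup>+s. ennreal (p * s powr (- p - 1)) * indicator {norm x..} s \<partial>lborel)"
        using nn_integral_powr_tail[OF p, of "norm x"] by simp
      then have "ennreal (norm x powr - p) * indicator S x
        = (\<integral>\<^sup>+s. ennreal (p * s powr (- p - 1)) * indicator {norm x..} s * indicator S x \<partial>lborel)"
        by (simp add: nn_integral_multc)
      also have "\<dots> = (\<integral>\<^sup>+s. ennreal (p * s powr (- p - 1)) * indicator {0<..} s * (indicator S x * indicator {norm x..} s) \<partial>lborel)"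
        using elim by (intro nn_integral_cong) (auto simp: indicator_def, metis less_le_trans zero_less_norm_iff)
      finally show ?case .
    qed
  qed
  also have "\<dots> = (\<integral>\<^sup>+s. (\<integral>\<^sup>+x. ennreal (p * s powr (- p - 1)) * indicator {0<..} s * (indicator S x * indicator {norm x..} s) \<partial>lborel) \<partial>lborel)"
    by (rule lborel_pair.Fubini') (measurable, simp add: indicator_def, measurable)
  also have "\<dots> = (\<integral>\<^sup>+s. ennreal (p * s powr (- p - 1)) * indicator {0<..} s * emeasure lborel (S \<inter> cball 0 s) \<partial>lborel)"
  proof (rule nn_integral_cong)
    fix s :: real
    have eq: "indicator S x * indicator {norm x..} s = (indicator (S \<inter> cball 0 s) x :: ennreal)" for x
      by (auto simp: indicator_def)
    show "(\<integral>\<^sup>+x. ennreal (p * s powr (- p - 1)) * indicator {0<..} s * (indicator S x * indicator {norm x..} s) \<partial>lborel)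
      = ennreal (p * s powr (- p - 1)) * indicator {0<..} s * emeasure lborel (S \<inter> cball 0 s)"
      unfolding eq by (subst nn_integral_cmult) (auto intro!: borel_measurable_indicator)
  qed
  finally show ?thesis .
qed

lemma nn_integral_norm_ball:
  assumes r: "0 < r"
  shows "(\<integral>\<^sup>+(x::vec3). ennreal (norm x powr - 2) * indicator (ball 0 r) x \<partial>lborel) \<le> ennreal (3 * \<kappa> * r)"
proof -
  have "(\<integral>\<^sup>+(x::vec3). ennreal (norm x powr - 2) * indicator (ball 0 r) x \<partial>lborel)
    = (\<integral>\<^sup>+s. ennreal (2 * s powr (- 2 - 1)) * indicator {0<..} s * emeasure lborel (ball (0::vec3) r \<inter> cball 0 s) \<partial>lborel)"
    by (rule layer_cake_norm) auto
  \<comment> \<open>The volume of the intersection is at most that of the smaller ball: levels below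
    \<open>r\<close> contribute 2 \<kappa> r and levels above contribute \<kappa> r, together the
    exact value 4 pi r.\<close>
  also have "\<dots> \<le> (\<integral>\<^sup>+s. ennreal (2 * \<kappa>) * indicator {0..r} s + ennreal (\<kappa> * r ^ 3) * (ennreal (2 * s powr (- 2 - 1)) * indicator {r..} s) \<partial>lborel)"
  proof (rule nn_integral_mono)
    fix s :: real
    consider "s \<le> 0" | "0 < s" "s \<le> r" | "r < s" by linarith
    then show "ennreal (2 * s powr (- 2 - 1)) * indicator {0<..} s * emeasure lborel (ball (0::vec3) r \<inter> cball 0 s)
       \<le> ennreal (2 * \<kappa>) * indicator {0..r} s + ennreal (\<kappa> * r ^ 3) * (ennreal (2 * s powr (- 2 - 1)) * indicator {r..} s)"
    proof cases
      case 2
      have "emeasure lborel (ball (0::vec3) r \<inter> cball 0 s) \<le> ennreal (\<kappa> * s ^ 3)"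
        using emeasure_ball_vec3(2)[of s 0] 2 by (metis Int_lower2 emeasure_mono less_imp_le sets_lborel borel_closed closed_cball)
      then have "ennreal (2 * s powr (- 2 - 1)) * emeasure lborel (ball (0::vec3) r \<inter> cball 0 s) \<le> ennreal (2 * s powr (- 2 - 1)) * ennreal (\<kappa> * s ^ 3)"
        by (intro mult_left_mono) auto
      also have "\<dots> = ennreal (2 * \<kappa>)"
      proof -
        have "s powr - 3 * s ^ 3 = 1"
          using 2 by (simp add: powr_add[symmetric] flip: powr_numeral)
        then show ?thesis
          using 2 \<kappa>_pos by (simp add: ennreal_mult'[symmetric] mult_ac)
      qed
      finally show ?thesis using 2 by (simp add: add_increasing2)
    next
      case 3
      have "emeasure lborel (ball (0::vec3) r \<inter> cball 0 s) \<le> ennreal (\<kappa> * r ^ 3)"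
        using emeasure_ball_vec3(1)[of r 0] r by (metis Int_lower1 emeasure_mono less_imp_le sets_lborel borel_open open_ball)
      then show ?thesis using 3 r by (simp add: mult.commute[of _ "ennreal (2 * s powr - 3)"] mult_left_mono)
    qed (auto simp: indicator_def)
  qed
  also have "\<dots> = ennreal (2 * \<kappa>) * ennreal r + ennreal (\<kappa> * r ^ 3) * ennreal (r powr - 2)"
    using r nn_integral_powr_tail[of 2 r]
    by (subst nn_integral_add) (auto simp: nn_integral_cmult nn_integral_cmult_indicator)
  also have "\<dots> = ennreal (3 * \<kappa> * r)"
  proof -
    have "r ^ 3 * r powr - 2 = r"
      using r by (simp add: powr_add[symmetric] flip: powr_numeral)
    then show ?thesis
      using r \<kappa>_pos by (simp add: ennreal_mult'[symmetric] ennreal_plus[symmetric] mult.assoc del: ennreal_plus)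
  qed
  finally show ?thesis .
qed

lemma nn_integral_norm_tail:
  assumes r: "0 < r"
  shows "(\<integral>\<^sup>+(x::vec3). ennreal (norm x powr - 4) * indicator (- ball 0 r) x \<partial>lborel) \<le> ennreal (4 * \<kappa> / r)"
proof -
  have "(\<integral>\<^sup>+(x::vec3). ennreal (norm x powr - 4) * indicator (- ball 0 r) x \<partial>lborel)
    = (\<integral>\<^sup>+s. ennreal (4 * s powr (- 4 - 1)) * indicator {0<..} s * emeasure lborel (- ball (0::vec3) r \<inter> cball 0 s) \<partial>lborel)"
    by (rule layer_cake_norm) auto
  \<comment> \<open>Bounding the shell by the full ball of radius \<open>s\<close> gives the factor
    4 \<kappa>, while the exact integral is 3 \<kappa> / r.\<close>
  also have "\<dots> \<le> (\<integral>\<^sup>+s. ennreal (4 * \<kappa>) * (ennreal (1 * s powr (- 1 - 1)) * indicator {r..} s) \<partial>lborel)"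
  proof (rule nn_integral_mono)
    fix s :: real
    consider "s < r" | "r \<le> s" by linarith
    then show "ennreal (4 * s powr (- 4 - 1)) * indicator {0<..} s * emeasure lborel (- ball (0::vec3) r \<inter> cball 0 s)
       \<le> ennreal (4 * \<kappa>) * (ennreal (1 * s powr (- 1 - 1)) * indicator {r..} s)"
    proof cases
      case 1
      then have "- ball (0::vec3) r \<inter> cball 0 s = {}" by auto
      then show ?thesis by simp
    next
      case 2
      have "emeasure lborel (- ball (0::vec3) r \<inter> cball 0 s) \<le> ennreal (\<kappa> * s ^ 3)"
        using emeasure_ball_vec3(2)[of s 0] 2 r emeasure_mono[of "- ball (0::vec3) r \<inter> cball 0 s" "cball 0 s" lborel] by simp
      then have "ennreal (4 * s powr (- 4 - 1)) * emeasure lborel (- ball (0::vec3) r \<inter> cball 0 s) \<le> ennreal (4 * s powr (- 4 - 1)) * ennreal (\<kappa> * s ^ 3)"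
        by (intro mult_left_mono) auto
      also have "\<dots> = ennreal (4 * \<kappa>) * ennreal (1 * s powr (- 1 - 1))"
      proof -
        have "s powr - 5 * s ^ 3 = s powr - 2"
          using 2 r by (simp add: powr_add[symmetric] flip: powr_numeral)
        then show ?thesis
          using 2 r \<kappa>_pos by (simp add: ennreal_mult'[symmetric] mult_ac)
      qed
      finally show ?thesis using 2 r by (auto simp: indicator_def)
    qed
  qed
  also have "\<dots> = ennreal (4 * \<kappa>) * ennreal (r powr - 1)"
    using nn_integral_powr_tail[of 1 r] r by (subst nn_integral_cmult) (simp_all only:, measurable)
  also have "\<dots> = ennreal (4 * \<kappa> / r)"
    using r \<kappa>_pos by (simp add: ennreal_mult'[symmetric] powr_minus_divide)
  finally show ?thesis .
qed

text \<open>Hoelder's inequality with exponents 5/3 and 5/2 in the form of a weighted Young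
  inequality. The weight \<open>\<mu>\<close> is fitted so that both terms scale like r^(-4/5),
  which is how the L^(5/2)-norm of the kernel outside a ball of radius \<open>r\<close>
  scales.\<close>

lemma riesz_far_part:
  assumes \<rho>[measurable]: "\<rho> \<in> borel_measurable borel" and \<rho>0: "\<And>y::vec3. 0 \<le> \<rho> y"
    and N: "(\<integral>\<^sup>+y. ennreal (\<rho> y powr (5/3)) \<partial>lborel) \<le> 1" and r: "0 < r"
  shows "(\<integral>\<^sup>+y. ennreal (\<rho> y * norm (x - y) powr - 2) * indicator (- ball x r) y \<partial>lborel)
    \<le> ennreal ((3/5 + 8/5 * \<kappa>) * r powr - (4/5))"
proof -
  define \<mu> where "\<mu> = r powr (12/25)"
  have \<mu>: "0 < \<mu>" using r by (simp add: \<mu>_def)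
  have "(\<integral>\<^sup>+y. ennreal (\<rho> y * norm (x - y) powr - 2) * indicator (- ball x r) y \<partial>lborel)
    \<le> (\<integral>\<^sup>+y. ennreal (3/5 * r powr - (4/5)) * ennreal (\<rho> y powr (5/3))
        + ennreal (2/5 * r powr (1/5)) * (ennreal (norm (x - y) powr - 4) * indicator (- ball 0 r) (x - y)) \<partial>lborel)"
  proof (rule nn_integral_mono)
    fix y
    show "ennreal (\<rho> y * norm (x - y) powr - 2) * indicator (- ball x r) y
      \<le> ennreal (3/5 * r powr - (4/5)) * ennreal (\<rho> y powr (5/3))
        + ennreal (2/5 * r powr (1/5)) * (ennreal (norm (x - y) powr - 4) * indicator (- ball 0 r) (x - y))"
    proof (cases "r \<le> norm (x - y)")
      case True
      define n where "n = norm (x - y)"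
      have n: "r \<le> n" "0 < n" using True r by (auto simp: n_def)
      have "(\<rho> y / \<mu>) * (\<mu> * n powr - 2) \<le> (\<rho> y / \<mu>) powr (5/3) / (5/3) + (\<mu> * n powr - 2) powr (5/2) / (5/2)"
        by (rule Youngs_inequality) (use \<rho>0[of y] \<mu> in auto)
      also have "(\<rho> y / \<mu>) powr (5/3) / (5/3) = 3/5 * r powr - (4/5) * \<rho> y powr (5/3)"
        using \<rho>0[of y] r by (simp add: powr_divide \<mu>_def powr_powr powr_minus field_simps)
      also have "(\<mu> * n powr - 2) powr (5/2) / (5/2) = 2/5 * r powr (6/5) * n powr - 5"
        using n r by (simp add: powr_mult \<mu>_def powr_powr)
      \<comment> \<open>One power of the distance is traded for r^(-1), so that the tail integral of
        |z|^(-4) suffices; the scaling in \<open>r\<close> is unchanged.\<close>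
      also have "n powr - 5 = n powr - 4 * n powr - 1"
        using powr_add[of n "- 4" "- 1"] by simp
      also have "2/5 * r powr (6/5) * (n powr - 4 * n powr - 1) \<le> 2/5 * r powr (6/5) * (n powr - 4 * r powr - 1)"
        using n r by (intro mult_left_mono powr_mono2') auto
      also have "\<dots> = 2/5 * (r powr (6/5) * r powr - 1) * n powr - 4" by (simp add: algebra_simps)
      also have "r powr (6/5) * r powr - 1 = r powr (1/5)" using powr_add[of r "6/5" "- 1"] by simp
      finally have "\<rho> y * n powr - 2 \<le> 3/5 * r powr - (4/5) * \<rho> y powr (5/3) + 2/5 * r powr (1/5) * n powr - 4"
        using \<mu> by simp
      then have "ennreal (\<rho> y * n powr - 2) \<le> ennreal (3/5 * r powr - (4/5) * \<rho> y powr (5/3) + 2/5 * r powr (1/5) * n powr - 4)"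
        by (rule ennreal_leI)
      also have "\<dots> = ennreal (3/5 * r powr - (4/5)) * ennreal (\<rho> y powr (5/3)) + ennreal (2/5 * r powr (1/5)) * ennreal (n powr - 4)"
        by (simp add: ennreal_mult'[symmetric] ennreal_plus[symmetric] del: ennreal_plus)
      finally have le: "ennreal (\<rho> y * n powr - 2) \<le> \<dots>" .
      have i: "indicator (- ball x r) y = (1::ennreal)" "indicator (- ball 0 r) (x - y) = (1::ennreal)"
        using True by (simp_all add: dist_norm indicator_def norm_minus_commute)
      show ?thesis using le unfolding i n_def by (simp only: mult_1_right)
    qed (auto simp: dist_norm indicator_def)
  qed
  also have "\<dots> = ennreal (3/5 * r powr - (4/5)) * (\<integral>\<^sup>+y. ennreal (\<rho> y powr (5/3)) \<partial>lborel)
      + ennreal (2/5 * r powr (1/5)) * (\<integral>\<^sup>+y. ennreal (norm (x - y) powr - 4) * indicator (- ball 0 r) (x - y) \<partial>lborel)"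
    by (subst nn_integral_add) (auto simp: nn_integral_cmult)
  also have "(\<integral>\<^sup>+y. ennreal (norm (x - y) powr - 4) * indicator (- ball 0 r) (x - y) \<partial>lborel)
      = (\<integral>\<^sup>+(y::vec3). ennreal (norm y powr - 4) * indicator (- ball 0 r) y \<partial>lborel)"
    by (rule lborel_nn_integral_reflect) auto
  also have "ennreal (3/5 * r powr - (4/5)) * (\<integral>\<^sup>+y. ennreal (\<rho> y powr (5/3)) \<partial>lborel) + ennreal (2/5 * r powr (1/5)) * \<dots>
    \<le> ennreal (3/5 * r powr - (4/5)) * 1 + ennreal (2/5 * r powr (1/5)) * ennreal (4 * \<kappa> / r)"
    by (intro add_mono mult_left_mono N nn_integral_norm_tail[OF r]) auto
  also have "\<dots> = ennreal ((3/5 + 8/5 * \<kappa>) * r powr - (4/5))"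
  proof -
    have "r powr (1/5) = r powr - (4/5) * r" using r powr_mult_base[of r "- (4/5)"] by (simp add: mult.commute)
    then show ?thesis
      using r \<kappa>_pos by (simp add: ennreal_mult'[symmetric] ennreal_plus[symmetric] field_simps del: ennreal_plus)
  qed
  finally show ?thesis .
qed

lemma nn_integral_norm_ball_translate:
  assumes r: "0 < r"
  shows "(\<integral>\<^sup>+(x::vec3). ennreal (norm (y - x) powr - 2) * indicator (ball y r) x \<partial>lborel) \<le> ennreal (3 * \<kappa> * r)"
proof -
  have "(\<integral>\<^sup>+(x::vec3). ennreal (norm (y - x) powr - 2) * indicator (ball y r) x \<partial>lborel)
     = (\<integral>\<^sup>+(x::vec3). ennreal (norm (y - x) powr - 2) * indicator (ball 0 r) (y - x) \<partial>lborel)"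
    by (intro nn_integral_cong) (simp add: indicator_def dist_norm norm_minus_commute)
  also have "\<dots> = (\<integral>\<^sup>+(x::vec3). ennreal (norm x powr - 2) * indicator (ball 0 r) x \<partial>lborel)"
    by (rule lborel_nn_integral_reflect) auto
  finally show ?thesis using nn_integral_norm_ball[OF r] by simp
qed

text \<open>If \<open>u x > \<lambda>\<close>, then the far part of the kernel and the part of \<open>\<rho>\<close> below a suitable height
  contribute at most \<open>\<lambda> / 2\<close>, so the near part of the peaks of \<open>\<rho>\<close> contributes the rest.
  Its \<open>L\<^sup>1\<close>-norm is controlled by Tonelli, and integrating over all levels gives the estimate
  directly, without interpolation or maximal functions.\<close>

lemma HLS_normalized:
  "\<exists>C>0. \<forall>\<rho> u. \<rho> \<in> borel_measurable borel \<longrightarrow> u \<in> borel_measurable borel \<longrightarrow>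
      (\<forall>y::vec3. 0 \<le> \<rho> y) \<longrightarrow> (\<forall>x::vec3. 0 \<le> u x) \<longrightarrow>
      (\<integral>\<^sup>+y. ennreal (\<rho> y powr (5/3)) \<partial>lborel) \<le> 1 \<longrightarrow>
      (\<forall>x. ennreal (u x) \<le> (\<integral>\<^sup>+y. ennreal (\<rho> y * norm (x - y) powr - 2) \<partial>lborel)) \<longrightarrow>
      (\<integral>\<^sup>+x. ennreal (u x powr (15/4)) \<partial>lborel) \<le> ennreal C"
proof -
  define K where "K = 3 * \<kappa>"
  define c where "c = 3/5 + 8/5 * \<kappa>"
  have K: "0 < K" and c: "0 < c" using \<kappa>_pos by (auto simp: K_def c_def add_pos_pos)
  \<comment> \<open>The radius \<open>r l\<close> makes the far part equal to l / 4, and the height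
    \<open>a l\<close> makes the part of the density below it contribute l / 4 inside that radius.
    The constants \<open>d\<close>, \<open>B\<close> and \<open>A\<close> are forced by these two
    equations.\<close>
  define d where "d = 4 * c"
  have d: "0 < d" using c by (simp add: d_def)
  define B where "B = d powr (5/4)"
  define r where "r l = B * l powr - (5/4)" for l :: real
  define A where "A = 4 * K * B"
  define a where "a l = l powr (9/4) / A" for l :: real
  have B: "0 < B" and A: "0 < A" using d K by (auto simp: B_def A_def)
  have r: "0 < r l" if "0 < l" for l using that B by (auto simp: r_def)
  have far: "c * r l powr - (4/5) = l / 4" if "0 < l" for l
  proof -
    have "r l powr - (4/5) = d powr - 1 * l powr 1"
      using that d by (simp only: r_def B_def powr_mult powr_powr) simp
    also have "\<dots> = l / (4 * c)" using that d by (simp add: powr_minus_divide d_def)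
    finally show ?thesis using c by simp
  qed
  have near: "a l * (K * r l) = l / 4" if "0 < l" for l
  proof -
    have "l powr (9/4) * l powr - (5/4) = l" using that by (simp add: powr_add[symmetric])
    then show ?thesis using B K by (simp add: a_def A_def r_def field_simps)
  qed
  have rm[measurable]: "r \<in> borel_measurable borel" and am[measurable]: "a \<in> borel_measurable borel"
    unfolding r_def a_def by measurable
  define C where "C = 15/2 * K * B * (2/3 * A powr (2/3))"
  have C: "0 < C" using K B A by (auto simp: C_def)
  show ?thesis
  proof (intro exI[of _ C] conjI C allI impI)
    fix \<rho> u :: "vec3 \<Rightarrow> real"
    assume \<rho>m[measurable]: "\<rho> \<in> borel_measurable borel" and um[measurable]: "u \<in> borel_measurable borel"
      and \<rho>0: "\<forall>y. 0 \<le> \<rho> y" and u0: "\<forall>x. 0 \<le> u x"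
      and N: "(\<integral>\<^sup>+y. ennreal (\<rho> y powr (5/3)) \<partial>lborel) \<le> 1"
      and u: "\<forall>x. ennreal (u x) \<le> (\<integral>\<^sup>+y. ennreal (\<rho> y * norm (x - y) powr - 2) \<partial>lborel)"
    \<comment> \<open>What remains of the kernel integral: near points at which the density exceeds
      the height \<open>a l\<close>.\<close>
    define Q where "Q l x y = (if a l < \<rho> y \<and> norm (y - x) < r l then ennreal (\<rho> y) * ennreal (norm (y - x) powr - 2) else 0)" for l x y
    have Qm[measurable (raw)]: "(\<lambda>z. Q (l z) (x z) (y z)) \<in> borel_measurable M"
      if [measurable]: "l \<in> borel_measurable M" "x \<in> borel_measurable M" "y \<in> borel_measurable M" for l x y M
      unfolding Q_def by measurable
    have peak: "ennreal l \<le> 2 * (\<integral>\<^sup>+y. Q l x y \<partial>lborel)" if l: "0 < l" "l < u x" for l x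
    proof -
      have "ennreal l \<le> (\<integral>\<^sup>+y. ennreal (\<rho> y * norm (x - y) powr - 2) \<partial>lborel)"
        by (rule order_trans[OF ennreal_leI u[rule_format]]) (use l in simp)
      also have "\<dots> \<le> (\<integral>\<^sup>+y. (Q l x y + ennreal (a l) * (ennreal (norm (x - y) powr - 2) * indicator (ball x (r l)) y))
           + ennreal (\<rho> y * norm (x - y) powr - 2) * indicator (- ball x (r l)) y \<partial>lborel)"
      proof (rule nn_integral_mono)
        fix y
        consider "r l \<le> norm (x - y)" | "norm (x - y) < r l" "a l < \<rho> y" | "norm (x - y) < r l" "\<rho> y \<le> a l" by linarith
        then show "ennreal (\<rho> y * norm (x - y) powr - 2) \<le> (Q l x y + ennreal (a l) * (ennreal (norm (x - y) powr - 2) * indicator (ball x (r l)) y))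
           + ennreal (\<rho> y * norm (x - y) powr - 2) * indicator (- ball x (r l)) y"
        proof cases
          case 1 then show ?thesis by (simp add: indicator_def dist_norm)
        next
          case 2 then show ?thesis using \<rho>0 by (simp add: Q_def ennreal_mult norm_minus_commute)
        next
          case 3
          then have "ennreal (\<rho> y * norm (x - y) powr - 2) \<le> ennreal (a l) * ennreal (norm (x - y) powr - 2)"
            using \<rho>0 by (auto simp: ennreal_mult intro!: mult_right_mono ennreal_leI)
          also have "\<dots> = ennreal (a l) * (ennreal (norm (x - y) powr - 2) * indicator (ball x (r l)) y)"
            using 3 by (simp add: dist_norm)
          finally show ?thesis by (rule order_trans) (simp add: add_increasing add_increasing2)
        qed
      qed
      also have "\<dots> = ((\<integral>\<^sup>+y. Q l x y \<partial>lborel) + ennreal (a l) * (\<integral>\<^sup>+y. ennreal (norm (x - y) powr - 2) * indicator (ball x (r l)) y \<partial>lborel))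
           + (\<integral>\<^sup>+y. ennreal (\<rho> y * norm (x - y) powr - 2) * indicator (- ball x (r l)) y \<partial>lborel)"
        by (simp add: nn_integral_add nn_integral_cmult)
      also have "\<dots> \<le> ((\<integral>\<^sup>+y. Q l x y \<partial>lborel) + ennreal (a l) * ennreal (K * r l)) + ennreal (c * r l powr - (4/5))"
        unfolding K_def c_def
        by (intro add_mono mult_left_mono order_refl nn_integral_norm_ball_translate riesz_far_part r l \<rho>m N) (use \<rho>0 in auto)
      also have "\<dots> = (\<integral>\<^sup>+y. Q l x y \<partial>lborel) + (ennreal (l / 4) + ennreal (l / 4))"
      proof -
        have "ennreal (a l) * ennreal (K * r l) = ennreal (a l * (K * r l))"
          using K r[OF l(1)] by (simp add: ennreal_mult'')
        then show ?thesis by (simp only: near[OF l(1)] far[OF l(1)] add.assoc)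
      qed
      also have "\<dots> = (\<integral>\<^sup>+y. Q l x y \<partial>lborel) + ennreal (l / 2)"
        using l by (simp add: ennreal_plus[symmetric] del: ennreal_plus)
      finally have le: "ennreal l \<le> (\<integral>\<^sup>+y. Q l x y \<partial>lborel) + ennreal (l / 2)" .
      show ?thesis
      proof (cases "(\<integral>\<^sup>+y. Q l x y \<partial>lborel)")
        case (real q)
        with le l have "l \<le> q + l / 2" by (simp add: ennreal_plus[symmetric] del: ennreal_plus)
        then have "ennreal l \<le> ennreal (2 * q)" by (intro ennreal_leI) simp
        then show ?thesis using real by (simp add: ennreal_mult)
      qed (simp add: ennreal_mult_top)
    qed
    \<comment> \<open>The levels of \<open>u\<close> are integrated with weight 15/4 l^(11/4). One
      factor \<open>l\<close> is replaced by the peak bound, which leaves 15/2 l^(7/4).\<close>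
    have "(\<integral>\<^sup>+x. ennreal (u x powr (15/4)) \<partial>lborel)
       = (\<integral>\<^sup>+x. (\<integral>\<^sup>+l. ennreal (15/4) * (ennreal (l powr (11/4)) * indicator {0..u x} l) \<partial>lborel) \<partial>lborel)"
      using nn_integral_powr_from_0[of "11/4"] u0
      by (intro nn_integral_cong) (simp add: nn_integral_cmult ennreal_mult'[symmetric])
    also have "\<dots> \<le> (\<integral>\<^sup>+x. (\<integral>\<^sup>+l. ennreal (15/2) * (ennreal (l powr (7/4)) * indicator {0<..} l * (\<integral>\<^sup>+y. Q l x y \<partial>lborel)) \<partial>lborel) \<partial>lborel)"
    proof (rule nn_integral_mono, rule nn_integral_mono_AE)
      fix x
      show "AE l in lborel. ennreal (15/4) * (ennreal (l powr (11/4)) * indicator {0..u x} l)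
         \<le> ennreal (15/2) * (ennreal (l powr (7/4)) * indicator {0<..} l * (\<integral>\<^sup>+y. Q l x y \<partial>lborel))"
        using AE_lborel_singleton[of 0] AE_lborel_singleton[of "u x"]
      proof eventually_elim
        case (elim l)
        show ?case
        proof (cases "0 < l \<and> l < u x")
          case True
          have "ennreal (15/4) * ennreal (l powr (11/4)) = ennreal (15/4) * ennreal (l powr (7/4)) * ennreal l"
            using True by (simp add: ennreal_mult'[symmetric] powr_mult_base mult.commute[of _ l])
          also have "\<dots> \<le> ennreal (15/4) * ennreal (l powr (7/4)) * (2 * (\<integral>\<^sup>+y. Q l x y \<partial>lborel))"
            by (intro mult_left_mono peak) (use True in auto)
          also have "\<dots> = ennreal (15/4) * ennreal 2 * (ennreal (l powr (7/4)) * (\<integral>\<^sup>+y. Q l x y \<partial>lborel))"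
            by (simp add: mult_ac)
          also have "ennreal (15/4) * ennreal 2 = ennreal (15/2)" by (subst ennreal_mult'[symmetric]) auto
          finally show ?thesis using True by simp
        next
          case False
          then have "l \<notin> {0..u x}" using elim by auto
          then show ?thesis by simp
        qed
      qed
    qed
    also have "\<dots> = (\<integral>\<^sup>+l. (\<integral>\<^sup>+x. ennreal (15/2) * (ennreal (l powr (7/4)) * indicator {0<..} l * (\<integral>\<^sup>+y. Q l x y \<partial>lborel)) \<partial>lborel) \<partial>lborel)"
      by (rule lborel_pair.Fubini') measurable
    also have "\<dots> = (\<integral>\<^sup>+l. ennreal (15/2) * (ennreal (l powr (7/4)) * indicator {0<..} l * (\<integral>\<^sup>+x. (\<integral>\<^sup>+y. Q l x y \<partial>lborel) \<partial>lborel)) \<partial>lborel)"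
      by (intro nn_integral_cong) (simp add: nn_integral_cmult)
    \<comment> \<open>For positive \<open>l\<close> the condition \<open>a l < \<rho> y\<close>
      implies \<open>l \<le> (A * \<rho> y) powr (4/9)\<close>. As an indicator of a difference this
      is plainly measurable in \<open>l\<close> and \<open>y\<close> jointly, and it makes the later
      integral over \<open>l\<close> finite.\<close>
    also have "\<dots> \<le> (\<integral>\<^sup>+l. ennreal (15/2) * (ennreal (l powr (7/4)) * indicator {0<..} l *
         (\<integral>\<^sup>+y. ennreal (\<rho> y) * ennreal (K * r l) * indicator {0..} ((A * \<rho> y) powr (4/9) - l) \<partial>lborel)) \<partial>lborel)"
    proof (rule nn_integral_mono, rule mult_left_mono)
      fix l :: real
      show "ennreal (l powr (7/4)) * indicator {0<..} l * (\<integral>\<^sup>+x. (\<integral>\<^sup>+y. Q l x y \<partial>lborel) \<partial>lborel)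
        \<le> ennreal (l powr (7/4)) * indicator {0<..} l * (\<integral>\<^sup>+y. ennreal (\<rho> y) * ennreal (K * r l) * indicator {0..} ((A * \<rho> y) powr (4/9) - l) \<partial>lborel)"
      proof (cases "0 < l")
        case True
        have "(\<integral>\<^sup>+x. (\<integral>\<^sup>+y. Q l x y \<partial>lborel) \<partial>lborel) = (\<integral>\<^sup>+y. (\<integral>\<^sup>+x. Q l x y \<partial>lborel) \<partial>lborel)"
          by (rule lborel_pair.Fubini') measurable
        also have "\<dots> \<le> (\<integral>\<^sup>+y. ennreal (\<rho> y) * ennreal (K * r l) * indicator {0..} ((A * \<rho> y) powr (4/9) - l) \<partial>lborel)"
        proof (rule nn_integral_mono)
          fix y
          show "(\<integral>\<^sup>+x. Q l x y \<partial>lborel) \<le> ennreal (\<rho> y) * ennreal (K * r l) * indicator {0..} ((A * \<rho> y) powr (4/9) - l)"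
          proof (cases "a l < \<rho> y")
            case False then show ?thesis by (simp add: Q_def)
          next
            case a: True
            have "(\<integral>\<^sup>+x. Q l x y \<partial>lborel) = (\<integral>\<^sup>+x. ennreal (\<rho> y) * (ennreal (norm (y - x) powr - 2) * indicator (ball y (r l)) x) \<partial>lborel)"
              using a by (intro nn_integral_cong) (simp add: Q_def indicator_def dist_norm)
            also have "\<dots> \<le> ennreal (\<rho> y) * ennreal (K * r l)"
              unfolding K_def using nn_integral_norm_ball_translate[OF r[OF True], of y]
              by (subst nn_integral_cmult) (auto intro: mult_left_mono)
            also have "l \<le> (A * \<rho> y) powr (4/9)"
            proof -
              have "l powr (9/4) \<le> A * \<rho> y" using a A by (simp add: a_def field_simps)
              then have "(l powr (9/4)) powr (4/9) \<le> (A * \<rho> y) powr (4/9)" by (intro powr_mono2) auto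
              then show ?thesis using True by (simp add: powr_powr)
            qed
            then have "ennreal (\<rho> y) * ennreal (K * r l) = ennreal (\<rho> y) * ennreal (K * r l) * indicator {0..} ((A * \<rho> y) powr (4/9) - l)"
              by simp
            finally show ?thesis .
          qed
        qed
        finally show ?thesis by (rule mult_left_mono) simp
      qed simp
    qed simp
    also have "\<dots> = (\<integral>\<^sup>+l. (\<integral>\<^sup>+y. ennreal (15/2 * K * B) * ennreal (\<rho> y) * (ennreal (l powr (1/2)) * (indicator {0..} l * indicator {0..} ((A * \<rho> y) powr (4/9) - l))) \<partial>lborel) \<partial>lborel)"
    proof (intro nn_integral_cong_AE)
      show "AE l in lborel. ennreal (15/2) * (ennreal (l powr (7/4)) * indicator {0<..} l *
         (\<integral>\<^sup>+y. ennreal (\<rho> y) * ennreal (K * r l) * indicator {0..} ((A * \<rho> y) powr (4/9) - l) \<partial>lborel)) =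
         (\<integral>\<^sup>+y. ennreal (15/2 * K * B) * ennreal (\<rho> y) * (ennreal (l powr (1/2)) * (indicator {0..} l * indicator {0..} ((A * \<rho> y) powr (4/9) - l))) \<partial>lborel)"
        using AE_lborel_singleton[of 0]
      proof eventually_elim
        case (elim l)
        show ?case
        proof (cases "0 < l")
          case True
          have "l powr (7/4) * l powr - (5/4) = l powr (1/2)" using True by (simp add: powr_add[symmetric])
          then have p: "15/2 * (l powr (7/4) * (K * r l)) = 15/2 * K * B * l powr (1/2)" by (simp add: r_def algebra_simps)
          have "ennreal (15/2) * (ennreal (l powr (7/4)) * indicator {0<..} l *
             (\<integral>\<^sup>+y. ennreal (\<rho> y) * ennreal (K * r l) * indicator {0..} ((A * \<rho> y) powr (4/9) - l) \<partial>lborel)) =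
             (\<integral>\<^sup>+y. ennreal (15/2) * (ennreal (l powr (7/4)) * (ennreal (\<rho> y) * ennreal (K * r l) * indicator {0..} ((A * \<rho> y) powr (4/9) - l))) \<partial>lborel)"
          proof -
            have m: "(\<lambda>y. ennreal (\<rho> y) * ennreal (K * r l) * indicator {0..} ((A * \<rho> y) powr (4/9) - l)) \<in> borel_measurable lborel"
              by measurable
            have "(\<lambda>y. ennreal (l powr (7/4)) * (ennreal (\<rho> y) * ennreal (K * r l) * indicator {0..} ((A * \<rho> y) powr (4/9) - l))) \<in> borel_measurable lborel"
              by measurable
            from nn_integral_cmult[OF this] nn_integral_cmult[OF m] True show ?thesis by simp
          qed
          also have "\<dots> = (\<integral>\<^sup>+y. ennreal (15/2 * (l powr (7/4) * (K * r l))) * ennreal (\<rho> y) * indicator {0..} ((A * \<rho> y) powr (4/9) - l) \<partial>lborel)"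
          proof -
            have "ennreal (15/2 * (l powr (7/4) * (K * r l))) = ennreal (15/2) * (ennreal (l powr (7/4)) * ennreal (K * r l))"
              using r[OF True] K by (simp only: ennreal_mult' ennreal_mult'' powr_ge_zero mult_nonneg_nonneg less_imp_le)
            then show ?thesis by (simp only: mult_ac)
          qed
          also have "\<dots> = (\<integral>\<^sup>+y. ennreal (15/2 * K * B) * ennreal (\<rho> y) * (ennreal (l powr (1/2)) * (indicator {0..} l * indicator {0..} ((A * \<rho> y) powr (4/9) - l))) \<partial>lborel)"
            proof -
            have "ennreal (15/2 * K * B * l powr (1/2)) = ennreal (15/2 * K * B) * ennreal (l powr (1/2))"
              by (simp only: ennreal_mult'' powr_ge_zero)
            moreover have "indicator {0..} l = (1::ennreal)" using True by simp
            ultimately show ?thesis unfolding p by (simp only: mult_ac mult_1_left mult_1_right)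
          qed
          finally show ?thesis .
        qed (use elim in simp)
      qed
    qed
    also have "\<dots> = (\<integral>\<^sup>+y. (\<integral>\<^sup>+l. ennreal (15/2 * K * B) * ennreal (\<rho> y) * (ennreal (l powr (1/2)) * (indicator {0..} l * indicator {0..} ((A * \<rho> y) powr (4/9) - l))) \<partial>lborel) \<partial>lborel)"
      by (rule lborel_pair.Fubini') measurable
    \<comment> \<open>Since l^(7/4) times the radius is a multiple of l^(1/2), integrating up to (A
      \<rho>)^(4/9) gives 2/3 (A \<rho>)^(2/3). The remaining factor \<rho> completes the power 5/3,
      and the coefficients collected on the way are those of \<open>C\<close>.\<close>
    also have "\<dots> = (\<integral>\<^sup>+y. ennreal C * ennreal (\<rho> y powr (5/3)) \<partial>lborel)"
    proof (rule nn_integral_cong)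
      fix y
      have "(\<integral>\<^sup>+l. ennreal (15/2 * K * B) * ennreal (\<rho> y) * (ennreal (l powr (1/2)) * (indicator {0..} l * indicator {0..} ((A * \<rho> y) powr (4/9) - l))) \<partial>lborel)
         = ennreal (15/2 * K * B) * ennreal (\<rho> y) * ennreal (2/3 * ((A * \<rho> y) powr (4/9)) powr (3/2))"
      proof -
        have i: "indicator {0..} l * indicator {0..} ((A * \<rho> y) powr (4/9) - l) = (indicator {0..(A * \<rho> y) powr (4/9)} l :: ennreal)" for l
          by (simp add: indicator_def)
        show ?thesis
          using nn_integral_powr_from_0[of "1/2" "(A * \<rho> y) powr (4/9)"] unfolding i by (simp add: nn_integral_cmult mult.commute[of 2])
      qed
      also have "\<dots> = ennreal (C * (\<rho> y * \<rho> y powr (2/3)))"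
        using K B A \<rho>0 by (simp add: ennreal_mult'[symmetric] powr_powr powr_mult C_def algebra_simps)
      also have "\<rho> y * \<rho> y powr (2/3) = \<rho> y powr (5/3)" using \<rho>0 by (cases "\<rho> y = 0") (auto simp: powr_mult_base)
      finally show "(\<integral>\<^sup>+l. ennreal (15/2 * K * B) * ennreal (\<rho> y) * (ennreal (l powr (1/2)) * (indicator {0..} l * indicator {0..} ((A * \<rho> y) powr (4/9) - l))) \<partial>lborel) = ennreal C * ennreal (\<rho> y powr (5/3))"
        using C by (simp add: ennreal_mult)
    qed
    also have "\<dots> = ennreal C * (\<integral>\<^sup>+y. ennreal (\<rho> y powr (5/3)) \<partial>lborel)" by (simp add: nn_integral_cmult)
    also have "\<dots> \<le> ennreal C * 1" by (intro mult_left_mono N) simp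
    finally show "(\<integral>\<^sup>+x. ennreal (u x powr (15/4)) \<partial>lborel) \<le> ennreal C" by simp
  qed
qed

text \<open>The inequality is packaged as a property of its constant, so that one universal
  \<open>C\<close> can be fixed as a locale parameter before any solution is considered. The power
  9/4 is the quotient of 15/4 by 5/3, as homogeneity demands.\<close>

definition HLS_bound :: "real \<Rightarrow> bool" where
  "HLS_bound C \<longleftrightarrow> (\<forall>\<rho> u N. \<rho> \<in> borel_measurable borel \<longrightarrow> u \<in> borel_measurable borel \<longrightarrow>
      (\<forall>y::vec3. 0 \<le> \<rho> y) \<longrightarrow> (\<forall>x::vec3. 0 \<le> u x) \<longrightarrow> 0 < N \<longrightarrow>
      (\<integral>\<^sup>+y. ennreal (\<rho> y powr (5/3)) \<partial>lborel) \<le> ennreal N \<longrightarrow>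
      (\<forall>x. ennreal (u x) \<le> (\<integral>\<^sup>+y. ennreal (\<rho> y * norm (x - y) powr - 2) \<partial>lborel)) \<longrightarrow>
      (\<integral>\<^sup>+x. ennreal (u x powr (15/4)) \<partial>lborel) \<le> ennreal (C * N powr (9/4)))"

lemma HLS: "\<exists>C>0. HLS_bound C"
proof -
  from HLS_normalized obtain C where C: "0 < C" and *: "\<forall>\<rho> u. \<rho> \<in> borel_measurable borel \<longrightarrow> u \<in> borel_measurable borel \<longrightarrow>
      (\<forall>y::vec3. 0 \<le> \<rho> y) \<longrightarrow> (\<forall>x::vec3. 0 \<le> u x) \<longrightarrow>
      (\<integral>\<^sup>+y. ennreal (\<rho> y powr (5/3)) \<partial>lborel) \<le> 1 \<longrightarrow>
      (\<forall>x. ennreal (u x) \<le> (\<integral>\<^sup>+y. ennreal (\<rho> y * norm (x - y) powr - 2) \<partial>lborel)) \<longrightarrow>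
      (\<integral>\<^sup>+x. ennreal (u x powr (15/4)) \<partial>lborel) \<le> ennreal C"
    by (elim exE conjE)
  show ?thesis
    unfolding HLS_bound_def
  proof (intro exI[of _ C] conjI C allI impI)
    fix \<rho> u :: "vec3 \<Rightarrow> real" and N :: real
    assume \<rho>m[measurable]: "\<rho> \<in> borel_measurable borel" and um[measurable]: "u \<in> borel_measurable borel"
      and \<rho>0: "\<forall>y. 0 \<le> \<rho> y" and u0: "\<forall>x. 0 \<le> u x" and N: "0 < N"
      and \<rho>N: "(\<integral>\<^sup>+y. ennreal (\<rho> y powr (5/3)) \<partial>lborel) \<le> ennreal N"
      and u: "\<forall>x. ennreal (u x) \<le> (\<integral>\<^sup>+y. ennreal (\<rho> y * norm (x - y) powr - 2) \<partial>lborel)"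
    \<comment> \<open>Multiplying the density by N^(-3/5) brings its L^(5/3)-norm to at most 1. The
      potential scales by the same factor, so its power integral scales back with N^(9/4).\<close>
    define n where "n = N powr - (3/5)"
    have n: "0 < n" using N by (simp add: n_def)
    have "n powr (5/3) = N powr - 1" by (simp add: n_def powr_powr)
    then have n53: "n powr (5/3) = 1 / N" using N by (simp add: powr_minus_divide)
    have "n powr (15/4) = N powr - (9/4)" by (simp add: n_def powr_powr)
    then have n154: "N powr (9/4) * (n powr (15/4) * z) = z" for z
      using N by (simp add: powr_minus_divide)
    have "(\<integral>\<^sup>+x. ennreal ((n * u x) powr (15/4)) \<partial>lborel) \<le> ennreal C"
    proof (rule *[rule_format])
      have "(\<integral>\<^sup>+y. ennreal ((n * \<rho> y) powr (5/3)) \<partial>lborel) = (\<integral>\<^sup>+y. ennreal (1 / N) * ennreal (\<rho> y powr (5/3)) \<partial>lborel)"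
        using n N \<rho>0 by (intro nn_integral_cong) (simp add: ennreal_mult'[symmetric] powr_mult n53)
      also have "\<dots> \<le> ennreal (1 / N) * ennreal N"
        by (subst nn_integral_cmult) (use \<rho>N in \<open>auto intro: mult_left_mono\<close>)
      also have "\<dots> = 1" using N by (simp add: ennreal_mult'[symmetric])
      finally show "(\<integral>\<^sup>+y. ennreal ((n * \<rho> y) powr (5/3)) \<partial>lborel) \<le> 1" .
      show "ennreal (n * u x) \<le> (\<integral>\<^sup>+y. ennreal (n * \<rho> y * norm (x - y) powr - 2) \<partial>lborel)" for x
      proof -
        have "ennreal (n * u x) \<le> ennreal n * (\<integral>\<^sup>+y. ennreal (\<rho> y * norm (x - y) powr - 2) \<partial>lborel)"
          using u n by (simp add: ennreal_mult' mult_left_mono)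
        also have "\<dots> = (\<integral>\<^sup>+y. ennreal (n * \<rho> y * norm (x - y) powr - 2) \<partial>lborel)"
          using n by (subst nn_integral_cmult[symmetric]) (auto simp: ennreal_mult'[symmetric] mult.assoc)
        finally show "ennreal (n * u x) \<le> (\<integral>\<^sup>+y. ennreal (n * \<rho> y * norm (x - y) powr - 2) \<partial>lborel)" .
      qed
    qed (use n \<rho>0 u0 in auto)
    then have le: "ennreal (N powr (9/4)) * (\<integral>\<^sup>+x. ennreal ((n * u x) powr (15/4)) \<partial>lborel) \<le> ennreal (N powr (9/4)) * ennreal C"
      by (rule mult_left_mono) simp
    have "(\<integral>\<^sup>+x. ennreal (u x powr (15/4)) \<partial>lborel) = (\<integral>\<^sup>+x. ennreal (N powr (9/4)) * ennreal ((n * u x) powr (15/4)) \<partial>lborel)"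
      using n N u0
      by (intro nn_integral_cong)
         (simp add: ennreal_mult'[symmetric] powr_mult n154)
    also have "\<dots> = ennreal (N powr (9/4)) * (\<integral>\<^sup>+x. ennreal ((n * u x) powr (15/4)) \<partial>lborel)"
      by (simp add: nn_integral_cmult)
    finally show "(\<integral>\<^sup>+x. ennreal (u x powr (15/4)) \<partial>lborel) \<le> ennreal (C * N powr (9/4))"
      using le C by (simp add: ennreal_mult'[symmetric] mult.commute)
  qed
qed

section \<open>Newtonian potentials of compactly supported densities\<close>

text \<open>The kernel carries the integration variable, so differentiating in \<open>x\<close>
  touches only the density and never the singularity.\<close>

definition conv :: "(vec3 \<Rightarrow> real) \<Rightarrow> (vec3 \<Rightarrow> real) \<Rightarrow> vec3 \<Rightarrow> real" where
  "conv k \<phi> x = (\<integral>z. k z * \<phi> (x - z) \<partial>lborel)"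

definition kernel_mass :: "real \<Rightarrow> real" where "kernel_mass R = \<kappa> * R ^ 3 + 4 * \<kappa> * R"

lemma kernel_mass_nonneg: "0 \<le> R \<Longrightarrow> 0 \<le> kernel_mass R"
  using \<kappa>_pos by (simp add: kernel_mass_def)

text \<open>Uniform in the position \<open>x\<close> of the singularity: within distance
  \<open>R\<close> of it the ball integral of |z|^(-2) applies, and farther away the singular term
  is at most R^(-2). The constant 1 gives \<kappa> R^3; the other two contributions, \<kappa> R and
  3 \<kappa> R, add up to 4 \<kappa> R.\<close>

lemma nn_integral_kernel_cball:
  fixes x :: vec3
  assumes R: "0 < R"
  shows "(\<integral>\<^sup>+y. ennreal (1 + norm (x - y) powr - 2) * indicator (cball 0 R) y \<partial>lborel) \<le> ennreal (kernel_mass R)"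
proof -
  have "(\<integral>\<^sup>+y. ennreal (1 + norm (x - y) powr - 2) * indicator (cball 0 R) y \<partial>lborel)
    \<le> (\<integral>\<^sup>+y. ennreal (1 + R powr - 2) * indicator (cball 0 R) y
         + ennreal (norm (x - y) powr - 2) * indicator (ball x R) y \<partial>lborel)"
  proof (rule nn_integral_mono)
    fix y
    show "ennreal (1 + norm (x - y) powr - 2) * indicator (cball 0 R) y
      \<le> ennreal (1 + R powr - 2) * indicator (cball 0 R) y + ennreal (norm (x - y) powr - 2) * indicator (ball x R) y"
    proof (cases "norm (x - y) < R")
      case True
      have "ennreal (1 + norm (x - y) powr - 2) \<le> ennreal (1 + R powr - 2) + ennreal (norm (x - y) powr - 2)"
        by (simp add: ennreal_plus[symmetric] ennreal_leI del: ennreal_plus)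
      then show ?thesis using True by (simp add: indicator_def dist_norm)
    next
      case False
      then have "ennreal (1 + norm (x - y) powr - 2) \<le> ennreal (1 + R powr - 2)"
        using R by (intro ennreal_leI add_left_mono powr_mono2') auto
      then show ?thesis using False by (simp add: indicator_def dist_norm)
    qed
  qed
  also have "\<dots> = ennreal (1 + R powr - 2) * ennreal (\<kappa> * R ^ 3)
     + (\<integral>\<^sup>+y. ennreal (norm (x - y) powr - 2) * indicator (ball x R) y \<partial>lborel)"
    using R by (subst nn_integral_add) (auto simp: nn_integral_cmult_indicator emeasure_ball_vec3)
  also have "\<dots> \<le> ennreal (1 + R powr - 2) * ennreal (\<kappa> * R ^ 3) + ennreal (3 * \<kappa> * R)"
    by (intro add_left_mono nn_integral_norm_ball_translate R)
  also have "\<dots> = ennreal (kernel_mass R)"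
  proof -
    have "R powr - 2 * R ^ 3 = R" using R by (simp add: powr_add[symmetric] flip: powr_numeral)
    then have "(1 + R powr - 2) * (\<kappa> * R ^ 3) + 3 * \<kappa> * R = kernel_mass R" by (simp add: kernel_mass_def algebra_simps)
    moreover have "ennreal (1 + R powr - 2) * ennreal (\<kappa> * R ^ 3) + ennreal (3 * \<kappa> * R) = ennreal ((1 + R powr - 2) * (\<kappa> * R ^ 3) + 3 * \<kappa> * R)"
      using R \<kappa>_pos by (subst ennreal_mult[symmetric]) (auto simp: ennreal_plus[symmetric] simp del: ennreal_plus)
    ultimately show ?thesis by simp
  qed
  finally show ?thesis .
qed

text \<open>One bound, locally integrable in three dimensions, that covers 1 / |z| as well as the
  components of its gradient.\<close>

locale kernel =
  fixes k :: "vec3 \<Rightarrow> real"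
  assumes kmeas [measurable]: "k \<in> borel_measurable borel"
    and kbnd: "\<bar>k z\<bar> \<le> 1 + norm z powr - 2"

locale bounded_density =
  fixes \<phi> :: "vec3 \<Rightarrow> real" and B R :: real
  assumes meas [measurable]: "\<phi> \<in> borel_measurable borel"
    and bnd: "\<bar>\<phi> x\<bar> \<le> B" and R: "0 < R" and supp: "norm x > R \<Longrightarrow> \<phi> x = 0"
begin

lemma B_nonneg: "0 \<le> B" using bnd[of 0] by linarith

lemma integrable: "integrable lborel \<phi>"
  using bnd supp by (intro integrable_bounded_support[of _ B R]) auto

lemma kernel_integrable:
  assumes "kernel k"
  shows "integrable lborel (\<lambda>y. k (x - y) * \<phi> y)"
    and "(\<integral>y. \<bar>k (x - y) * \<phi> y\<bar> \<partial>lborel) \<le> B * kernel_mass R"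
proof -
  interpret kernel k by fact
  have le: "(\<integral>\<^sup>+y. ennreal \<bar>k (x - y) * \<phi> y\<bar> \<partial>lborel) \<le> ennreal (B * kernel_mass R)"
  proof -
    have "(\<integral>\<^sup>+y. ennreal \<bar>k (x - y) * \<phi> y\<bar> \<partial>lborel)
      \<le> (\<integral>\<^sup>+y. ennreal B * (ennreal (1 + norm (x - y) powr - 2) * indicator (cball 0 R) y) \<partial>lborel)"
    proof (rule nn_integral_mono)
      fix y
      show "ennreal \<bar>k (x - y) * \<phi> y\<bar> \<le> ennreal B * (ennreal (1 + norm (x - y) powr - 2) * indicator (cball 0 R) y)"
      proof (cases "norm y \<le> R")
        case True
        have "\<bar>k (x - y) * \<phi> y\<bar> \<le> (1 + norm (x - y) powr - 2) * B"
          unfolding abs_mult using kbnd bnd B_nonneg by (intro mult_mono) auto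
        then show ?thesis using True B_nonneg by (simp add: ennreal_mult'[symmetric] ennreal_leI mult.commute del: ennreal_plus)
      qed (simp add: supp)
    qed
    also have "\<dots> \<le> ennreal B * ennreal (kernel_mass R)"
      by (subst nn_integral_cmult) (auto intro!: mult_left_mono nn_integral_kernel_cball R simp del: ennreal_plus)
    finally show ?thesis using B_nonneg kernel_mass_nonneg[of R] R by (simp add: ennreal_mult)
  qed
  then show *: "integrable lborel (\<lambda>y. k (x - y) * \<phi> y)"
    by (intro integrableI_bounded) (auto intro: le_less_trans)
  have "ennreal (\<integral>y. \<bar>k (x - y) * \<phi> y\<bar> \<partial>lborel) \<le> ennreal (B * kernel_mass R)"
    using le nn_integral_eq_integral[of lborel "\<lambda>y. \<bar>k (x - y) * \<phi> y\<bar>"] integrable_abs[OF *] by simp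
  then show "(\<integral>y. \<bar>k (x - y) * \<phi> y\<bar> \<partial>lborel) \<le> B * kernel_mass R"
    using B_nonneg kernel_mass_nonneg[of R] R by simp
qed

lemma conv_integrable:
  assumes "kernel k"
  shows "integrable lborel (\<lambda>z. k z * \<phi> (x - z))"
  using lborel_integrable_reflect[OF kernel_integrable(1)[OF assms, of x], of x] by simp

lemma conv_eq:
  assumes "kernel k"
  shows "conv k \<phi> x = (\<integral>y. k (x - y) * \<phi> y \<partial>lborel)"
  using lborel_integral_reflect[of "\<lambda>y. k (x - y) * \<phi> y" x]
    borel_measurable_integrable[OF kernel_integrable(1)[OF assms, of x]]
  by (simp add: conv_def)

lemma conv_bound:
  assumes "kernel k"
  shows "\<bar>conv k \<phi> x\<bar> \<le> B * kernel_mass R"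
  unfolding conv_eq[OF assms] by (rule order_trans[OF integral_abs_bound kernel_integrable(2)[OF assms]])

text \<open>For |x| \<ge> 2 R every point of the support is at distance at least |x| / 2 from
  \<open>x\<close>, hence the factor 2^p.\<close>

lemma conv_decay:
  assumes "kernel k" and k: "\<And>z. \<bar>k z\<bar> \<le> norm z powr - p" and p: "0 \<le> p" and x: "2 * R \<le> norm x"
  shows "\<bar>conv k \<phi> x\<bar> \<le> 2 powr p * (B * (\<kappa> * R ^ 3)) * norm x powr - p"
proof -
  have x0: "0 < norm x" using x R by linarith
  have int: "integrable lborel (\<lambda>y. 2 powr p * norm x powr - p * B * indicator (cball (0::vec3) R) y)"
    using emeasure_lborel_cball_finite by (auto intro!: integrable_mult_right integrable_real_indicator)
  have "\<bar>conv k \<phi> x\<bar> \<le> (\<integral>y. \<bar>k (x - y) * \<phi> y\<bar> \<partial>lborel)"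
    unfolding conv_eq[OF assms(1)] by (rule integral_abs_bound)
  also have "\<dots> \<le> (\<integral>y. 2 powr p * norm x powr - p * B * indicator (cball (0::vec3) R) y \<partial>lborel)"
  proof (rule integral_mono[OF _ int])
    show "integrable lborel (\<lambda>y. \<bar>k (x - y) * \<phi> y\<bar>)" using kernel_integrable(1)[OF assms(1)] by simp
    fix y
    show "\<bar>k (x - y) * \<phi> y\<bar> \<le> 2 powr p * norm x powr - p * B * indicator (cball (0::vec3) R) y"
    proof (cases "norm y \<le> R")
      case True
      have "norm x / 2 \<le> norm (x - y)" using x True norm_triangle_ineq2[of x y] by linarith
      then have "norm (x - y) powr - p \<le> (norm x / 2) powr - p" using x0 p by (intro powr_mono2') auto
      also have "\<dots> = 2 powr p * norm x powr - p" using x0 by (simp add: powr_divide powr_minus_divide)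
      finally have "\<bar>k (x - y)\<bar> \<le> 2 powr p * norm x powr - p" using k order_trans by blast
      then have "\<bar>k (x - y) * \<phi> y\<bar> \<le> (2 powr p * norm x powr - p) * B"
        unfolding abs_mult using bnd by (intro mult_mono) auto
      then show ?thesis using True by simp
    qed (simp add: supp)
  qed
  also have "\<dots> = 2 powr p * norm x powr - p * B * measure lborel (cball (0::vec3) R)" by simp
  also have "measure lborel (cball (0::vec3) R) = \<kappa> * R ^ 3"
    using R \<kappa>_pos by (simp add: measure_def emeasure_ball_vec3)
  finally show ?thesis by (simp add: mult_ac)
qed

lemma conv_measurable:
  assumes "kernel k"
  shows "conv k \<phi> \<in> borel_measurable borel"
proof -
  interpret kernel k by fact
  show ?thesis unfolding conv_def[abs_def] by measurable
qed

end

section \<open>The Newtonian potential and its field\<close>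

lemma kernel_norm_1: "kernel (\<lambda>z. norm z powr - 1)"
proof
  fix z :: vec3
  show "\<bar>norm z powr - 1\<bar> \<le> 1 + norm z powr - 2"
  proof (cases "norm z \<ge> 1")
    case True
    then have "norm z powr - 1 \<le> 1 powr - 1" by (intro powr_mono2') auto
    then show ?thesis using powr_ge_zero[of "norm z" "- 2"] abs_of_nonneg[OF powr_ge_zero[of "norm z" "- 1"]]
      unfolding powr_one_eq_one by linarith
  next
    case False
    then have "norm z powr - 1 \<le> norm z powr - 2" by (intro powr_mono') auto
    then show ?thesis by simp
  qed
qed measurable

lemma norm_powr_3_bound: "\<bar>(z \<bullet> a) * norm z powr - 3\<bar> \<le> norm a * norm z powr - 2" for z a :: vec3
proof (cases "z = 0")
  case False
  have "\<bar>(z \<bullet> a) * norm z powr - 3\<bar> \<le> norm z * norm a * norm z powr - 3"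
    unfolding abs_mult using Cauchy_Schwarz_ineq2[of z a] by (intro mult_mono) auto
  also have "norm z * norm z powr - 3 = norm z powr - 2" using False by (simp add: powr_mult_base)
  then have "norm z * norm a * norm z powr - 3 = norm a * norm z powr - 2" by (simp add: mult_ac)
  finally show ?thesis .
qed simp

lemma kernel_grad:
  assumes "norm a \<le> 1"
  shows "kernel (\<lambda>z. (z \<bullet> a) * norm z powr - 3)"
proof
  fix z :: vec3
  have "norm a * norm z powr - 2 \<le> norm z powr - 2" using assms by (simp add: mult_left_le_one_le)
  then show "\<bar>(z \<bullet> a) * norm z powr - 3\<bar> \<le> 1 + norm z powr - 2"
    using norm_powr_3_bound[of z a] by linarith
qed measurable

definition newton :: "(vec3 \<Rightarrow> real) \<Rightarrow> vec3 \<Rightarrow> real" where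
  "newton \<phi> = (\<lambda>x. - conv (\<lambda>z. norm z powr - 1) \<phi> x)"

text \<open>The kernel (x - y) / |x - y|^3 integrated against the density, assembled from scalar
  convolutions so that the bounds and derivatives for \<open>conv\<close> apply to each component.
  It will turn out to be the gradient of \<open>newton \<phi>\<close>.\<close>

definition field :: "(vec3 \<Rightarrow> real) \<Rightarrow> vec3 \<Rightarrow> vec3" where
  "field \<phi> x = (\<Sum>b\<in>Basis. conv (\<lambda>z. (z \<bullet> b) * norm z powr - 3) \<phi> x *\<^sub>R b)"

context bounded_density
begin

lemma field_inner: "field \<phi> x \<bullet> a = conv (\<lambda>z. (z \<bullet> a) * norm z powr - 3) \<phi> x"
proof -
  have "conv (\<lambda>z. (z \<bullet> a) * norm z powr - 3) \<phi> x
     = (\<integral>z. (\<Sum>b\<in>Basis. (a \<bullet> b) * (((z \<bullet> b) * norm z powr - 3) * \<phi> (x - z))) \<partial>lborel)"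
    unfolding conv_def
    by (intro Bochner_Integration.integral_cong refl, subst euclidean_inner)
       (simp add: sum_distrib_left sum_distrib_right mult_ac)
  also have "\<dots> = (\<Sum>b\<in>Basis. (a \<bullet> b) * conv (\<lambda>z. (z \<bullet> b) * norm z powr - 3) \<phi> x)"
    using conv_integrable[OF kernel_grad] by (simp add: conv_def)
  also have "\<dots> = field \<phi> x \<bullet> a"
    by (simp add: field_def inner_sum_left) (simp add: mult.commute inner_commute)
  finally show ?thesis by simp
qed

lemma field_measurable [measurable]: "field \<phi> \<in> borel_measurable borel"
  unfolding field_def[abs_def]
  using conv_measurable[OF kernel_grad] by (intro borel_measurable_sum borel_measurable_scaleR) auto

lemma newton_measurable [measurable]: "newton \<phi> \<in> borel_measurable borel"
  unfolding newton_def using conv_measurable[OF kernel_norm_1] by measurable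

lemma newton_bound: "\<bar>newton \<phi> x\<bar> \<le> B * kernel_mass R"
  unfolding newton_def using conv_bound[OF kernel_norm_1] by simp

text \<open>Testing with the normalized field itself recovers the norm, so scalar bounds carry over
  without a factor for the number of components.\<close>

lemma field_norm_le_unit:
  assumes "\<And>a. norm a \<le> 1 \<Longrightarrow> field \<phi> x \<bullet> a \<le> c"
  shows "norm (field \<phi> x) \<le> c"
proof (cases "field \<phi> x = 0")
  case True then show ?thesis using assms[of 0] by simp
next
  case False
  have "field \<phi> x \<bullet> sgn (field \<phi> x) \<le> c" by (rule assms) (simp add: norm_sgn)
  also have "field \<phi> x \<bullet> sgn (field \<phi> x) = norm (field \<phi> x)"
    using False by (simp add: sgn_div_norm power2_norm_eq_inner[symmetric] power2_eq_square)
  finally show ?thesis .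
qed

lemma field_bound: "norm (field \<phi> x) \<le> B * kernel_mass R"
  using conv_bound[OF kernel_grad] by (intro field_norm_le_unit) (simp add: field_inner abs_le_iff)

lemma newton_decay:
  assumes "2 * R \<le> norm x"
  shows "\<bar>newton \<phi> x\<bar> \<le> 2 * (B * (\<kappa> * R ^ 3)) * norm x powr - 1"
  using conv_decay[OF kernel_norm_1, of 1 x] assms by (simp add: newton_def)

lemma field_decay:
  assumes "2 * R \<le> norm x"
  shows "norm (field \<phi> x) \<le> 4 * (B * (\<kappa> * R ^ 3)) * norm x powr - 2"
proof (rule field_norm_le_unit)
  fix a :: vec3 assume a: "norm a \<le> 1"
  have "\<bar>(z \<bullet> a) * norm z powr - 3\<bar> \<le> norm z powr - 2" for z
    using norm_powr_3_bound[of z a] mult_left_le_one_le[of "norm z powr - 2" "norm a"] a by simp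
  from conv_decay[OF kernel_grad[OF a] this _ assms]
  show "field \<phi> x \<bullet> a \<le> 4 * (B * (\<kappa> * R ^ 3)) * norm x powr - 2"
    by (simp add: field_inner)
qed

text \<open>In this form the field meets the condition on \<open>u\<close> in
  \<open>HLS_bound\<close>, with the absolute value of the charge as density.\<close>

lemma field_le_riesz:
  "ennreal (norm (field \<phi> x)) \<le> (\<integral>\<^sup>+y. ennreal (\<bar>\<phi> y\<bar> * norm (x - y) powr - 2) \<partial>lborel)"
proof -
  have k: "kernel (\<lambda>z. norm z powr - 2)" by standard auto
  have i: "integrable lborel (\<lambda>y. \<bar>\<phi> y\<bar> * norm (x - y) powr - 2)"
    using integrable_abs[OF kernel_integrable(1)[OF k, of x]] by (simp add: abs_mult mult.commute)
  have "norm (field \<phi> x) \<le> (\<integral>y. \<bar>\<phi> y\<bar> * norm (x - y) powr - 2 \<partial>lborel)"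
  proof (rule field_norm_le_unit)
    fix a :: vec3 assume a: "norm a \<le> 1"
    show "field \<phi> x \<bullet> a \<le> (\<integral>y. \<bar>\<phi> y\<bar> * norm (x - y) powr - 2 \<partial>lborel)"
      unfolding field_inner conv_eq[OF kernel_grad[OF a]]
    proof (rule integral_mono[OF kernel_integrable(1)[OF kernel_grad[OF a]] i])
      fix y
      have "\<bar>((x - y) \<bullet> a) * norm (x - y) powr - 3\<bar> \<le> norm (x - y) powr - 2"
        using norm_powr_3_bound[of "x - y" a] mult_left_le_one_le[of "norm (x - y) powr - 2" "norm a"] a by simp
      then have "\<bar>(x - y) \<bullet> a * norm (x - y) powr - 3\<bar> * \<bar>\<phi> y\<bar> \<le> norm (x - y) powr - 2 * \<bar>\<phi> y\<bar>"
        by (rule mult_right_mono) simp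
      then show "(x - y) \<bullet> a * norm (x - y) powr - 3 * \<phi> y \<le> \<bar>\<phi> y\<bar> * norm (x - y) powr - 2"
        using abs_ge_self[of "(x - y) \<bullet> a * norm (x - y) powr - 3 * \<phi> y"] by (simp add: abs_mult mult.commute)
    qed
  qed
  then show ?thesis using nn_integral_eq_integral[OF i] by (simp add: ennreal_leI)
qed

end

lemma DERIV_norm_shift_powr:
  fixes z a :: vec3
  assumes \<delta>: "0 < \<delta>"
  shows "((\<lambda>s. (norm (z + s *\<^sub>R a) ^ 2 + \<delta>) powr - (1/2)) has_real_derivative
    - (z \<bullet> a) * (norm z ^ 2 + \<delta>) powr - (3/2)) (at 0)"
proof -
  have eq: "norm (z + s *\<^sub>R a) ^ 2 = norm z ^ 2 + 2 * s * (z \<bullet> a) + s ^ 2 * norm a ^ 2" for s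
    by (simp only: power2_norm_eq_inner)
       (simp add: inner_add_left inner_add_right inner_commute[of a z] power2_eq_square algebra_simps)
  have p: "0 < norm z ^ 2 + \<delta>" using \<delta> by (simp add: add_nonneg_pos)
  have "- (1/2) - 1 = - (3/2::real)" by simp
  then show ?thesis unfolding eq
    by (auto intro!: derivative_eq_intros simp: p)
qed

text \<open>Directional derivatives are what differentiating a velocity average yields, so the
  spatial regularity of the charge is recorded in this form. The bound linear in the direction makes
  each derivative a bounded density on the same ball.\<close>

locale charge = bounded_density \<rho> B R for \<rho> B R +
  fixes \<rho>' :: "vec3 \<Rightarrow> vec3 \<Rightarrow> real" and B' :: real
  assumes \<rho>'_meas [measurable]: "\<And>a. \<rho>' a \<in> borel_measurable borel"
    and der: "\<And>a x. ((\<lambda>s. \<rho> (x + s *\<^sub>R a)) has_real_derivative \<rho>' a x) (at 0)"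
    and \<rho>'_bnd: "\<And>a x. \<bar>\<rho>' a x\<bar> \<le> B' * norm a"
    and \<rho>'_supp: "\<And>a x. R < norm x \<Longrightarrow> \<rho>' a x = 0"
begin

lemma bounded_density_deriv: "bounded_density (\<rho>' a) (B' * norm a) R"
  by standard (use \<rho>'_bnd \<rho>'_supp R in auto)

lemma der': "((\<lambda>s. \<rho> (x + s *\<^sub>R a)) has_real_derivative \<rho>' a (x + s *\<^sub>R a)) (at s)"
proof -
  have "((\<lambda>u. \<rho> ((x + s *\<^sub>R a) + (u - s) *\<^sub>R a)) has_real_derivative \<rho>' a (x + s *\<^sub>R a)) (at s)"
    using DERIV_shift[of "\<lambda>u. \<rho> (x + s *\<^sub>R a + (u - s) *\<^sub>R a)" _ 0 s] der[of "x + s *\<^sub>R a" a]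
    by (simp add: add.commute)
  then show ?thesis by (simp add: algebra_simps)
qed

text \<open>Since the density carries the dependence on \<open>x\<close>, dominated convergence
  applies with the kernel times an indicator as majorant, and the kernel itself is never
  differentiated.\<close>

lemma conv_deriv:
  assumes k: "kernel k"
  shows "((\<lambda>s. conv k \<rho> (x + s *\<^sub>R a)) has_real_derivative conv k (\<rho>' a) x) (at 0)"
proof -
  interpret kernel k by fact
  let ?T = "{-1..1::real}"
  let ?R = "norm x + norm a + R"
  let ?g = "\<lambda>z. \<bar>k z\<bar> * (B' * norm a * indicator (cball 0 ?R) z)"
  have B': "0 \<le> B' * norm a" using order_trans[OF abs_ge_zero \<rho>'_bnd] .
  interpret I: bounded_density "\<lambda>z. B' * norm a * indicator (cball 0 ?R) (- z)" "B' * norm a" ?R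
    using B' R by unfold_locales (auto simp: indicator_def intro!: add_nonneg_pos)
  have "((\<lambda>s. \<integral>z. k z * \<rho> (x + s *\<^sub>R a - z) \<partial>lborel) has_real_derivative (\<integral>z. k z * \<rho>' a (x + 0 *\<^sub>R a - z) \<partial>lborel)) (at 0 within ?T)"
  proof (rule has_real_derivative_integral(2)[where g="?g" and F'="\<lambda>s z. k z * \<rho>' a (x + s *\<^sub>R a - z)"])
    show "integrable lborel (\<lambda>z. k z * \<rho> (x + s *\<^sub>R a - z))" for s
      by (rule conv_integrable) fact
    show "((\<lambda>s. k z * \<rho> (x + s *\<^sub>R a - z)) has_real_derivative k z * \<rho>' a (x + s *\<^sub>R a - z)) (at s within ?T)" for s z
      using DERIV_cmult[OF der'[of "x - z" a s, unfolded diff_add_eq], of "k z"]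
      by (rule has_field_derivative_at_within)
    show "\<bar>k z * \<rho>' a (x + s *\<^sub>R a - z)\<bar> \<le> ?g z" if "s \<in> ?T" for s z
    proof (cases "norm z \<le> ?R")
      case True
      then show ?thesis using \<rho>'_bnd by (simp add: abs_mult mult_left_mono)
    next
      case False
      have "norm (s *\<^sub>R a) \<le> norm a" using that by (auto simp: mult_left_le_one_le)
      then have "R < norm (x + s *\<^sub>R a - z)"
        using False norm_triangle_ineq2[of z "x + s *\<^sub>R a"] norm_triangle_ineq[of x "s *\<^sub>R a"]
        by (simp add: norm_minus_commute)
      then show ?thesis using B' by (simp add: \<rho>'_supp)
    qed
    have eq: "?g = (\<lambda>z. \<bar>k z * (B' * norm a * indicator (cball 0 ?R) z)\<bar>)"
      by (rule ext) (simp only: abs_mult[of "k _"] abs_of_nonneg[OF mult_nonneg_nonneg[OF B' indicator_pos_le]])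
    show "integrable lborel ?g"
      unfolding eq using integrable_abs[OF I.conv_integrable[OF k, of 0]] by simp
  qed (auto simp: islimpt_Icc)
  then show ?thesis by (simp add: conv_def at_within_Icc_at)
qed

text \<open>Integration by parts against the kernel \<open>(|z|\<^sup>2 + \<delta>)\<^bsup>-1/2\<^esup>\<close> followed by \<open>\<delta> \<rightarrow> 0\<close> avoids
  excising a ball around the singularity.\<close>

lemma conv_norm_1_deriv:
  "conv (\<lambda>z. norm z powr - 1) (\<rho>' a) x = - conv (\<lambda>z. (z \<bullet> a) * norm z powr - 3) \<rho> x"
proof -
  let ?k = "\<lambda>\<delta> (z::vec3). (norm z ^ 2 + \<delta>) powr - (1/2)"
  let ?l = "\<lambda>\<delta> (z::vec3). (norm z ^ 2 + \<delta>) powr - (3/2)"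
  define \<delta> :: "nat \<Rightarrow> real" where "\<delta> n = inverse (Suc n)" for n
  have \<delta>: "0 < \<delta> n" for n by (simp add: \<delta>_def)
  have \<delta>0: "\<delta> \<longlonglongrightarrow> 0" unfolding \<delta>_def[abs_def] by (rule LIMSEQ_inverse_real_of_nat)
  have km: "?k d z \<le> norm z powr - 1" if "0 < d" "z \<noteq> 0" for d z
  proof -
    have "?k d z \<le> (norm z ^ 2) powr - (1/2)" using that by (intro powr_mono2') auto
    also have "\<dots> = norm z powr - 1" using that by (simp add: powr_powr flip: powr_numeral)
    finally show ?thesis .
  qed
  have lm: "?l d z \<le> norm z powr - 3" if "0 < d" "z \<noteq> 0" for d z
  proof -
    have "?l d z \<le> (norm z ^ 2) powr - (3/2)" using that by (intro powr_mono2') auto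
    also have "\<dots> = norm z powr - 3" using that by (simp add: powr_powr flip: powr_numeral)
    finally show ?thesis .
  qed
  have kc: "(\<lambda>n. ?k (\<delta> n) z) \<longlonglongrightarrow> norm z powr - 1" if "z \<noteq> 0" for z
  proof -
    have "(\<lambda>n. ?k (\<delta> n) z) \<longlonglongrightarrow> (norm z ^ 2 + 0) powr - (1/2)"
      using that by (intro tendsto_intros \<delta>0) auto
    then show ?thesis using that by (simp add: powr_powr flip: powr_numeral)
  qed
  have lc: "(\<lambda>n. ?l (\<delta> n) z) \<longlonglongrightarrow> norm z powr - 3" if "z \<noteq> 0" for z
  proof -
    have "(\<lambda>n. ?l (\<delta> n) z) \<longlonglongrightarrow> (norm z ^ 2 + 0) powr - (3/2)"
      using that by (intro tendsto_intros \<delta>0) auto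
    then show ?thesis using that by (simp add: powr_powr flip: powr_numeral)
  qed
  interpret D: bounded_density "\<rho>' a" "B' * norm a" R by (rule bounded_density_deriv)
  have kb: "\<bar>?k d z\<bar> \<le> d powr - (1/2)" if "0 < d" for d z using that by (auto intro!: powr_mono2')
  have lb: "\<bar>?l d z\<bar> \<le> d powr - (3/2)" if "0 < d" for d z using that by (auto intro!: powr_mono2')
  have far: "R < norm (x - z)" if "norm x + R < norm z" for z
    using that norm_triangle_ineq2[of z x] by (simp add: norm_minus_commute)
  have parts: "(\<integral>z. ?k d z * \<rho>' a (x - z) \<partial>lborel) = - (\<integral>z. (z \<bullet> a) * ?l d z * \<rho> (x - z) \<partial>lborel)" if d: "0 < d" for d
  proof -
    let ?f = "\<lambda>z. ?k d z * \<rho>' a (x - z)" and ?g = "\<lambda>z. (z \<bullet> a) * ?l d z * \<rho> (x - z)"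
    have fb: "norm (?f z) \<le> d powr - (1/2) * (B' * norm a)" for z
      unfolding real_norm_def abs_mult using kb[OF d] D.bnd by (intro mult_mono) auto
    have gb: "norm (?g z) \<le> ((norm x + R) * norm a) * d powr - (3/2) * B" for z
    proof (cases "norm z \<le> norm x + R")
      case True
      have "\<bar>z \<bullet> a\<bar> \<le> (norm x + R) * norm a"
        using Cauchy_Schwarz_ineq2[of z a] mult_right_mono[OF True norm_ge_zero[of a]] by linarith
      then show ?thesis
        unfolding real_norm_def abs_mult using lb[OF d] bnd R by (intro mult_mono) (auto simp: abs_mult)
    next
      case False then show ?thesis using supp[OF far] R B_nonneg by simp
    qed
    have fi: "integrable lborel ?f"
      by (rule integrable_bounded_support[OF _ fb, where R="norm x + R"]) (use far D.supp in auto)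
    have gi: "integrable lborel ?g"
      by (rule integrable_bounded_support[OF _ gb, where R="norm x + R"]) (use far supp in auto)
    have pi: "integrable lborel (\<lambda>z. ?k d z * \<rho> (x - z))"
    proof (rule integrable_bounded_support[of _ "d powr - (1/2) * B" "norm x + R"])
      show "norm (?k d z * \<rho> (x - z)) \<le> d powr - (1/2) * B" for z
        unfolding real_norm_def abs_mult using kb[OF d] bnd by (intro mult_mono) auto
    qed (use far supp in auto)
    \<comment> \<open>The integrand is the derivative along \<open>a\<close> of the regularized
      kernel times \<open>\<rho> (x - z)\<close>; the reflection in the argument of the density
      produces the sign of \<open>?f\<close>.\<close>
    have "(\<integral>z. - ?f z - ?g z \<partial>lborel) = 0"
    proof (rule integral_directional_derivative_eq_0(2)[OF pi, where a=a and R="norm x + R"])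
      fix z
      have "((\<lambda>s. \<rho> ((x - z) + (- s) *\<^sub>R a)) has_real_derivative - \<rho>' a (x - z)) (at 0)"
        using DERIV_mirror[of "\<lambda>s. \<rho> ((x - z) + s *\<^sub>R a)" "\<rho>' a (x - z)" 0] der[of "x - z" a] by simp
      then have "((\<lambda>s. \<rho> (x - (z + s *\<^sub>R a))) has_real_derivative - \<rho>' a (x - z)) (at 0)"
        by (simp add: algebra_simps)
      from DERIV_mult[OF DERIV_norm_shift_powr[OF d, of z a] this]
      show "((\<lambda>s. ?k d (z + s *\<^sub>R a) * \<rho> (x - (z + s *\<^sub>R a))) has_real_derivative - ?f z - ?g z) (at 0)"
        by (simp add: algebra_simps)
      show "\<bar>- ?f z - ?g z\<bar> \<le> d powr - (1/2) * (B' * norm a) + ((norm x + R) * norm a) * d powr - (3/2) * B"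
        using fb[of z] gb[of z] by (auto simp: abs_le_iff)
      show "- ?f z - ?g z = 0" if "norm x + R < norm z" using far[OF that] supp D.supp by simp
    qed
    then show ?thesis using fi gi by simp
  qed
  have 1: "(\<lambda>n. \<integral>z. ?k (\<delta> n) z * \<rho>' a (x - z) \<partial>lborel) \<longlonglongrightarrow> (\<integral>z. norm z powr - 1 * \<rho>' a (x - z) \<partial>lborel)"
  proof (rule integral_dominated_convergence[where w="\<lambda>z. \<bar>norm z powr - 1 * \<rho>' a (x - z)\<bar>"])
    show "integrable lborel (\<lambda>z. \<bar>norm z powr - 1 * \<rho>' a (x - z)\<bar>)"
      by (rule integrable_abs, rule D.conv_integrable, rule kernel_norm_1)
    show "AE z in lborel. (\<lambda>n. ?k (\<delta> n) z * \<rho>' a (x - z)) \<longlonglongrightarrow> norm z powr - 1 * \<rho>' a (x - z)"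
      using AE_lborel_singleton[of 0] by eventually_elim (intro tendsto_mult kc tendsto_const)
    show "AE z in lborel. norm (?k (\<delta> n) z * \<rho>' a (x - z)) \<le> \<bar>norm z powr - 1 * \<rho>' a (x - z)\<bar>" for n
      using AE_lborel_singleton[of 0]
    proof eventually_elim
      case (elim z)
      from km[OF \<delta> this] show ?case
        unfolding real_norm_def abs_mult abs_of_nonneg[OF powr_ge_zero] by (rule mult_right_mono) simp
    qed
  qed measurable
  have 2: "(\<lambda>n. \<integral>z. (z \<bullet> a) * ?l (\<delta> n) z * \<rho> (x - z) \<partial>lborel) \<longlonglongrightarrow> (\<integral>z. (z \<bullet> a) * norm z powr - 3 * \<rho> (x - z) \<partial>lborel)"
  proof (rule integral_dominated_convergence[where w="\<lambda>z. norm a * \<bar>norm z powr - 2 * \<rho> (x - z)\<bar>"])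
    have k2: "kernel (\<lambda>z. norm z powr - 2)" by standard auto
    show "integrable lborel (\<lambda>z. norm a * \<bar>norm z powr - 2 * \<rho> (x - z)\<bar>)"
      by (rule integrable_mult_right, rule integrable_abs, rule conv_integrable, rule k2)
    show "AE z in lborel. (\<lambda>n. (z \<bullet> a) * ?l (\<delta> n) z * \<rho> (x - z)) \<longlonglongrightarrow> (z \<bullet> a) * norm z powr - 3 * \<rho> (x - z)"
      using AE_lborel_singleton[of 0] by eventually_elim (intro tendsto_mult lc tendsto_const)
    show "AE z in lborel. norm ((z \<bullet> a) * ?l (\<delta> n) z * \<rho> (x - z)) \<le> norm a * \<bar>norm z powr - 2 * \<rho> (x - z)\<bar>" for n
      using AE_lborel_singleton[of 0]
    proof eventually_elim
      case (elim z)
      have "\<bar>z \<bullet> a\<bar> * ?l (\<delta> n) z \<le> \<bar>z \<bullet> a\<bar> * norm z powr - 3"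
        using lm[OF \<delta> elim] by (rule mult_left_mono) simp
      also have "\<dots> \<le> norm a * norm z powr - 2" using norm_powr_3_bound[of z a] by (simp add: abs_mult)
      finally have "\<bar>z \<bullet> a\<bar> * ?l (\<delta> n) z * \<bar>\<rho> (x - z)\<bar> \<le> norm a * norm z powr - 2 * \<bar>\<rho> (x - z)\<bar>"
        by (rule mult_right_mono) simp
      then show ?case by (simp add: abs_mult mult.assoc)
    qed
  qed measurable
  have "(\<integral>z. norm z powr - 1 * \<rho>' a (x - z) \<partial>lborel) = - (\<integral>z. (z \<bullet> a) * norm z powr - 3 * \<rho> (x - z) \<partial>lborel)"
    using 1 tendsto_minus[OF 2] unfolding parts[OF \<delta>] by (rule LIMSEQ_unique)
  then show ?thesis by (simp add: conv_def)
qed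

lemma newton_deriv:
  "((\<lambda>s. newton \<rho> (x + s *\<^sub>R a)) has_real_derivative field \<rho> x \<bullet> a) (at 0)"
  using DERIV_minus[OF conv_deriv[OF kernel_norm_1, of x a]]
  unfolding newton_def conv_norm_1_deriv field_inner minus_minus .

text \<open>Directional derivatives alone do not yield a gradient. Differentiability is granted by
  the notion of solution, and the directional derivatives then determine the gradient.\<close>

lemma GDERIV_newton:
  assumes "newton \<rho> differentiable (at x)"
  shows "GDERIV (newton \<rho>) x :> field \<rho> x"
proof -
  from assms obtain L where L: "(newton \<rho> has_derivative L) (at x)" by (auto simp: differentiable_def)
  have "L a = a \<bullet> field \<rho> x" for a
  proof -
    have "((\<lambda>s. newton \<rho> (x + s *\<^sub>R a)) has_derivative (\<lambda>s. L (s *\<^sub>R a))) (at 0)"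
      by (rule has_derivative_compose[of "\<lambda>s. x + s *\<^sub>R a" "\<lambda>s. s *\<^sub>R a" 0 UNIV "newton \<rho>" L])
         (use L in \<open>auto intro!: derivative_eq_intros\<close>)
    then have "((\<lambda>s. newton \<rho> (x + s *\<^sub>R a)) has_real_derivative L a) (at 0)"
      using linear_scale[OF has_derivative_linear[OF L]]
      by (simp add: has_field_derivative_def mult.commute[of "L a"] fun_eq_iff)
        (simp add: mult_commute_abs)
    with newton_deriv show ?thesis using DERIV_unique by (metis inner_commute)
  qed
  then have "L = (\<lambda>h. h \<bullet> field \<rho> x)" by auto
  with L show ?thesis by (simp add: gderiv_def)
qed

end

lemma GDERIV_unique: "GDERIV f x :> D \<Longrightarrow> GDERIV f x :> E \<Longrightarrow> D = E" for f :: "vec3 \<Rightarrow> real"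
proof -
  assume "GDERIV f x :> D" "GDERIV f x :> E"
  then have "(\<lambda>h. h \<bullet> D) = (\<lambda>h. h \<bullet> E)" unfolding gderiv_def by (rule has_derivative_unique)
  then have "h \<bullet> D = h \<bullet> E" for h by (rule fun_cong)
  then show "D = E" by (rule vector_eq_ldot[THEN iffD1, OF allI])
qed

lemma grad_eqI: "GDERIV f x :> D \<Longrightarrow> grad f x = D"
  unfolding grad_def by (rule the_equality) (auto intro: GDERIV_unique)

text \<open>Squaring removes the kink of the positive part at 0. The same function builds the cutoff
  below and the renormalizations that propagate the bounds of the densities.\<close>

lemma DERIV_pos_part_sq: "((\<lambda>u. (max 0 u)\<^sup>2) has_real_derivative 2 * max 0 u) (at u)" for u :: real
proof -
  consider "u < 0" | "0 < u" | "u = 0" by linarith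
  then show ?thesis
  proof cases
    case 1
    have "((\<lambda>u. 0) has_real_derivative 0) (at u)" by simp
    then have "((\<lambda>u. (max 0 u)\<^sup>2) has_real_derivative 0) (at u)"
      by (rule has_field_derivative_transform_within[where d="- u"]) (use 1 in \<open>auto simp: dist_real_def\<close>)
    then show ?thesis using 1 by simp
  next
    case 2
    have "((\<lambda>u. u\<^sup>2) has_real_derivative 2 * u) (at u)" by (auto intro!: derivative_eq_intros)
    then have "((\<lambda>u. (max 0 u)\<^sup>2) has_real_derivative 2 * u) (at u)"
      by (rule has_field_derivative_transform_within[where d="u"]) (use 2 in \<open>auto simp: dist_real_def\<close>)
    then show ?thesis using 2 by simp
  next
    case 3
    have "((\<lambda>h::real. (max 0 h)\<^sup>2 / h) \<longlongrightarrow> 0) (at 0)"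
    proof (rule Lim_null_comparison[OF always_eventually])
      show "\<forall>h::real. norm ((max 0 h)\<^sup>2 / h) \<le> \<bar>h\<bar>"
        by (auto simp: max_def power2_eq_square)
    qed (auto intro!: tendsto_eq_intros)
    then show ?thesis using 3 by (simp add: DERIV_def)
  qed
qed

section \<open>Interaction energies as double integrals\<close>

lemma pair_kernel:
  assumes k: "kernel k" and \<phi>: "bounded_density \<phi> A R" and \<psi>: "bounded_density \<psi> B S"
  shows "integrable (lborel \<Otimes>\<^sub>M lborel) (\<lambda>(x, y). \<phi> x * (k (x - y) * \<psi> y))"
    and "(\<integral>z. (case z of (x, y) \<Rightarrow> \<phi> x * (k (x - y) * \<psi> y)) \<partial>(lborel \<Otimes>\<^sub>M lborel)) = (\<integral>x. \<phi> x * conv k \<psi> x \<partial>lborel)"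
proof -
  interpret \<phi>: bounded_density \<phi> A R by fact
  interpret \<psi>: bounded_density \<psi> B S by fact
  interpret kernel k by fact
  \<comment> \<open>The inner integral is bounded by a constant times the absolute value of the
    outer density. This absolute integrability is what permits swapping the variables and
    differentiating under the double integral later.\<close>
  show *: "integrable (lborel \<Otimes>\<^sub>M lborel) (\<lambda>(x, y). \<phi> x * (k (x - y) * \<psi> y))"
  proof (rule lborel_pair.Fubini_integrable)
    show "integrable lborel (\<lambda>x. \<integral>y. norm (case (x, y) of (x, y) \<Rightarrow> \<phi> x * (k (x - y) * \<psi> y)) \<partial>lborel)"
    proof (rule Bochner_Integration.integrable_bound)
      show "integrable lborel (\<lambda>x. \<phi> x * (B * kernel_mass S))" using \<phi>.integrable by simp
      show "AE x in lborel. norm (\<integral>y. norm (case (x, y) of (x, y) \<Rightarrow> \<phi> x * (k (x - y) * \<psi> y)) \<partial>lborel) \<le> norm (\<phi> x * (B * kernel_mass S))"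
      proof (rule AE_I2)
        fix x
        have "(\<integral>y. \<bar>\<phi> x * (k (x - y) * \<psi> y)\<bar> \<partial>lborel) = \<bar>\<phi> x\<bar> * (\<integral>y. \<bar>k (x - y) * \<psi> y\<bar> \<partial>lborel)"
          by (simp only: abs_mult[of "\<phi> x"]) simp
        also have "\<dots> \<le> \<bar>\<phi> x\<bar> * (B * kernel_mass S)"
          by (rule mult_left_mono[OF \<psi>.kernel_integrable(2)[OF k]]) simp
        finally have le: "(\<integral>y. \<bar>\<phi> x * (k (x - y) * \<psi> y)\<bar> \<partial>lborel) \<le> \<bar>\<phi> x\<bar> * (B * kernel_mass S)" .
        have "0 \<le> (\<integral>y. \<bar>\<phi> x * (k (x - y) * \<psi> y)\<bar> \<partial>lborel)" by simp
        moreover have "0 \<le> B * kernel_mass S" using \<psi>.B_nonneg kernel_mass_nonneg[of S] \<psi>.R by simp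
        ultimately show "norm (\<integral>y. norm (case (x, y) of (x, y) \<Rightarrow> \<phi> x * (k (x - y) * \<psi> y)) \<partial>lborel) \<le> norm (\<phi> x * (B * kernel_mass S))"
          using le by (simp only: real_norm_def prod.case abs_of_nonneg abs_mult[of "\<phi> x" "B * kernel_mass S"])
      qed
    qed measurable
    show "AE x in lborel. integrable lborel (\<lambda>y. case (x, y) of (x, y) \<Rightarrow> \<phi> x * (k (x - y) * \<psi> y))"
      using \<psi>.kernel_integrable(1)[OF k] by (intro AE_I2) simp
  qed measurable
  show "(\<integral>z. (case z of (x, y) \<Rightarrow> \<phi> x * (k (x - y) * \<psi> y)) \<partial>(lborel \<Otimes>\<^sub>M lborel)) = (\<integral>x. \<phi> x * conv k \<psi> x \<partial>lborel)"
    using lborel_pair.integral_fst'[OF *] by (simp add: \<psi>.conv_eq[OF k])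
qed

lemma conv_symmetric:
  assumes k: "kernel k" and even: "\<And>z. k (- z) = k z"
    and \<phi>: "bounded_density \<phi> A R" and \<psi>: "bounded_density \<psi> B S"
  shows "(\<integral>x. \<phi> x * conv k \<psi> x \<partial>lborel) = (\<integral>x. \<psi> x * conv k \<phi> x \<partial>lborel)"
proof -
  have "(\<integral>x. \<phi> x * conv k \<psi> x \<partial>lborel) = (\<integral>z. (case z of (x, y) \<Rightarrow> \<phi> x * (k (x - y) * \<psi> y)) \<partial>(lborel \<Otimes>\<^sub>M lborel))"
    using pair_kernel(2)[OF k \<phi> \<psi>] by simp
  also have "\<dots> = (\<integral>z. (case z of (x, y) \<Rightarrow> \<phi> y * (k (y - x) * \<psi> x)) \<partial>(lborel \<Otimes>\<^sub>M lborel))"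
    using lborel_pair.integral_product_swap[OF borel_measurable_integrable[OF pair_kernel(1)[OF k \<phi> \<psi>]]]
    by (simp add: case_prod_unfold)
  also have "\<dots> = (\<integral>z. (case z of (x, y) \<Rightarrow> \<psi> x * (k (x - y) * \<phi> y)) \<partial>(lborel \<Otimes>\<^sub>M lborel))"
    using even by (intro Bochner_Integration.integral_cong refl) (auto simp: mult_ac, metis minus_diff_eq)
  also have "\<dots> = (\<integral>x. \<psi> x * conv k \<phi> x \<partial>lborel)"
    by (rule pair_kernel(2)[OF k \<psi> \<phi>])
  finally show ?thesis .
qed

text \<open>The energy is differentiated as a double integral over \<open>x\<close> and
  \<open>y\<close>, in which both charge factors depend on time. Evenness of the kernel makes the
  two resulting terms equal, whence the factor 2; the time derivative of the potential itself never
  appears.\<close>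

lemma newton_energy_deriv:
  assumes T: "convex T" "t \<in> T" "t islimpt T"
    and r: "\<And>s. s \<in> T \<Longrightarrow> bounded_density (r s) B R"
    and r': "\<And>s. s \<in> T \<Longrightarrow> bounded_density (r' s) B' R"
    and der: "\<And>s x. s \<in> T \<Longrightarrow> ((\<lambda>s. r s x) has_real_derivative r' s x) (at s within T)"
  shows "((\<lambda>s. \<integral>x. r s x * newton (r s) x \<partial>lborel) has_real_derivative
    2 * (\<integral>x. r' t x * newton (r t) x \<partial>lborel)) (at t within T)"
proof -
  let ?k = "\<lambda>z::vec3. norm z powr - 1"
  let ?I = "indicator (cball (0::vec3) R) :: vec3 \<Rightarrow> real"
  let ?M = "lborel \<Otimes>\<^sub>M lborel :: (vec3 \<times> vec3) measure"
  let ?F = "\<lambda>s (x, y). r s x * (?k (x - y) * r s y)"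
  let ?F' = "\<lambda>s (x, y). r' s x * (?k (x - y) * r s y) + r s x * (?k (x - y) * r' s y)"
  have I: "bounded_density ?I 1 R"
    using bounded_density.R[OF r[OF T(2)]] by unfold_locales (auto simp: indicator_def)
  note k = kernel_norm_1
  have B: "0 \<le> B" "0 \<le> B'" using bounded_density.B_nonneg r[OF T(2)] r'[OF T(2)] by blast+
  have rb: "\<bar>r s x\<bar> \<le> B * ?I x" "\<bar>r' s x\<bar> \<le> B' * ?I x" if "s \<in> T" for s x
    using bounded_density.bnd[OF r[OF that], of x] bounded_density.bnd[OF r'[OF that], of x]
      bounded_density.supp[OF r[OF that], of x] bounded_density.supp[OF r'[OF that], of x]
    by (auto simp: indicator_def)
  have "((\<lambda>s. \<integral>z. ?F s z \<partial>?M) has_real_derivative (\<integral>z. ?F' t z \<partial>?M)) (at t within T)"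
  proof (rule has_real_derivative_integral(2)[OF T, where g="\<lambda>z. 2 * B * B' * (case z of (x, y) \<Rightarrow> ?I x * (?k (x - y) * ?I y))"])
    show "integrable ?M (?F s)" if "s \<in> T" for s by (rule pair_kernel(1)[OF k r[OF that] r[OF that]])
    show "integrable ?M (\<lambda>z. 2 * B * B' * (case z of (x, y) \<Rightarrow> ?I x * (?k (x - y) * ?I y)))"
      by (intro integrable_mult_right pair_kernel(1)[OF k I I])
    show "((\<lambda>s. ?F s z) has_real_derivative ?F' s z) (at s within T)" if "s \<in> T" for s z
    proof (cases z)
      case (Pair x y)
      have "((\<lambda>s. r s x * (?k (x - y) * r s y)) has_real_derivative
          r' s x * (?k (x - y) * r s y) + (?k (x - y) * r' s y) * r s x) (at s within T)"
        by (intro DERIV_mult DERIV_cmult der that)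
      then show ?thesis using Pair by (simp only: prod.case mult.commute[of "r s x"])
    qed
    show "\<bar>?F' s z\<bar> \<le> 2 * B * B' * (case z of (x, y) \<Rightarrow> ?I x * (?k (x - y) * ?I y))" if "s \<in> T" for s z
    proof (cases z)
      case (Pair x y)
      have "\<bar>r' s x * (?k (x - y) * r s y)\<bar> \<le> (B' * ?I x) * (?k (x - y) * (B * ?I y))"
        unfolding abs_mult abs_of_nonneg[OF powr_ge_zero] using rb[OF that] B
        by (intro mult_mono order_refl) (auto simp: indicator_def)
      moreover have "\<bar>r s x * (?k (x - y) * r' s y)\<bar> \<le> (B * ?I x) * (?k (x - y) * (B' * ?I y))"
        unfolding abs_mult abs_of_nonneg[OF powr_ge_zero] using rb[OF that] B
        by (intro mult_mono order_refl) (auto simp: indicator_def)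
      moreover have "(B' * ?I x) * (?k (x - y) * (B * ?I y)) + (B * ?I x) * (?k (x - y) * (B' * ?I y)) = 2 * B * B' * (?I x * (?k (x - y) * ?I y))"
        by (simp only: mult_ac mult_2 distrib_left distrib_right)
      ultimately show ?thesis
        using abs_triangle_ineq[of "r' s x * (?k (x - y) * r s y)" "r s x * (?k (x - y) * r' s y)"]
        unfolding Pair prod.case by linarith
    qed
  qed
  moreover have "(\<integral>z. ?F s z \<partial>?M) = - (\<integral>x. r s x * newton (r s) x \<partial>lborel)" if "s \<in> T" for s
    using pair_kernel(2)[OF k r[OF that] r[OF that]] by (simp add: newton_def)
  moreover have "(\<integral>z. ?F' t z \<partial>?M) = - 2 * (\<integral>x. r' t x * newton (r t) x \<partial>lborel)"
  proof -
    note b = r[OF T(2)] r'[OF T(2)]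
    have "(\<integral>z. ?F' t z \<partial>?M) = (\<integral>x. r' t x * conv ?k (r t) x \<partial>lborel) + (\<integral>x. r t x * conv ?k (r' t) x \<partial>lborel)"
      using Bochner_Integration.integral_add[OF pair_kernel(1)[OF k b(2) b(1)] pair_kernel(1)[OF k b(1) b(2)]]
      unfolding pair_kernel(2)[OF k b(2) b(1)] pair_kernel(2)[OF k b(1) b(2)] by (simp add: case_prod_unfold)
    also have "(\<integral>x. r t x * conv ?k (r' t) x \<partial>lborel) = (\<integral>x. r' t x * conv ?k (r t) x \<partial>lborel)"
      by (rule conv_symmetric[OF k _ b]) simp
    finally show ?thesis by (simp add: newton_def)
  qed
  ultimately have "((\<lambda>s. - (\<integral>x. r s x * newton (r s) x \<partial>lborel)) has_real_derivative
      - 2 * (\<integral>x. r' t x * newton (r t) x \<partial>lborel)) (at t within T)"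
    by (metis (mono_tags, lifting) has_field_derivative_transform_within T(2) zero_less_one)
  from DERIV_minus[OF this] show ?thesis by simp
qed

section \<open>The virial identity\<close>

context bounded_density
begin

lemma inner_density: "bounded_density (\<lambda>x. (x \<bullet> b) * \<phi> x) (R * norm b * B) R"
proof
  show "\<bar>(x \<bullet> b) * \<phi> x\<bar> \<le> R * norm b * B" for x
  proof (cases "norm x \<le> R")
    case True
    have "\<bar>x \<bullet> b\<bar> \<le> R * norm b"
      using Cauchy_Schwarz_ineq2[of x b] mult_right_mono[OF True norm_ge_zero[of b]] by linarith
    then show ?thesis unfolding abs_mult using bnd R by (intro mult_mono) auto
  next
    case False
    then show ?thesis using supp R B_nonneg by simp
  qed
qed (use R supp in auto)

text \<open>Symmetrizing the double integral in \<open>x\<close> and \<open>y\<close> produces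
  \<open>x \<bullet> (x - y) + y \<bullet> (y - x)\<close>, which is |x - y|^2 and turns the field
  kernel |x - y|^(-3) into the potential kernel 1 / |x - y|. The division by 2 is the average over
  the two orderings.\<close>

lemma virial: "(\<integral>x. \<phi> x * (x \<bullet> field \<phi> x) \<partial>lborel) = - (\<integral>x. \<phi> x * newton \<phi> x \<partial>lborel) / 2"
proof -
  let ?M = "lborel \<Otimes>\<^sub>M lborel :: (vec3 \<times> vec3) measure"
  let ?k = "\<lambda>b z::vec3. (z \<bullet> b) * norm z powr - 3"
  have D: "bounded_density \<phi> B R" by unfold_locales
  let ?G = "\<lambda>(x, y). (\<phi> x * \<phi> y) * ((x \<bullet> (x - y)) * norm (x - y) powr - 3)"
  have eqG: "?G = (\<lambda>z. \<Sum>b\<in>Basis. (case z of (x, y) \<Rightarrow> ((x \<bullet> b) * \<phi> x) * (?k b (x - y) * \<phi> y)))"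
  proof (rule ext)
    fix z :: "vec3 \<times> vec3"
    obtain x y where z: "z = (x, y)" by (cases z)
    show "?G z = (\<Sum>b\<in>Basis. (case z of (x, y) \<Rightarrow> ((x \<bullet> b) * \<phi> x) * (?k b (x - y) * \<phi> y)))"
      unfolding z prod.case by (subst euclidean_inner) (simp add: sum_distrib_left sum_distrib_right mult_ac)
  qed
  have int: "integrable ?M (\<lambda>z. case z of (x, y) \<Rightarrow> ((x \<bullet> b) * \<phi> x) * (?k b (x - y) * \<phi> y))" if "b \<in> Basis" for b
    using that by (intro pair_kernel(1)[OF kernel_grad inner_density D]) simp
  have Gi: "integrable ?M ?G" unfolding eqG using int by (intro Bochner_Integration.integrable_sum)
  have "(\<integral>z. ?G z \<partial>?M) = (\<Sum>b\<in>Basis. \<integral>x. ((x \<bullet> b) * \<phi> x) * conv (?k b) \<phi> x \<partial>lborel)"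
    unfolding eqG using int pair_kernel(2)[OF kernel_grad inner_density D]
    by (subst Bochner_Integration.integral_sum) auto
  also have "\<dots> = (\<integral>x. (\<Sum>b\<in>Basis. ((x \<bullet> b) * \<phi> x) * conv (?k b) \<phi> x) \<partial>lborel)"
  proof (rule Bochner_Integration.integral_sum[symmetric])
    fix b :: vec3 assume "b \<in> Basis"
    then have "kernel (?k b)" by (intro kernel_grad) simp
    note kb = conv_bound[OF this] conv_measurable[OF this]
    interpret b: bounded_density "\<lambda>x. (x \<bullet> b) * \<phi> x" "R * norm b * B" R by (rule inner_density)
    have "norm ((x \<bullet> b) * \<phi> x * conv (?k b) \<phi> x) \<le> (R * norm b * B) * (B * kernel_mass R)" for x
      unfolding real_norm_def abs_mult[of _ "conv (?k b) \<phi> x"] using b.bnd kb(1) b.B_nonneg by (intro mult_mono) auto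
    then show "integrable lborel (\<lambda>x. (x \<bullet> b) * \<phi> x * conv (?k b) \<phi> x)"
      by (rule integrable_bounded_support[rotated, where R=R]) (use kb(2) supp in auto)
  qed
  also have "\<dots> = (\<integral>x. \<phi> x * (x \<bullet> field \<phi> x) \<partial>lborel)"
  proof (intro Bochner_Integration.integral_cong refl)
    fix x
    show "(\<Sum>b\<in>Basis. ((x \<bullet> b) * \<phi> x) * conv (?k b) \<phi> x) = \<phi> x * (x \<bullet> field \<phi> x)"
      by (subst euclidean_inner) (simp add: sum_distrib_left mult_ac field_inner)
  qed
  finally have v: "(\<integral>z. ?G z \<partial>?M) = (\<integral>x. \<phi> x * (x \<bullet> field \<phi> x) \<partial>lborel)" .
  have swap: "(\<integral>z. ?G z \<partial>?M) = (\<integral>z. (case z of (x, y) \<Rightarrow> ?G (y, x)) \<partial>?M)"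
    using lborel_pair.integral_product_swap[OF borel_measurable_integrable[OF Gi]] by (simp add: case_prod_unfold)
  have Gi': "integrable ?M (\<lambda>(x, y). ?G (y, x))"
    using lborel_pair.integrable_product_swap[OF Gi] by (simp add: case_prod_unfold)
  have "2 * (\<integral>z. ?G z \<partial>?M) = (\<integral>z. ?G z + (case z of (x, y) \<Rightarrow> ?G (y, x)) \<partial>?M)"
    using swap Bochner_Integration.integral_add[OF Gi Gi'] by simp
  also have "\<dots> = (\<integral>z. (case z of (x, y) \<Rightarrow> \<phi> x * (norm (x - y) powr - 1 * \<phi> y)) \<partial>?M)"
  proof (intro Bochner_Integration.integral_cong refl)
    fix z :: "vec3 \<times> vec3"
    obtain x y where z: "z = (x, y)" by (cases z)
    have "x \<bullet> (x - y) + y \<bullet> (y - x) = norm (x - y) ^ 2"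
      by (simp add: power2_norm_eq_inner algebra_simps inner_commute)
    moreover have "norm (x - y) ^ 2 * norm (x - y) powr - 3 = norm (x - y) powr - 1"
      by (cases "x = y") (simp_all add: powr_add[symmetric] flip: powr_numeral)
    ultimately have "x \<bullet> (x - y) * norm (x - y) powr - 3 + y \<bullet> (y - x) * norm (x - y) powr - 3 = norm (x - y) powr - 1"
      by (metis distrib_right)
    then have "\<phi> x * \<phi> y * (x \<bullet> (x - y) * norm (x - y) powr - 3) + \<phi> x * \<phi> y * (y \<bullet> (y - x) * norm (x - y) powr - 3)
       = \<phi> x * \<phi> y * norm (x - y) powr - 1"
      by (metis distrib_left)
    then show "?G z + (case z of (x, y) \<Rightarrow> ?G (y, x)) = (case z of (x, y) \<Rightarrow> \<phi> x * (norm (x - y) powr - 1 * \<phi> y))"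
      unfolding z prod.case norm_minus_commute[of y x] by (simp only: mult_ac)
  qed
  also have "\<dots> = - (\<integral>x. \<phi> x * newton \<phi> x \<partial>lborel)"
    using pair_kernel(2)[OF kernel_norm_1 D D] by (simp add: newton_def)
  finally show ?thesis using v by simp
qed

end

section \<open>Green's identity and the field energy\<close>

lemma integrable_norm_tail: "0 < R \<Longrightarrow> integrable lborel (\<lambda>x::vec3. norm x powr - 4 * indicator (- ball 0 R) x)"
proof (rule integrableI_bounded)
  assume R: "0 < R"
  have "(\<integral>\<^sup>+(x::vec3). ennreal (norm (norm x powr - 4 * indicator (- ball 0 R) x)) \<partial>lborel)
    = (\<integral>\<^sup>+(x::vec3). ennreal (norm x powr - 4) * indicator (- ball 0 R) x \<partial>lborel)"
    by (intro nn_integral_cong) (auto simp: indicator_def)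
  also have "\<dots> < \<infinity>" using nn_integral_norm_tail[OF R] by (rule le_less_trans) simp
  finally show "(\<integral>\<^sup>+(x::vec3). ennreal (norm (norm x powr - 4 * indicator (- ball 0 R) x)) \<partial>lborel) < \<infinity>" .
qed measurable

text \<open>For positive \<open>n\<close> a continuously differentiable bump on the ball of radius
  \<open>n\<close>, tending to 1 as \<open>n\<close> grows. The outer square smooths the edge, and
  the quadratic argument makes the gradient a multiple of \<open>x\<close>.\<close>

definition cutoff :: "real \<Rightarrow> vec3 \<Rightarrow> real" where
  "cutoff n x = (max 0 (1 - norm x ^ 2 / n ^ 2)) ^ 2"

lemma cutoff_bounds: "0 \<le> cutoff n x" "cutoff n x \<le> 1"
proof -
  have "max 0 (1 - norm x ^ 2 / n ^ 2) ^ 2 \<le> 1 ^ 2" by (intro power_mono) auto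
  then show "cutoff n x \<le> 1" by (simp add: cutoff_def)
qed (simp add: cutoff_def)

lemma cutoff_deriv:
  "((\<lambda>s. cutoff n (x + s *\<^sub>R a)) has_real_derivative
     - 4 / n ^ 2 * max 0 (1 - norm x ^ 2 / n ^ 2) * (x \<bullet> a)) (at 0)"
proof -
  have eq: "norm (x + s *\<^sub>R a) ^ 2 = norm x ^ 2 + 2 * s * (x \<bullet> a) + s ^ 2 * norm a ^ 2" for s
    by (simp only: power2_norm_eq_inner)
       (simp add: inner_add_left inner_add_right inner_commute[of a x] power2_eq_square algebra_simps)
  let ?q = "\<lambda>s. 1 - norm (x + s *\<^sub>R a) ^ 2 / n ^ 2"
  have d: "(?q has_real_derivative - (2 * (x \<bullet> a)) / n ^ 2) (at 0)"
    unfolding eq divide_inverse by (auto intro!: derivative_eq_intros)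
  have "((\<lambda>s. (max 0 (?q s)) ^ 2) has_real_derivative 2 * max 0 (?q 0) * (- (2 * (x \<bullet> a)) / n ^ 2)) (at 0)"
    by (rule DERIV_chain2[of "\<lambda>u. (max 0 u) ^ 2" _ ?q, OF DERIV_pos_part_sq d])
  then show ?thesis by (simp add: cutoff_def mult_ac)
qed

context charge
begin

text \<open>Green's identity for \<open>newton \<rho>\<close>, from testing the Poisson equation with
  \<open>cutoff n * newton \<rho>\<close>; the boundary term vanishes as \<open>n \<rightarrow> \<infinity>\<close> because \<open>newton \<rho>\<close>, \<open>x\<close> and
  \<open>field \<rho>\<close> multiply to \<open>O(|x|\<^bsup>-2\<^esup>)\<close>.\<close>

lemma green_identity:
  assumes diff: "\<And>x. field \<rho> differentiable (at x)"
    and lap: "\<And>x. (\<Sum>b\<in>Basis. frechet_derivative (field \<rho>) (at x) b \<bullet> b) = 4 * pi * \<rho> x"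
  shows "integrable lborel (\<lambda>x. norm (field \<rho> x) ^ 2)"
    and "(\<integral>x. norm (field \<rho> x) ^ 2 \<partial>lborel) = - 4 * pi * (\<integral>x. \<rho> x * newton \<rho> x \<partial>lborel)"
proof -
  define E where "E = field \<rho>"
  define U where "U = newton \<rho>"
  have [measurable]: "E \<in> borel_measurable borel" "U \<in> borel_measurable borel"
    unfolding E_def U_def by measurable
  define c where "c = B * (\<kappa> * R ^ 3)"
  define R0 where "R0 = 2 * R"
  have R0: "0 < R0" using R by (simp add: R0_def)
  have c: "0 \<le> c" using R B_nonneg \<kappa>_pos by (simp add: c_def)
  define K where "K = B * kernel_mass R"
  have K: "0 \<le> K" using B_nonneg kernel_mass_nonneg[of R] R by (simp add: K_def)
  have Ub: "\<bar>U x\<bar> \<le> K" and Eb: "norm (E x) \<le> K" for x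
    using newton_bound field_bound by (auto simp: U_def E_def K_def)
  have Ud: "\<bar>U x\<bar> \<le> 2 * c * norm x powr - 1" if "R0 \<le> norm x" for x
    using newton_decay that by (simp add: U_def c_def R0_def)
  have Ed: "norm (E x) \<le> 4 * c * norm x powr - 2" if "R0 \<le> norm x" for x
    using field_decay that by (simp add: E_def c_def R0_def)
  \<comment> \<open>A single shape of majorant, constant near the origin and |x|^(-4) outside,
    serves both the field energy and the boundary term.\<close>
  define w where "w A x = A * indicator (cball 0 R0) x + A * (norm x powr - 4 * indicator (- ball 0 R0) x)" for A :: real and x :: vec3
  have w: "integrable lborel (w A)" for A
    unfolding w_def[abs_def] using emeasure_lborel_cball_finite
    by (intro Bochner_Integration.integrable_add integrable_mult_right integrable_real_indicator integrable_norm_tail R0) auto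
  have wI: "f \<le> w A x" if "norm x \<le> R0 \<Longrightarrow> f \<le> A" "R0 \<le> norm x \<Longrightarrow> f \<le> A * norm x powr - 4" "0 \<le> A" for f A x
  proof (cases "norm x \<le> R0")
    case True
    then have "f \<le> A * indicator (cball 0 R0) x" using that by simp
    then show ?thesis unfolding w_def using that(3) by (simp add: add_increasing2)
  next
    case False
    then have "f \<le> A * (norm x powr - 4 * indicator (- ball 0 R0) x)" using that by simp
    then show ?thesis unfolding w_def using that(3) by (simp add: add_increasing)
  qed
  define A where "A = K ^ 2 + 16 * c ^ 2"
  have A: "0 \<le> A" by (simp add: A_def)
  have E2: "norm (E x) ^ 2 \<le> w A x" for x
  proof (rule wI)
    show "norm (E x) ^ 2 \<le> A" using power_mono[OF Eb[of x], of 2] by (simp add: A_def add_increasing2)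
    assume x: "R0 \<le> norm x"
    have "norm (E x) ^ 2 \<le> (4 * c * norm x powr - 2) ^ 2" using Ed[OF x] by (intro power_mono) auto
    also have "\<dots> = 16 * c ^ 2 * (norm x powr - 2) ^ 2" by (simp add: power_mult_distrib)
    also have "(norm x powr - 2) ^ 2 = norm x powr - 4"
      by (simp add: power2_eq_square powr_add[symmetric])
    also have "16 * c ^ 2 * norm x powr - 4 \<le> A * norm x powr - 4"
      by (intro mult_right_mono) (auto simp: A_def)
    finally show "norm (E x) ^ 2 \<le> A * norm x powr - 4" .
  qed fact
  show int: "integrable lborel (\<lambda>x. norm (field \<rho> x) ^ 2)"
    using E2 by (intro Bochner_Integration.integrable_bound[OF w[of A]] AE_I2)
      (auto simp: E_def intro: order_trans[OF _ abs_ge_self])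
  define m where "m n x = max 0 (1 - norm x ^ 2 / n ^ 2)" for n :: real and x :: vec3
  have m: "0 \<le> m n x" "m n x \<le> 1" for n x by (auto simp: m_def)
  have m0: "m n x = 0" if "n < norm x" "0 < n" for n x
  proof -
    have "n ^ 2 \<le> norm x ^ 2" using that by (intro power_mono) auto
    then show ?thesis using that by (simp add: m_def field_simps)
  qed
  have cm: "cutoff n x = m n x ^ 2" for n x by (simp add: cutoff_def m_def)
  have [measurable]: "m n \<in> borel_measurable borel" "cutoff n \<in> borel_measurable borel" for n
    unfolding m_def cutoff_def by measurable
  let ?T = "\<lambda>n x. - 4 / n ^ 2 * m n x * (U x * (x \<bullet> E x))"
  have weak: "(\<integral>x. ?T n x + cutoff n x * norm (E x) ^ 2 + 4 * pi * (cutoff n x * (\<rho> x * U x)) \<partial>lborel) = 0"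
    if n: "0 < n" for n
  proof -
    let ?E' = "\<lambda>b. conv (\<lambda>z. (z \<bullet> b) * norm z powr - 3) (\<rho>' b)"
    \<comment> \<open>This is the derivative along \<open>b\<close> of the cutoff times
      \<open>U\<close> times the \<open>b\<close>-component of \<open>E\<close>. Its integral
      vanishes, and the sum over the basis is the tested Poisson equation.\<close>
    let ?\<psi> = "\<lambda>b x. - 4 / n ^ 2 * m n x * (x \<bullet> b) * (U x * (E x \<bullet> b)) + cutoff n x * ((E x \<bullet> b) * (E x \<bullet> b) + U x * ?E' b x)"
    have z: "integrable lborel (?\<psi> b)" "(\<integral>x. ?\<psi> b x \<partial>lborel) = 0" if b: "b \<in> Basis" for b
    proof -
      have nb: "norm b = 1" using b by simp
      have kb: "kernel (\<lambda>z. (z \<bullet> b) * norm z powr - 3)" by (rule kernel_grad) (simp add: nb)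
      interpret D: bounded_density "\<rho>' b" "B' * norm b" R by (rule bounded_density_deriv)
      define K' where "K' = B' * norm b * kernel_mass R"
      have E'b: "\<bar>?E' b x\<bar> \<le> K'" for x unfolding K'_def by (rule D.conv_bound[OF kb])
      have Ebb: "\<bar>E x \<bullet> b\<bar> \<le> K" for x
        using Cauchy_Schwarz_ineq2[of "E x" b] Eb[of x] nb by simp
      have \<phi>i: "integrable lborel (\<lambda>x. cutoff n x * (U x * (E x \<bullet> b)))"
      proof (rule integrable_bounded_support[where R=n])
        show "norm (cutoff n x * (U x * (E x \<bullet> b))) \<le> 1 * (K * K)" for x
          unfolding real_norm_def abs_mult using Ub Ebb K cutoff_bounds by (intro mult_mono) auto
      qed (use m0 n in \<open>auto simp: cm\<close>)
      have "((\<lambda>s. cutoff n (x + s *\<^sub>R b) * (U (x + s *\<^sub>R b) * (E (x + s *\<^sub>R b) \<bullet> b))) has_real_derivative ?\<psi> b x) (at 0)" for x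
      proof -
        have 1: "((\<lambda>s. U (x + s *\<^sub>R b)) has_real_derivative E x \<bullet> b) (at 0)"
          unfolding U_def E_def by (rule newton_deriv)
        have 2: "((\<lambda>s. E (x + s *\<^sub>R b) \<bullet> b) has_real_derivative ?E' b x) (at 0)"
          unfolding E_def field_inner by (rule conv_deriv[OF kb])
        from DERIV_mult[OF cutoff_deriv[of n x b] DERIV_mult[OF 1 2]] show ?thesis
          by (simp add: m_def mult_ac)
      qed
      moreover have "\<bar>?\<psi> b x\<bar> \<le> 4 / n ^ 2 * n * (K * K) + (K * K + K * K')" for x
      proof -
        have mx: "\<bar>m n x * (x \<bullet> b)\<bar> \<le> n"
        proof (cases "norm x \<le> n")
          case True
          have "\<bar>m n x\<bar> * \<bar>x \<bullet> b\<bar> \<le> 1 * norm x"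
            using m Cauchy_Schwarz_ineq2[of x b] nb by (intro mult_mono) auto
          then show ?thesis using True by (simp add: abs_mult)
        qed (use m0 n in auto)
        have "\<bar>- 4 / n ^ 2 * m n x * (x \<bullet> b) * (U x * (E x \<bullet> b))\<bar> = 4 / n ^ 2 * \<bar>m n x * (x \<bullet> b)\<bar> * (\<bar>U x\<bar> * \<bar>E x \<bullet> b\<bar>)"
          by (simp add: abs_mult)
        also have "\<dots> \<le> 4 / n ^ 2 * n * (K * K)"
          using mx Ub[of x] Ebb[of x] K n by (intro mult_mono) auto
        finally have 1: "\<bar>- 4 / n ^ 2 * m n x * (x \<bullet> b) * (U x * (E x \<bullet> b))\<bar> \<le> 4 / n ^ 2 * n * (K * K)" .
        have a: "\<bar>(E x \<bullet> b) * (E x \<bullet> b)\<bar> \<le> K * K" unfolding abs_mult using Ebb[of x] K by (intro mult_mono) auto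
        have b: "\<bar>U x * ?E' b x\<bar> \<le> K * K'" unfolding abs_mult using Ub[of x] E'b[of x] K by (intro mult_mono) auto
        have "\<bar>(E x \<bullet> b) * (E x \<bullet> b) + U x * ?E' b x\<bar> \<le> K * K + K * K'" using a b by linarith
        then have 2: "\<bar>cutoff n x * ((E x \<bullet> b) * (E x \<bullet> b) + U x * ?E' b x)\<bar> \<le> 1 * (K * K + K * K')"
          unfolding abs_mult[of "cutoff n x"] using cutoff_bounds[of n x] by (intro mult_mono) auto
        show ?thesis using order_trans[OF abs_triangle_ineq add_mono[OF 1 2]] by (simp only: mult_1)
      qed
      moreover have "?\<psi> b x = 0" if "n < norm x" for x using m0[OF that n] by (simp add: cm)
      ultimately show "integrable lborel (?\<psi> b)" "(\<integral>x. ?\<psi> b x \<partial>lborel) = 0"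
        using integral_directional_derivative_eq_0[OF \<phi>i, of b "?\<psi> b"] by blast+
    qed
    have sum: "?T n x + cutoff n x * norm (E x) ^ 2 + 4 * pi * (cutoff n x * (\<rho> x * U x)) = (\<Sum>b\<in>Basis. ?\<psi> b x)" for x
    proof -
      \<comment> \<open>The diagonal entries of the Jacobian of the field agree with the convolution
        derivatives; through them the Poisson equation enters.\<close>
      have "?E' b x = frechet_derivative E (at x) b \<bullet> b" if b: "b \<in> Basis" for b
      proof -
        have kb: "kernel (\<lambda>z. (z \<bullet> b) * norm z powr - 3)" by (rule kernel_grad) (simp add: b)
        define L where "L = frechet_derivative E (at x)"
        have L: "(E has_derivative L) (at x)"
          using diff unfolding E_def L_def by (simp add: frechet_derivative_works)
        have "((\<lambda>s. E (x + s *\<^sub>R b)) has_derivative (\<lambda>s. L (s *\<^sub>R b))) (at 0)"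
          by (rule has_derivative_compose[of "\<lambda>s. x + s *\<^sub>R b" "\<lambda>s. s *\<^sub>R b" 0 UNIV E L])
             (use L in \<open>auto intro!: derivative_eq_intros\<close>)
        then have "((\<lambda>s. E (x + s *\<^sub>R b) \<bullet> b) has_derivative (\<lambda>s. L (s *\<^sub>R b) \<bullet> b)) (at 0)"
          by (rule has_derivative_inner_left)
        also have "(\<lambda>s. L (s *\<^sub>R b) \<bullet> b) = (*) (L b \<bullet> b)"
          using linear_scale[OF has_derivative_linear[OF L]] by (auto simp: mult.commute)
        finally have "((\<lambda>s. E (x + s *\<^sub>R b) \<bullet> b) has_real_derivative (L b \<bullet> b)) (at 0)"
          by (simp add: has_field_derivative_def)
        moreover have "((\<lambda>s. E (x + s *\<^sub>R b) \<bullet> b) has_real_derivative ?E' b x) (at 0)"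
          unfolding E_def field_inner by (rule conv_deriv[OF kb])
        ultimately have "L b \<bullet> b = ?E' b x" by (rule DERIV_unique)
        then show ?thesis unfolding L_def by (rule sym)
      qed
      then have lap': "(\<Sum>b\<in>Basis. ?E' b x) = 4 * pi * \<rho> x" using lap[of x] by (simp add: E_def)
      have "(\<Sum>b\<in>Basis. ?\<psi> b x) = - 4 / n ^ 2 * m n x * U x * (\<Sum>b\<in>Basis. (x \<bullet> b) * (E x \<bullet> b))
          + cutoff n x * (\<Sum>b\<in>Basis. (E x \<bullet> b) * (E x \<bullet> b)) + cutoff n x * U x * (\<Sum>b\<in>Basis. ?E' b x)"
        unfolding sum_distrib_left sum.distrib[symmetric] by (intro sum.cong refl) (simp add: algebra_simps)
      also have "(\<Sum>b\<in>Basis. (x \<bullet> b) * (E x \<bullet> b)) = x \<bullet> E x" by (rule euclidean_inner[symmetric])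
      also have "(\<Sum>b\<in>Basis. (E x \<bullet> b) * (E x \<bullet> b)) = norm (E x) ^ 2"
        unfolding power2_norm_eq_inner by (rule euclidean_inner[symmetric])
      finally show ?thesis unfolding lap' by (simp add: mult_ac)
    qed
    show ?thesis unfolding sum using z by (subst Bochner_Integration.integral_sum) auto
  qed
  define N where "N k = real (Suc k)" for k
  have N: "0 < N k" "1 \<le> N k" for k by (auto simp: N_def)
  have N2: "(\<lambda>k. 1 / N k ^ 2) \<longlonglongrightarrow> 0"
    using tendsto_power[OF LIMSEQ_inverse_real_of_nat, of 2] by (simp add: N_def divide_inverse power_inverse)
  have mlim: "(\<lambda>k. m (N k) x) \<longlonglongrightarrow> 1" for x
  proof -
    have "(\<lambda>k. max 0 (1 - norm x ^ 2 * (1 / N k ^ 2))) \<longlonglongrightarrow> max 0 (1 - norm x ^ 2 * 0)"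
      by (intro tendsto_intros N2)
    then show ?thesis by (simp add: m_def)
  qed
  have clim: "(\<lambda>k. cutoff (N k) x) \<longlonglongrightarrow> 1" for x
    using tendsto_power[OF mlim[of x], of 2] by (simp add: cm)
  define A' where "A' = 4 * (K * (R0 * K)) + 32 * c ^ 2"
  have A': "0 \<le> A'" using K R0 by (simp add: A'_def)
  have Tb: "\<bar>?T (N k) x\<bar> \<le> w A' x" for k x
  proof -
    have n: "1 / N k ^ 2 \<le> 1" using N[of k] by (simp add: one_le_power)
    have eq: "\<bar>?T (N k) x\<bar> = 4 * (1 / N k ^ 2 * m (N k) x) * (\<bar>U x\<bar> * \<bar>x \<bullet> E x\<bar>)"
      using m by (simp add: abs_mult)
    have xE: "\<bar>x \<bullet> E x\<bar> \<le> norm x * norm (E x)" by (rule Cauchy_Schwarz_ineq2)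
    show ?thesis
    proof (rule wI)
      assume x: "norm x \<le> R0"
      have "norm x * norm (E x) \<le> R0 * K" using x Eb[of x] R0 by (intro mult_mono) auto
      then have a: "\<bar>U x\<bar> * \<bar>x \<bullet> E x\<bar> \<le> K * (R0 * K)" using Ub[of x] xE K R0 by (intro mult_mono) auto
      have b: "1 / N k ^ 2 * m (N k) x \<le> 1 * 1" using n m by (intro mult_mono) auto
      have "4 * (1 / N k ^ 2 * m (N k) x) * (\<bar>U x\<bar> * \<bar>x \<bullet> E x\<bar>) \<le> 4 * (1 * 1) * (K * (R0 * K))"
        by (rule mult_mono[OF mult_left_mono[OF b] a]) auto
      then show "\<bar>?T (N k) x\<bar> \<le> A'" unfolding eq A'_def by (simp add: add_increasing2)
    next
      assume x: "R0 \<le> norm x"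
      have x0: "0 < norm x" using x R0 by linarith
      have "norm x * norm (E x) \<le> norm x * (4 * c * norm x powr - 2)" using Ed[OF x] by (intro mult_left_mono) auto
      also have "\<dots> = 4 * c * (norm x * norm x powr - 2)" by simp
      also have "norm x * norm x powr - 2 = norm x powr - 1" using x0 powr_mult_base[of "norm x" "- 2"] by simp
      finally have "\<bar>x \<bullet> E x\<bar> \<le> 4 * c * norm x powr - 1" using xE by linarith
      then have "\<bar>U x\<bar> * \<bar>x \<bullet> E x\<bar> \<le> (2 * c * norm x powr - 1) * (4 * c * norm x powr - 1)"
        using Ud[OF x] c by (intro mult_mono) auto
      also have "\<dots> = 8 * c ^ 2 * (norm x powr - 1 * norm x powr - 1)" by (simp add: power2_eq_square)
      also have "norm x powr - 1 * norm x powr - 1 = norm x powr - 2" by (subst powr_add[symmetric]) simp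
      finally have 1: "\<bar>U x\<bar> * \<bar>x \<bullet> E x\<bar> \<le> 8 * c ^ 2 * norm x powr - 2" .
      \<comment> \<open>The gradient of the cutoff lives on |x| \<le> n, so its factor 1 / n^2 is at
        most |x|^(-2). This makes the majorant independent of \<open>n\<close> and supplies the
        missing decay.\<close>
      have 2: "1 / N k ^ 2 * m (N k) x \<le> norm x powr - 2"
      proof (cases "norm x \<le> N k")
        case True
        have "norm x ^ 2 \<le> N k ^ 2" using True by (intro power_mono) auto
        then have "1 / N k ^ 2 \<le> 1 / norm x ^ 2" using x0 N(1)[of k] by (intro divide_left_mono) auto
        also have "\<dots> = norm x powr - 2" using x0 by (simp add: powr_minus_divide)
        finally have "1 / N k ^ 2 * m (N k) x \<le> norm x powr - 2 * 1"
          using m[of "N k" x] by (intro mult_mono) auto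
        then show ?thesis by (simp only: mult_1_right)
      qed (use m0 N in auto)
      have "4 * (1 / N k ^ 2 * m (N k) x) * (\<bar>U x\<bar> * \<bar>x \<bullet> E x\<bar>) \<le> 4 * norm x powr - 2 * (8 * c ^ 2 * norm x powr - 2)"
        by (rule mult_mono[OF mult_left_mono[OF 2] 1]) auto
      also have "\<dots> = 32 * c ^ 2 * (norm x powr - 2 * norm x powr - 2)" by simp
      also have "norm x powr - 2 * norm x powr - 2 = norm x powr - 4" by (subst powr_add[symmetric]) simp
      also have "32 * c ^ 2 * norm x powr - 4 \<le> A' * norm x powr - 4"
        using K R0 by (intro mult_right_mono) (auto simp: A'_def)
      finally show "\<bar>?T (N k) x\<bar> \<le> A' * norm x powr - 4" unfolding eq .
    qed fact
  qed
  have Ui: "integrable lborel (\<lambda>x. \<rho> x * U x)"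
  proof (rule integrable_bounded_support[where R=R])
    show "norm (\<rho> x * U x) \<le> B * K" for x
      unfolding real_norm_def abs_mult using bnd[of x] Ub[of x] B_nonneg by (intro mult_mono) auto
  qed (use supp in auto)
  have Tlim: "(\<lambda>k. ?T (N k) x) \<longlonglongrightarrow> 0" for x
  proof -
    have "(\<lambda>k. - 4 * (1 / N k ^ 2) * m (N k) x * (U x * (x \<bullet> E x))) \<longlonglongrightarrow> - 4 * 0 * 1 * (U x * (x \<bullet> E x))"
      by (intro tendsto_intros N2 mlim)
    then show ?thesis by simp
  qed
  have "(\<lambda>k. \<integral>x. ?T (N k) x + cutoff (N k) x * norm (E x) ^ 2 + 4 * pi * (cutoff (N k) x * (\<rho> x * U x)) \<partial>lborel)
     \<longlonglongrightarrow> (\<integral>x. 0 + 1 * norm (E x) ^ 2 + 4 * pi * (1 * (\<rho> x * U x)) \<partial>lborel)"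
  proof (rule integral_dominated_convergence[where w="\<lambda>x. w A' x + norm (E x) ^ 2 + 4 * pi * \<bar>\<rho> x * U x\<bar>"])
    show "integrable lborel (\<lambda>x. w A' x + norm (E x) ^ 2 + 4 * pi * \<bar>\<rho> x * U x\<bar>)"
      using w int Ui by (auto simp: E_def)
    show "AE x in lborel. (\<lambda>k. ?T (N k) x + cutoff (N k) x * norm (E x) ^ 2 + 4 * pi * (cutoff (N k) x * (\<rho> x * U x)))
        \<longlonglongrightarrow> 0 + 1 * norm (E x) ^ 2 + 4 * pi * (1 * (\<rho> x * U x))"
      by (intro AE_I2 tendsto_add tendsto_mult tendsto_const clim Tlim)
    show "AE x in lborel. norm (?T (N k) x + cutoff (N k) x * norm (E x) ^ 2 + 4 * pi * (cutoff (N k) x * (\<rho> x * U x)))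
        \<le> w A' x + norm (E x) ^ 2 + 4 * pi * \<bar>\<rho> x * U x\<bar>" for k
    proof (rule AE_I2)
      fix x
      have "\<bar>cutoff (N k) x * norm (E x) ^ 2\<bar> \<le> 1 * norm (E x) ^ 2"
        unfolding abs_mult using cutoff_bounds[of "N k" x] by (intro mult_mono) auto
      moreover have "\<bar>4 * pi * (cutoff (N k) x * (\<rho> x * U x))\<bar> \<le> 4 * pi * \<bar>\<rho> x * U x\<bar>"
      proof -
        have "\<bar>cutoff (N k) x * (\<rho> x * U x)\<bar> \<le> 1 * \<bar>\<rho> x * U x\<bar>"
          unfolding abs_mult[of "cutoff (N k) x"] using cutoff_bounds[of "N k" x] by (intro mult_mono) auto
        then show ?thesis unfolding abs_mult[of "4 * pi"] by (intro mult_mono) auto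
      qed
      ultimately show "norm (?T (N k) x + cutoff (N k) x * norm (E x) ^ 2 + 4 * pi * (cutoff (N k) x * (\<rho> x * U x)))
        \<le> w A' x + norm (E x) ^ 2 + 4 * pi * \<bar>\<rho> x * U x\<bar>"
        using Tb[of k x] unfolding real_norm_def by linarith
    qed
  qed measurable
  then have "(\<integral>x. 0 + 1 * norm (E x) ^ 2 + 4 * pi * (1 * (\<rho> x * U x)) \<partial>lborel) = 0"
    unfolding weak[OF N(1)] by (simp add: LIMSEQ_const_iff)
  then have "(\<integral>x. norm (E x) ^ 2 \<partial>lborel) + 4 * pi * (\<integral>x. \<rho> x * U x \<partial>lborel) = 0"
    using int Ui by (simp add: E_def)
  then show "(\<integral>x. norm (field \<rho> x) ^ 2 \<partial>lborel) = - 4 * pi * (\<integral>x. \<rho> x * newton \<rho> x \<partial>lborel)"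
    by (simp add: E_def U_def)
qed

end

section \<open>Transport equations on phase space\<close>

lemma integrable_continuous_support:
  fixes g :: "vec3 \<Rightarrow> real"
  assumes c: "continuous_on UNIV g" and supp: "\<And>v. R < norm v \<Longrightarrow> g v = 0"
  shows "integrable lborel g"
proof -
  have "compact (g ` cball 0 R)" by (intro compact_continuous_image continuous_on_subset[OF c]) auto
  then obtain B where B: "\<And>y. y \<in> g ` cball 0 R \<Longrightarrow> norm y \<le> B"
    using compact_imp_bounded bounded_iff by metis
  have "norm (g v) \<le> max 0 B" for v using B[of "g v"] supp[of v] by (cases "norm v \<le> R") auto
  then show ?thesis
    using supp by (intro integrable_bounded_support[where R=R] borel_measurable_continuous_onI c) auto
qed

abbreviation phase_space :: "(vec3 \<times> vec3) measure" where
  "phase_space \<equiv> lborel \<Otimes>\<^sub>M lborel"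

lemma compact_support_bounded:
  fixes g :: "real \<Rightarrow> vec3 \<times> vec3 \<Rightarrow> 'b::real_normed_vector"
  assumes cont: "continuous_on ({0..T} \<times> UNIV) (\<lambda>(t, z). g t z)"
    and supp: "\<And>t x v. t \<in> {0..T} \<Longrightarrow> R < norm x \<or> R < norm v \<Longrightarrow> g t (x, v) = 0"
  shows "\<exists>B\<ge>0. \<forall>t\<in>{0..T}. \<forall>z. norm (g t z) \<le> B"
proof -
  let ?K = "{0..T} \<times> (cball 0 R \<times> cball 0 R :: (vec3 \<times> vec3) set)"
  have "compact ((\<lambda>(t, z). g t z) ` ?K)"
    by (intro compact_continuous_image continuous_on_subset[OF cont] compact_Times) auto
  then obtain B where B: "\<And>y. y \<in> (\<lambda>(t, z). g t z) ` ?K \<Longrightarrow> norm y \<le> B"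
    using compact_imp_bounded bounded_iff by metis
  have "norm (g t (x, v)) \<le> max 0 B" if t: "t \<in> {0..T}" for t x v
  proof (cases "norm x \<le> R \<and> norm v \<le> R")
    case True
    then have "g t (x, v) \<in> (\<lambda>(t, z). g t z) ` ?K" using t by (auto intro!: image_eqI[of _ _ "(t, x, v)"])
    from B[OF this] show ?thesis by simp
  next
    case False
    then show ?thesis using supp[OF t, of x v] by (auto simp: not_le)
  qed
  then show ?thesis by (intro exI[of _ "max 0 B"]) auto
qed

lemma integrable_pair_bounded_support:
  fixes g :: "vec3 \<times> vec3 \<Rightarrow> real"
  assumes "g \<in> borel_measurable borel" "\<And>z. \<bar>g z\<bar> \<le> B"
    and supp: "\<And>x v. R < norm x \<or> R < norm v \<Longrightarrow> g (x, v) = 0"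
  shows "integrable phase_space g"
proof -
  have "integrable lborel g"
  proof (rule integrable_bounded_support[where B=B and R="2 * R"])
    fix z :: "vec3 \<times> vec3" assume z: "2 * R < norm z"
    obtain x v where "z = (x, v)" by (cases z)
    then show "g z = 0" using z norm_Pair_le[of x v] by (auto intro!: supp)
  qed (use assms in auto)
  then show ?thesis by (simp add: lborel_prod)
qed

lemma integrable_pair_continuous:
  fixes g :: "vec3 \<times> vec3 \<Rightarrow> real"
  assumes cont: "continuous_on UNIV g"
    and supp: "\<And>x v. R < norm x \<or> R < norm v \<Longrightarrow> g (x, v) = 0"
  shows "integrable phase_space g"
proof -
  have "continuous_on ({0..0::real} \<times> UNIV) (\<lambda>(t, z). g z)"
    unfolding case_prod_unfold by (intro continuous_on_compose2[OF cont] continuous_intros) auto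
  from compact_support_bounded[OF this, of R] supp
  obtain B where "\<And>z. \<bar>g z\<bar> \<le> B" by auto
  then show ?thesis
    using supp by (intro integrable_pair_bounded_support borel_measurable_continuous_onI cont) auto
qed

text \<open>The direction \<open>b\<close> depends on the velocity alone, so for each
  \<open>v\<close> this is a derivative along a fixed vector, and Fubini finishes. Such a field is
  divergence free in \<open>x\<close>, hence no term with a derivative of \<open>b\<close>.\<close>

lemma integral_pair_x_derivative_eq_0:
  fixes g g' :: "vec3 \<times> vec3 \<Rightarrow> real"
  assumes cont: "continuous_on UNIV g" "continuous_on UNIV g'"
    and supp: "\<And>x v. R < norm x \<or> R < norm v \<Longrightarrow> g (x, v) = 0"
      "\<And>x v. R < norm x \<or> R < norm v \<Longrightarrow> g' (x, v) = 0"
    and der: "\<And>x v. ((\<lambda>s. g (x + s *\<^sub>R b v, v)) has_real_derivative g' (x, v)) (at 0)"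
  shows "(\<integral>z. g' z \<partial>phase_space) = 0"
proof -
  have c: "continuous_on ({0..0::real} \<times> UNIV) (\<lambda>(t, z). h z)" if "continuous_on UNIV h" for h :: "vec3 \<times> vec3 \<Rightarrow> real"
    unfolding case_prod_unfold by (intro continuous_on_compose2[OF that] continuous_intros) auto
  obtain B where B: "\<And>z. \<bar>g z\<bar> \<le> B"
    using compact_support_bounded[OF c[OF cont(1)], of R] supp by auto
  obtain B' where B': "\<And>z. \<bar>g' z\<bar> \<le> B'"
    using compact_support_bounded[OF c[OF cont(2)], of R] supp by auto
  have [measurable]: "g \<in> borel_measurable (borel \<Otimes>\<^sub>M borel)"
    using borel_measurable_continuous_onI[OF cont(1)] by (simp add: borel_prod)
  have "(\<integral>x. g' (x, v) \<partial>lborel) = 0" for v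
  proof (rule integral_directional_derivative_eq_0(2)[OF _ der[of _ v]])
    show "integrable lborel (\<lambda>x. g (x, v))"
      by (rule integrable_bounded_support[where B=B and R=R]) (use B supp in auto)
    show "\<bar>g' (x, v)\<bar> \<le> B'" for x by (rule B')
    show "g' (x, v) = 0" if "R < norm x" for x using supp that by blast
  qed
  moreover have "(\<integral>v. (\<integral>x. g' (x, v) \<partial>lborel) \<partial>lborel) = (\<integral>z. g' z \<partial>phase_space)"
    using lborel_pair.integral_snd[of "\<lambda>x v. g' (x, v)"] integrable_pair_continuous[OF cont(2) supp(2)] by simp
  ultimately show ?thesis by simp
qed

text \<open>The mirror image of the preceding fact under exchange of position and velocity; it will
  be applied to the force, which depends on position alone.\<close>

lemma integral_pair_v_derivative_eq_0:
  fixes g g' :: "vec3 \<times> vec3 \<Rightarrow> real"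
  assumes cont: "continuous_on UNIV g" "continuous_on UNIV g'"
    and supp: "\<And>x v. R < norm x \<or> R < norm v \<Longrightarrow> g (x, v) = 0"
      "\<And>x v. R < norm x \<or> R < norm v \<Longrightarrow> g' (x, v) = 0"
    and der: "\<And>x v. ((\<lambda>s. g (x, v + s *\<^sub>R b x)) has_real_derivative g' (x, v)) (at 0)"
  shows "(\<integral>z. g' z \<partial>phase_space) = 0"
proof -
  let ?sw = "\<lambda>(x, v). (v, x) :: vec3 \<times> vec3"
  have s: "continuous_on UNIV (\<lambda>z. h (?sw z))" if "continuous_on UNIV h" for h :: "vec3 \<times> vec3 \<Rightarrow> real"
    unfolding case_prod_unfold by (intro continuous_on_compose2[OF that] continuous_intros) auto
  have "(\<integral>z. g' (?sw z) \<partial>phase_space) = 0"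
    by (rule integral_pair_x_derivative_eq_0[where g="\<lambda>z. g (?sw z)" and b=b and R=R])
       (use s[OF cont(1)] s[OF cont(2)] supp der in auto)
  then show ?thesis
    using lborel_pair.integral_product_swap[of g'] integrable_pair_continuous[OF cont(2) supp(2)]
    by (simp add: case_prod_unfold)
qed

lemma has_real_derivative_integral_pair:
  fixes G G' :: "real \<Rightarrow> vec3 \<times> vec3 \<Rightarrow> real"
  assumes cont: "continuous_on ({0..} \<times> UNIV) (\<lambda>(t, z). G t z)" "continuous_on ({0..} \<times> UNIV) (\<lambda>(t, z). G' t z)"
    and supp: "\<And>T. \<exists>R. \<forall>t\<in>{0..T}. \<forall>x v. R < norm x \<or> R < norm v \<longrightarrow> G t (x, v) = 0 \<and> G' t (x, v) = 0"
    and der: "\<And>t z. 0 \<le> t \<Longrightarrow> ((\<lambda>s. G s z) has_real_derivative G' t z) (at t within {0..})"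
    and t: "0 \<le> t"
  shows "((\<lambda>s. \<integral>z. G s z \<partial>phase_space) has_real_derivative (\<integral>z. G' t z \<partial>phase_space)) (at t within {0..})"
proof -
  let ?M = "phase_space"
  \<comment> \<open>On the compact interval up to t + 1 supports and bounds are uniform. Since
    \<open>t\<close> lies strictly below \<open>T\<close>, the filter at \<open>t\<close> is the
    same as within the half-line, and the derivative at time 0 stays one-sided.\<close>
  define T where "T = t + 1"
  have tT: "t \<in> {0..T}" "t < T" using t by (auto simp: T_def)
  obtain R where R: "\<And>s x v. s \<in> {0..T} \<Longrightarrow> R < norm x \<or> R < norm v \<Longrightarrow> G s (x, v) = 0 \<and> G' s (x, v) = 0"
    using supp[of T] by blast
  have sub: "{0..T} \<times> UNIV \<subseteq> {0..} \<times> (UNIV :: (vec3 \<times> vec3) set)" by auto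
  obtain B where B: "0 \<le> B" "\<And>s z. s \<in> {0..T} \<Longrightarrow> \<bar>G' s z\<bar> \<le> B"
    using compact_support_bounded[OF continuous_on_subset[OF cont(2) sub], of R] R by auto
  have fixed: "continuous_on UNIV (G s)" if "0 \<le> s" for s
  proof -
    have "continuous_on UNIV (\<lambda>z. (\<lambda>(t, z). G t z) (s, z))"
      by (rule continuous_on_compose2[OF cont(1)]) (use that in \<open>auto intro!: continuous_intros\<close>)
    then show ?thesis by simp
  qed
  let ?I = "\<lambda>z. B * indicator (cball 0 R \<times> cball 0 R) z"
  have "((\<lambda>s. \<integral>z. G s z \<partial>?M) has_real_derivative (\<integral>z. G' t z \<partial>?M)) (at t within {0..T})"
  proof (rule has_real_derivative_integral(2)[where g="?I" and F'=G'])
    show "convex {0..T}" by simp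
    show "t \<in> {0..T}" by (rule tT)
    show "t islimpt {0..T}" using tT by (auto simp: islimpt_Icc)
    show "integrable ?M (G s)" if "s \<in> {0..T}" for s
      using that R by (intro integrable_pair_continuous[where R=R] fixed) auto
    show "((\<lambda>s. G s z) has_real_derivative G' s z) (at s within {0..T})" if "s \<in> {0..T}" for s z
      using der[of s z] that by (auto intro: has_field_derivative_subset)
    show "\<bar>G' s z\<bar> \<le> ?I z" if s: "s \<in> {0..T}" for s z
    proof (cases z)
      case (Pair x v)
      then show ?thesis using B(2)[OF s, of z] R[OF s, of x v] by (auto simp: indicator_def not_le)
    qed
    show "integrable ?M ?I"
    proof (rule integrable_pair_bounded_support[where B=B and R=R])
      show "?I \<in> borel_measurable borel"
        by (intro borel_measurable_times borel_measurable_const borel_measurable_indicator borel_closed closed_Times closed_cball)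
    qed (use B in \<open>auto simp: indicator_def\<close>)
  qed
  moreover have "at t within {0..T} = at t within {0..}"
    by (rule at_within_nhd[where S="{..<T}"]) (use tT in auto)
  ultimately show ?thesis by simp
qed


text \<open>A single species with drift coefficient \<open>c\<close> and force sign
  \<open>\<sigma>\<close>; the two species are the instances with \<open>\<epsilon>\<close>,
  \<open>1\<close> and \<open>- \<epsilon>\<close>, \<open>- 1\<close>. Here \<open>D\<close> and
  \<open>E\<close> count as given, so the equation is linear in \<open>f\<close>.\<close>

locale transport =
  fixes f ft :: "real \<Rightarrow> vec3 \<Rightarrow> vec3 \<Rightarrow> real" and fx fv :: "real \<Rightarrow> vec3 \<Rightarrow> vec3 \<Rightarrow> vec3"
    and c \<sigma> :: real and D :: "real \<Rightarrow> vec3" and E :: "real \<Rightarrow> vec3 \<Rightarrow> vec3"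
  assumes cont_f: "continuous_on ({0..} \<times> UNIV) (\<lambda>(t, z). f t (fst z) (snd z))"
    and cont_ft: "continuous_on ({0..} \<times> UNIV) (\<lambda>(t, z). ft t (fst z) (snd z))"
    and cont_fx: "continuous_on ({0..} \<times> UNIV) (\<lambda>(t, z). fx t (fst z) (snd z))"
    and cont_fv: "continuous_on ({0..} \<times> UNIV) (\<lambda>(t, z). fv t (fst z) (snd z))"
    and supp: "\<And>T. \<exists>R>0. \<forall>t\<in>{0..T}. \<forall>x v. R < norm x \<or> R < norm v \<longrightarrow>
      f t x v = 0 \<and> ft t x v = 0 \<and> fx t x v = 0 \<and> fv t x v = 0"
    and der_t: "\<And>t x v. 0 \<le> t \<Longrightarrow> ((\<lambda>s. f s x v) has_real_derivative ft t x v) (at t within {0..})"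
    and der_x: "\<And>t x v a. 0 \<le> t \<Longrightarrow> ((\<lambda>s. f t (x + s *\<^sub>R a) v) has_real_derivative fx t x v \<bullet> a) (at 0)"
    and der_v: "\<And>t x v a. 0 \<le> t \<Longrightarrow> ((\<lambda>s. f t x (v + s *\<^sub>R a)) has_real_derivative fv t x v \<bullet> a) (at 0)"
    and cont_E: "\<And>t. 0 \<le> t \<Longrightarrow> continuous_on UNIV (E t)"
    and pde: "\<And>t x v. 0 \<le> t \<Longrightarrow> ft t x v + (v + c *\<^sub>R D t) \<bullet> fx t x v + \<sigma> * (E t x \<bullet> fv t x v) = 0"
begin

lemma supp_at:
  assumes "0 \<le> t"
  shows "\<exists>R>0. \<forall>x v. R < norm x \<or> R < norm v \<longrightarrow> f t x v = 0 \<and> ft t x v = 0 \<and> fx t x v = 0 \<and> fv t x v = 0"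
proof -
  have "t \<in> {0..t}" using assms by simp
  then show ?thesis using supp[of t] by blast
qed

lemma cont_fixed:
  assumes "0 \<le> t"
  shows "continuous_on UNIV (\<lambda>z. f t (fst z) (snd z))" "continuous_on UNIV (\<lambda>z. ft t (fst z) (snd z))"
    "continuous_on UNIV (\<lambda>z. fx t (fst z) (snd z))" "continuous_on UNIV (\<lambda>z. fv t (fst z) (snd z))"
proof -
  have *: "continuous_on UNIV (h t)" if "continuous_on ({0..} \<times> UNIV) (\<lambda>(t, z). h t z)"
    for h :: "real \<Rightarrow> vec3 \<times> vec3 \<Rightarrow> 'x::real_normed_vector"
  proof -
    have "continuous_on UNIV (\<lambda>z. (\<lambda>(t, z). h t z) (t, z))"
      by (rule continuous_on_compose2[OF that]) (use assms in \<open>auto intro!: continuous_intros\<close>)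
    then show ?thesis by simp
  qed
  show "continuous_on UNIV (\<lambda>z. f t (fst z) (snd z))" "continuous_on UNIV (\<lambda>z. ft t (fst z) (snd z))"
    "continuous_on UNIV (\<lambda>z. fx t (fst z) (snd z))" "continuous_on UNIV (\<lambda>z. fv t (fst z) (snd z))"
    by (rule *[OF cont_f] *[OF cont_ft] *[OF cont_fx] *[OF cont_fv])+
qed

text \<open>The velocity in \<open>x\<close> is independent of \<open>x\<close> and the force is
  independent of \<open>v\<close>, so a function \<beta> of \<open>f\<close> obeys the same
  transport equation, and its derivatives can be moved onto the weight \<open>w\<close>. The
  identity as \<open>\<beta>\<close> gives moments, other choices give conservation laws and
  pointwise bounds; \<open>\<beta> 0 = 0\<close> keeps the support compact.\<close>

lemma transport_identity:
  fixes w :: "vec3 \<Rightarrow> vec3 \<Rightarrow> real" and wx wv :: "vec3 \<Rightarrow> vec3 \<Rightarrow> vec3" and \<beta> \<beta>' :: "real \<Rightarrow> real"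
  assumes t: "0 \<le> t"
    and w: "continuous_on UNIV (\<lambda>z. w (fst z) (snd z))"
    and wx: "continuous_on UNIV (\<lambda>z. wx (fst z) (snd z))"
    and wv: "continuous_on UNIV (\<lambda>z. wv (fst z) (snd z))"
    and dx: "\<And>x v a. ((\<lambda>s. w (x + s *\<^sub>R a) v) has_real_derivative wx x v \<bullet> a) (at 0)"
    and dv: "\<And>x v a. ((\<lambda>s. w x (v + s *\<^sub>R a)) has_real_derivative wv x v \<bullet> a) (at 0)"
    and \<beta>: "\<And>u. (\<beta> has_real_derivative \<beta>' u) (at u)" "continuous_on UNIV \<beta>'" "\<beta> 0 = 0"
  shows "(\<integral>z. w (fst z) (snd z) * (\<beta>' (f t (fst z) (snd z)) * ft t (fst z) (snd z)) \<partial>phase_space)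
    = (\<integral>z. \<beta> (f t (fst z) (snd z)) * ((snd z + c *\<^sub>R D t) \<bullet> wx (fst z) (snd z) + \<sigma> * (E t (fst z) \<bullet> wv (fst z) (snd z)))
        \<partial>phase_space)"
proof -
  let ?M = "phase_space"
  obtain R where R: "\<And>x v. R < norm x \<or> R < norm v \<Longrightarrow> f t x v = 0 \<and> ft t x v = 0 \<and> fx t x v = 0 \<and> fv t x v = 0"
    using supp_at[OF t] by blast
  note cf = cont_fixed[OF t]
  have \<beta>c: "continuous_on UNIV \<beta>"
    using \<beta>(1) by (intro continuous_at_imp_continuous_on) (auto intro: DERIV_isCont)
  have E: "continuous_on UNIV (\<lambda>z::vec3 \<times> vec3. E t (fst z))"
    by (rule continuous_on_compose2[OF cont_E[OF t]]) (auto intro!: continuous_intros)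
  have \<beta>f: "continuous_on UNIV (\<lambda>z. \<beta> (f t (fst z) (snd z)))" "continuous_on UNIV (\<lambda>z. \<beta>' (f t (fst z) (snd z)))"
    by (rule continuous_on_compose2[OF \<beta>c cf(1)], simp) (rule continuous_on_compose2[OF \<beta>(2) cf(1)], simp)
  define b where "b v = v + c *\<^sub>R D t" for v
  define e where "e x = \<sigma> *\<^sub>R E t x" for x
  have be: "continuous_on UNIV (\<lambda>z::vec3 \<times> vec3. b (snd z))" "continuous_on UNIV (\<lambda>z::vec3 \<times> vec3. e (fst z))"
    unfolding b_def e_def by (intro continuous_intros E)+
  define g where "g z = w (fst z) (snd z) * \<beta> (f t (fst z) (snd z))" for z
  define g1 where "g1 z = (wx (fst z) (snd z) \<bullet> b (snd z)) * \<beta> (f t (fst z) (snd z))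
      + (\<beta>' (f t (fst z) (snd z)) * (fx t (fst z) (snd z) \<bullet> b (snd z))) * w (fst z) (snd z)" for z
  define g2 where "g2 z = (wv (fst z) (snd z) \<bullet> e (fst z)) * \<beta> (f t (fst z) (snd z))
      + (\<beta>' (f t (fst z) (snd z)) * (fv t (fst z) (snd z) \<bullet> e (fst z))) * w (fst z) (snd z)" for z
  have gc: "continuous_on UNIV g" "continuous_on UNIV g1" "continuous_on UNIV g2"
    unfolding g_def g1_def g2_def by (intro continuous_intros w wx wv \<beta>f be cf)+
  have gs: "g (x, v) = 0" "g1 (x, v) = 0" "g2 (x, v) = 0" if "R < norm x \<or> R < norm v" for x v
    using R[OF that] by (simp_all add: g_def g1_def g2_def \<beta>(3))
  have 1: "(\<integral>z. g1 z \<partial>?M) = 0"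
  proof (rule integral_pair_x_derivative_eq_0[OF gc(1,2), where b=b and R=R])
    fix x v
    have "((\<lambda>s. \<beta> (f t (x + s *\<^sub>R b v) v)) has_real_derivative \<beta>' (f t (x + 0 *\<^sub>R b v) v) * (fx t x v \<bullet> b v)) (at 0)"
      by (rule DERIV_chain2[OF \<beta>(1) der_x[OF t]])
    from DERIV_mult[OF dx[of x "b v" v] this] show "((\<lambda>s. g (x + s *\<^sub>R b v, v)) has_real_derivative g1 (x, v)) (at 0)"
      by (simp add: g_def g1_def)
  qed (use gs in auto)
  have 2: "(\<integral>z. g2 z \<partial>?M) = 0"
  proof (rule integral_pair_v_derivative_eq_0[OF gc(1,3), where b=e and R=R])
    fix x v
    have "((\<lambda>s. \<beta> (f t x (v + s *\<^sub>R e x))) has_real_derivative \<beta>' (f t x (v + 0 *\<^sub>R e x)) * (fv t x v \<bullet> e x)) (at 0)"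
      by (rule DERIV_chain2[OF \<beta>(1) der_v[OF t]])
    from DERIV_mult[OF dv[of x v "e x"] this] show "((\<lambda>s. g (x, v + s *\<^sub>R e x)) has_real_derivative g2 (x, v)) (at 0)"
      by (simp add: g_def g2_def)
  qed (use gs in auto)
  let ?L = "\<lambda>z. w (fst z) (snd z) * (\<beta>' (f t (fst z) (snd z)) * ft t (fst z) (snd z))"
  let ?R = "\<lambda>z. \<beta> (f t (fst z) (snd z)) * (b (snd z) \<bullet> wx (fst z) (snd z) + e (fst z) \<bullet> wv (fst z) (snd z))"
  \<comment> \<open>The equation turns the time derivative into minus the two transport terms.
    Subtracting the exact derivatives \<open>g1\<close> and \<open>g2\<close> leaves only
    derivatives of the weight.\<close>
  have eq: "?L z = ?R z - g1 z - g2 z" for z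
  proof -
    have "ft t (fst z) (snd z) = - (b (snd z) \<bullet> fx t (fst z) (snd z)) - e (fst z) \<bullet> fv t (fst z) (snd z)"
      using pde[OF t, of "fst z" "snd z"] by (simp add: b_def e_def)
    then show ?thesis by (simp only: g1_def g2_def inner_commute) (simp add: algebra_simps)
  qed
  have Rc: "continuous_on UNIV ?R"
    by (intro continuous_intros wx wv \<beta>f be)
  have ints: "integrable ?M ?R" "integrable ?M g1" "integrable ?M g2"
    by (rule integrable_pair_continuous[where R=R]; (use gc gs Rc R \<beta>(3) in simp))+
  have "(\<integral>z. ?L z \<partial>?M) = (\<integral>z. ?R z \<partial>?M)"
    unfolding eq using ints 1 2 by simp
  then show ?thesis by (simp add: b_def e_def)
qed

text \<open>What multiplies the function of \<open>f\<close> in the result is the derivative of the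
  weight along characteristics, so a weight that is nearly constant along them gives a nearly
  conserved moment.\<close>

lemma integral_weight_deriv:
  fixes w wt :: "real \<Rightarrow> vec3 \<Rightarrow> vec3 \<Rightarrow> real" and wx wv :: "vec3 \<Rightarrow> vec3 \<Rightarrow> vec3" and \<beta> \<beta>' :: "real \<Rightarrow> real"
  assumes t: "0 \<le> t"
    and w: "continuous_on ({0..} \<times> UNIV) (\<lambda>(t, z). w t (fst z) (snd z))"
    and wt: "continuous_on ({0..} \<times> UNIV) (\<lambda>(t, z). wt t (fst z) (snd z))"
    and wx: "continuous_on UNIV (\<lambda>z. wx (fst z) (snd z))"
    and wv: "continuous_on UNIV (\<lambda>z. wv (fst z) (snd z))"
    and dt: "\<And>t x v. 0 \<le> t \<Longrightarrow> ((\<lambda>s. w s x v) has_real_derivative wt t x v) (at t within {0..})"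
    and dx: "\<And>x v a. ((\<lambda>s. w t (x + s *\<^sub>R a) v) has_real_derivative wx x v \<bullet> a) (at 0)"
    and dv: "\<And>x v a. ((\<lambda>s. w t x (v + s *\<^sub>R a)) has_real_derivative wv x v \<bullet> a) (at 0)"
    and \<beta>: "\<And>u. (\<beta> has_real_derivative \<beta>' u) (at u)" "continuous_on UNIV \<beta>'" "\<beta> 0 = 0"
  shows "((\<lambda>t. \<integral>z. w t (fst z) (snd z) * \<beta> (f t (fst z) (snd z)) \<partial>phase_space) has_real_derivative
    (\<integral>z. \<beta> (f t (fst z) (snd z)) * (wt t (fst z) (snd z) + (snd z + c *\<^sub>R D t) \<bullet> wx (fst z) (snd z)
        + \<sigma> * (E t (fst z) \<bullet> wv (fst z) (snd z))) \<partial>phase_space)) (at t within {0..})"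
proof -
  let ?M = "phase_space"
  let ?G = "\<lambda>t z. w t (fst z) (snd z) * \<beta> (f t (fst z) (snd z))"
  let ?A = "\<lambda>t z. wt t (fst z) (snd z) * \<beta> (f t (fst z) (snd z))"
  let ?B = "\<lambda>t z. w t (fst z) (snd z) * (\<beta>' (f t (fst z) (snd z)) * ft t (fst z) (snd z))"
  have \<beta>c: "continuous_on UNIV \<beta>"
    using \<beta>(1) by (intro continuous_at_imp_continuous_on) (auto intro: DERIV_isCont)
  have \<beta>f: "continuous_on ({0..} \<times> UNIV) (\<lambda>(t, z). \<beta> (f t (fst z) (snd z)))"
    "continuous_on ({0..} \<times> UNIV) (\<lambda>(t, z). \<beta>' (f t (fst z) (snd z)))"
    using continuous_on_compose2[OF \<beta>c cont_f] continuous_on_compose2[OF \<beta>(2) cont_f]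
    by (simp_all add: case_prod_unfold)
  note cs = w wt cont_ft \<beta>f
  have "((\<lambda>t. \<integral>z. ?G t z \<partial>?M) has_real_derivative (\<integral>z. ?A t z + ?B t z \<partial>?M)) (at t within {0..})"
  proof (rule has_real_derivative_integral_pair)
    show "continuous_on ({0..} \<times> UNIV) (\<lambda>(t, z). ?G t z)" "continuous_on ({0..} \<times> UNIV) (\<lambda>(t, z). ?A t z + ?B t z)"
      using cs unfolding case_prod_unfold by (auto intro!: continuous_intros)
    show "\<exists>R. \<forall>t\<in>{0..T}. \<forall>x v. R < norm x \<or> R < norm v \<longrightarrow> ?G t (x, v) = 0 \<and> ?A t (x, v) + ?B t (x, v) = 0" for T
    proof -
      obtain R where R: "\<forall>t\<in>{0..T}. \<forall>x v. R < norm x \<or> R < norm v \<longrightarrow>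
          f t x v = 0 \<and> ft t x v = 0 \<and> fx t x v = 0 \<and> fv t x v = 0" using supp[of T] by blast
      show ?thesis by (rule exI[of _ R]) (use R \<beta>(3) in auto)
    qed
    show "((\<lambda>s. ?G s z) has_real_derivative ?A t z + ?B t z) (at t within {0..})" if "0 \<le> t" for t z
      using DERIV_mult[OF dt[OF that] DERIV_chain2[OF \<beta>(1) der_t[OF that]]] by (simp add: mult_ac)
  qed fact
  moreover have "(\<integral>z. ?A t z + ?B t z \<partial>?M) = (\<integral>z. \<beta> (f t (fst z) (snd z)) * (wt t (fst z) (snd z) + (snd z + c *\<^sub>R D t) \<bullet> wx (fst z) (snd z)
        + \<sigma> * (E t (fst z) \<bullet> wv (fst z) (snd z))) \<partial>?M)"
  proof -
    obtain R where R: "\<And>x v. R < norm x \<or> R < norm v \<Longrightarrow> f t x v = 0 \<and> ft t x v = 0 \<and> fx t x v = 0 \<and> fv t x v = 0"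
      using supp_at[OF t] by blast
    have slice: "continuous_on UNIV (h t)" if "continuous_on ({0..} \<times> UNIV) (\<lambda>(t, z). h t z)" for h :: "real \<Rightarrow> vec3 \<times> vec3 \<Rightarrow> real"
    proof -
      have "continuous_on UNIV (\<lambda>z. (\<lambda>(t, z). h t z) (t, z))"
        by (rule continuous_on_compose2[OF that]) (use t in \<open>auto intro!: continuous_intros\<close>)
      then show ?thesis by simp
    qed
    note cs' = slice[OF w] slice[OF wt] slice[OF cont_ft] slice[OF \<beta>f(1)] slice[OF \<beta>f(2)]
    have E: "continuous_on UNIV (\<lambda>z::vec3 \<times> vec3. E t (fst z))"
      by (rule continuous_on_compose2[OF cont_E[OF t]]) (auto intro!: continuous_intros)
    let ?C = "\<lambda>z. \<beta> (f t (fst z) (snd z)) * ((snd z + c *\<^sub>R D t) \<bullet> wx (fst z) (snd z) + \<sigma> * (E t (fst z) \<bullet> wv (fst z) (snd z)))"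
    have "continuous_on UNIV (?A t)" "continuous_on UNIV (?B t)" "continuous_on UNIV ?C"
      by (intro continuous_intros cs' wx wv E)+
    then have i: "integrable ?M (?A t)" "integrable ?M (?B t)" "integrable ?M ?C"
      using R \<beta>(3) by (auto intro!: integrable_pair_continuous[where R=R])
    have "(\<integral>z. ?A t z + ?B t z \<partial>?M) = (\<integral>z. ?A t z \<partial>?M) + (\<integral>z. ?C z \<partial>?M)"
      using i(1,2) transport_identity[OF t slice[OF w] wx wv dx dv \<beta>] by simp
    also have "\<dots> = (\<integral>z. ?A t z + ?C z \<partial>?M)" using i by simp
    also have "\<dots> = (\<integral>z. \<beta> (f t (fst z) (snd z)) * (wt t (fst z) (snd z) + (snd z + c *\<^sub>R D t) \<bullet> wx (fst z) (snd z)
        + \<sigma> * (E t (fst z) \<bullet> wv (fst z) (snd z))) \<partial>?M)"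
      by (intro Bochner_Integration.integral_cong refl) (simp add: algebra_simps)
    finally show ?thesis .
  qed
  ultimately show ?thesis by simp
qed

end

section \<open>Partial derivatives of a solution\<close>

definition dt :: "(real \<Rightarrow> density) \<Rightarrow> real \<Rightarrow> density" where
  "dt f t x v = vector_derivative (\<lambda>s. f s x v) (at t within {0..})"

definition gx :: "(real \<Rightarrow> density) \<Rightarrow> real \<Rightarrow> vec3 \<Rightarrow> vec3 \<Rightarrow> vec3" where
  "gx f t x v = grad (\<lambda>y. f t y v) x"

definition gv :: "(real \<Rightarrow> density) \<Rightarrow> real \<Rightarrow> vec3 \<Rightarrow> vec3 \<Rightarrow> vec3" where
  "gv f t x v = grad (\<lambda>w. f t x w) v"

lemma at_within_atLeast_neq_bot: "0 \<le> t \<Longrightarrow> at t within {0::real..} \<noteq> bot"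
proof -
  assume t: "0 \<le> t"
  have "t islimpt {t..t + 1}" by (simp add: islimpt_Icc)
  then have "t islimpt {0..}" by (rule islimpt_subset) (use t in auto)
  then show ?thesis by (simp add: trivial_limit_within)
qed

lemma GDERIV_direction:
  fixes f :: "vec3 \<Rightarrow> real"
  assumes "GDERIV f x :> d"
  shows "((\<lambda>s. f (x + s *\<^sub>R a)) has_real_derivative d \<bullet> a) (at 0)"
proof -
  have "((\<lambda>s. f (x + s *\<^sub>R a)) has_derivative (\<lambda>s. (s *\<^sub>R a) \<bullet> d)) (at 0)"
    by (rule has_derivative_compose[of "\<lambda>s. x + s *\<^sub>R a" "\<lambda>s. s *\<^sub>R a" 0 UNIV f "\<lambda>h. h \<bullet> d"])
       (use assms in \<open>auto intro!: derivative_eq_intros simp: gderiv_def\<close>)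
  then show ?thesis
    by (simp add: has_field_derivative_def inner_commute mult_commute_abs)
qed

lemma GDERIV_linear:
  fixes f :: "vec3 \<Rightarrow> real"
  assumes f: "(f has_derivative L) (at x)"
  shows "GDERIV f x :> (\<Sum>b\<in>Basis. L b *\<^sub>R b)"
proof -
  have "L h = h \<bullet> (\<Sum>b\<in>Basis. L b *\<^sub>R b)" for h
  proof -
    have "L h = L (\<Sum>b\<in>Basis. (h \<bullet> b) *\<^sub>R b)" by (simp add: euclidean_representation)
    also have "\<dots> = (\<Sum>b\<in>Basis. (h \<bullet> b) *\<^sub>R L b)"
      using has_derivative_linear[OF f] by (simp add: linear_sum linear_scale)
    finally show ?thesis by (simp add: inner_sum_right mult.commute)
  qed
  then have "L = (\<lambda>h. h \<bullet> (\<Sum>b\<in>Basis. L b *\<^sub>R b))" by (rule ext)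
  with f show ?thesis unfolding gderiv_def by simp
qed

text \<open>All partial derivatives are components of one joint derivative in (t, x, v) and are
  therefore jointly continuous, up to and including t = 0. The gradients inherit the support, since
  outside a ball the density vanishes on an open set.\<close>

lemma species_regular:
  fixes f :: "real \<Rightarrow> density"
  assumes C1: "C1_on ({0..} \<times> UNIV \<times> UNIV) (\<lambda>(t, x, v). f t x v)"
    and lucs: "locally_uniform_compact_support {0..} f"
  shows "continuous_on ({0..} \<times> UNIV) (\<lambda>(t, z). f t (fst z) (snd z))"
    and "continuous_on ({0..} \<times> UNIV) (\<lambda>(t, z). dt f t (fst z) (snd z))"
    and "continuous_on ({0..} \<times> UNIV) (\<lambda>(t, z). gx f t (fst z) (snd z))"
    and "continuous_on ({0..} \<times> UNIV) (\<lambda>(t, z). gv f t (fst z) (snd z))"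
    and "\<And>t x v. 0 \<le> t \<Longrightarrow> ((\<lambda>s. f s x v) has_real_derivative dt f t x v) (at t within {0..})"
    and "\<And>t x v. 0 \<le> t \<Longrightarrow> GDERIV (\<lambda>y. f t y v) x :> gx f t x v"
    and "\<And>t x v. 0 \<le> t \<Longrightarrow> GDERIV (\<lambda>w. f t x w) v :> gv f t x v"
    and "\<And>T. \<exists>R>0. \<forall>t\<in>{0..T}. \<forall>x v. R < norm x \<or> R < norm v \<longrightarrow> f t x v = 0 \<and> gx f t x v = 0 \<and> gv f t x v = 0"
proof -
  let ?S = "{0..} \<times> UNIV :: (real \<times> vec3 \<times> vec3) set"
  let ?F = "\<lambda>(t, x, v). f t x v"
  from C1 obtain F' where F': "\<And>z. z \<in> ?S \<Longrightarrow> (?F has_derivative blinfun_apply (F' z)) (at z within ?S)"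
    and F'c: "continuous_on ?S F'"
    unfolding C1_on_def UNIV_Times_UNIV by blast
  have F'h: "continuous_on ?S (\<lambda>z. blinfun_apply (F' z) h)" for h
    using bounded_linear.continuous_on[OF blinfun.bounded_linear_left F'c] .
  have "continuous_on ?S ?F"
    unfolding continuous_on_eq_continuous_within using has_derivative_continuous[OF F'] by simp
  then show "continuous_on ?S (\<lambda>(t, z). f t (fst z) (snd z))"
    by (simp add: case_prod_unfold)
  have t': "((\<lambda>s. f s x v) has_real_derivative F' (t, x, v) (1, 0, 0)) (at t within {0..})" if t: "0 \<le> t" for t x v
  proof -
    have "((\<lambda>s. ?F (s, x, v)) has_derivative (\<lambda>h. F' (t, x, v) (h, 0, 0))) (at t within {0..})"
      by (rule has_derivative_in_compose2[OF F']) (use t in \<open>auto intro!: derivative_eq_intros simp: zero_prod_def\<close>)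
    moreover have "(\<lambda>h. F' (t, x, v) (h, 0, 0)) = (*) (F' (t, x, v) (1, 0, 0))"
    proof
      fix h
      show "F' (t, x, v) (h, 0, 0) = F' (t, x, v) (1, 0, 0) * h"
        using blinfun.scaleR_right[of "F' (t, x, v)" h "(1, 0, 0)"] by (simp add: mult.commute)
    qed
    ultimately show ?thesis by (simp only: has_field_derivative_def prod.case)
  qed
  have dt: "dt f t x v = F' (t, x, v) (1, 0, 0)" if t: "0 \<le> t" for t x v
    unfolding dt_def using t'[OF t, of x v]
    by (intro vector_derivative_within at_within_atLeast_neq_bot t)
       (simp add: has_real_derivative_iff_has_vector_derivative)
  show "((\<lambda>s. f s x v) has_real_derivative dt f t x v) (at t within {0..})" if "0 \<le> t" for t x v
    using t'[OF that] dt[OF that] by simp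
  show "continuous_on ?S (\<lambda>(t, z). dt f t (fst z) (snd z))"
    by (rule continuous_on_eq[OF F'h[of "(1, 0, 0)"]]) (auto simp: dt)
  have x': "GDERIV (\<lambda>y. f t y v) x :> (\<Sum>b\<in>Basis. F' (t, x, v) (0, b, 0) *\<^sub>R b)" if t: "0 \<le> t" for t x v
  proof (rule GDERIV_linear)
    have "((\<lambda>y. ?F (t, y, v)) has_derivative (\<lambda>h. F' (t, x, v) (0, h, 0))) (at x within UNIV)"
      by (rule has_derivative_in_compose2[OF F']) (use t in \<open>auto intro!: derivative_eq_intros simp: zero_prod_def\<close>)
    then show "((\<lambda>y. f t y v) has_derivative (\<lambda>h. F' (t, x, v) (0, h, 0))) (at x)" by simp
  qed
  have v': "GDERIV (\<lambda>w. f t x w) v :> (\<Sum>b\<in>Basis. F' (t, x, v) (0, 0, b) *\<^sub>R b)" if t: "0 \<le> t" for t x v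
  proof (rule GDERIV_linear)
    have "((\<lambda>w. ?F (t, x, w)) has_derivative (\<lambda>h. F' (t, x, v) (0, 0, h))) (at v within UNIV)"
      by (rule has_derivative_in_compose2[OF F']) (use t in \<open>auto intro!: derivative_eq_intros simp: zero_prod_def\<close>)
    then show "((\<lambda>w. f t x w) has_derivative (\<lambda>h. F' (t, x, v) (0, 0, h))) (at v)" by simp
  qed
  show GX: "GDERIV (\<lambda>y. f t y v) x :> gx f t x v" if "0 \<le> t" for t x v
    unfolding gx_def grad_eqI[OF x'[OF that]] by (rule x'[OF that])
  show GV: "GDERIV (\<lambda>w. f t x w) v :> gv f t x v" if "0 \<le> t" for t x v
    unfolding gv_def grad_eqI[OF v'[OF that]] by (rule v'[OF that])
  have "continuous_on ?S (\<lambda>z. \<Sum>b\<in>Basis. F' z (0, b, 0) *\<^sub>R b)"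
    by (intro continuous_intros F'h)
  then show "continuous_on ?S (\<lambda>(t, z). gx f t (fst z) (snd z))"
    by (rule continuous_on_eq) (use grad_eqI[OF x'] in \<open>auto simp: gx_def\<close>)
  have "continuous_on ?S (\<lambda>z. \<Sum>b\<in>Basis. F' z (0, 0, b) *\<^sub>R b)"
    by (intro continuous_intros F'h)
  then show "continuous_on ?S (\<lambda>(t, z). gv f t (fst z) (snd z))"
    by (rule continuous_on_eq) (use grad_eqI[OF v'] in \<open>auto simp: gv_def\<close>)
  show "\<exists>R>0. \<forall>t\<in>{0..T}. \<forall>x v. R < norm x \<or> R < norm v \<longrightarrow> f t x v = 0 \<and> gx f t x v = 0 \<and> gv f t x v = 0" for T
  proof -
    have J: "compact {0..T} \<and> {0..T} \<subseteq> {0..}" by auto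
    from lucs[unfolded locally_uniform_compact_support_def, THEN spec, THEN mp, OF J]
    obtain K where K: "compact K" "\<forall>t\<in>{0..T}. \<forall>x v. (x, v) \<notin> K \<longrightarrow> f t x v = 0"
      by (elim exE conjE)
    obtain R where R: "\<And>z. z \<in> K \<Longrightarrow> norm z \<le> R"
      using compact_imp_bounded[OF K(1)] bounded_iff by blast
    define R' where "R' = max 1 R"
    have f0: "f t x v = 0" if "t \<in> {0..T}" "R' < norm x \<or> R' < norm v" for t x v
    proof -
      have "(x, v) \<notin> K"
        using R[of "(x, v)"] that(2) norm_fst_le[of x v] norm_snd_le[of v x] by (auto simp: R'_def)
      then show ?thesis using K(2) that(1) by blast
    qed
    have z: "d = 0" if "GDERIV h x :> d" "open A" "x \<in> A" "\<And>y. y \<in> A \<Longrightarrow> h y = 0" for h :: "vec3 \<Rightarrow> real" and x d A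
    proof -
      have "((\<lambda>_. 0) has_derivative (\<lambda>k. k \<bullet> d)) (at x)"
        using that has_derivative_transform_within_open[of h "\<lambda>k. k \<bullet> d" x UNIV A "\<lambda>_. 0"] by (auto simp: gderiv_def)
      then have "GDERIV (\<lambda>_. 0) x :> d" by (simp add: gderiv_def)
      then show ?thesis by (rule GDERIV_unique[OF _ GDERIV_const])
    qed
    have o: "open {y::vec3. R' < norm y}" by (intro open_Collect_less continuous_intros)
    have "gx f t x v = 0" if t: "t \<in> {0..T}" and xv: "R' < norm x \<or> R' < norm v" for t x v
      using xv
    proof
      assume "R' < norm x"
      then show ?thesis using t f0 by (intro z[OF GX o]) auto
    next
      assume "R' < norm v"
      then show ?thesis using t f0 by (intro z[OF GX open_UNIV]) auto
    qed
    moreover have "gv f t x v = 0" if t: "t \<in> {0..T}" and xv: "R' < norm x \<or> R' < norm v" for t x v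
      using xv
    proof
      assume "R' < norm v"
      then show ?thesis using t f0 by (intro z[OF GV o]) auto
    next
      assume "R' < norm x"
      then show ?thesis using t f0 by (intro z[OF GV open_UNIV]) auto
    qed
    ultimately show ?thesis using f0 by (intro exI[of _ R']) (auto simp: R'_def)
  qed
qed

section \<open>Spatial densities as velocity averages\<close>

lemma bounded_density_mono:
  assumes "bounded_density \<phi> A R" "A \<le> A'" "R \<le> R'"
  shows "bounded_density \<phi> A' R'"
proof -
  interpret bounded_density \<phi> A R by fact
  show ?thesis
  proof
    show "\<bar>\<phi> x\<bar> \<le> A'" for x using bnd[of x] assms(2) by linarith
    show "0 < R'" using R assms(3) by linarith
    show "\<phi> x = 0" if "R' < norm x" for x using supp assms(3) that by simp
  qed measurable
qed

lemma bounded_density_diff: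
  assumes "bounded_density \<phi> A R" "bounded_density \<psi> B R"
  shows "bounded_density (\<lambda>x. \<phi> x - \<psi> x) (A + B) R"
proof -
  interpret a: bounded_density \<phi> A R by fact
  interpret b: bounded_density \<psi> B R by fact
  show ?thesis
  proof
    show "\<bar>\<phi> x - \<psi> x\<bar> \<le> A + B" for x using a.bnd[of x] b.bnd[of x] by linarith
    show "0 < R" by (rule a.R)
    show "\<phi> x - \<psi> x = 0" if "R < norm x" for x using a.supp b.supp that by simp
  qed measurable
qed

lemma bounded_density_marginal:
  fixes g :: "vec3 \<times> vec3 \<Rightarrow> real"
  assumes m: "g \<in> borel_measurable borel" and B: "\<And>z. \<bar>g z\<bar> \<le> B" and R: "0 < R"
    and supp: "\<And>x v. R < norm x \<or> R < norm v \<Longrightarrow> g (x, v) = 0"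
  shows "bounded_density (\<lambda>x. \<integral>v. g (x, v) \<partial>lborel) (B * (\<kappa> * R ^ 3)) R"
proof
  have [measurable]: "g \<in> borel_measurable (borel \<Otimes>\<^sub>M borel)" using m by (simp add: borel_prod)
  show "(\<lambda>x. \<integral>v. g (x, v) \<partial>lborel) \<in> borel_measurable borel" by measurable
  show "0 < R" by fact
  show "(\<integral>v. g (x, v) \<partial>lborel) = 0" if "R < norm x" for x using supp that by simp
  show "\<bar>\<integral>v. g (x, v) \<partial>lborel\<bar> \<le> B * (\<kappa> * R ^ 3)" for x
  proof -
    have "\<bar>\<integral>v. g (x, v) \<partial>lborel\<bar> \<le> (\<integral>v. \<bar>g (x, v)\<bar> \<partial>lborel)" by (rule integral_abs_bound)
    also have "\<dots> \<le> (\<integral>v. B * indicator (cball (0::vec3) R) v \<partial>lborel)"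
    proof (rule integral_mono)
      show "integrable lborel (\<lambda>v. \<bar>g (x, v)\<bar>)"
        by (intro integrable_abs integrable_bounded_support[where B=B and R=R]) (use B supp in auto)
      show "integrable lborel (\<lambda>v. B * indicator (cball (0::vec3) R) v)"
        using emeasure_lborel_cball_finite by (intro integrable_mult_right integrable_real_indicator) auto
      show "\<bar>g (x, v)\<bar> \<le> B * indicator (cball 0 R) v" for v
        using B[of "(x, v)"] supp[of x v] by (auto simp: indicator_def not_le)
    qed
    also have "\<dots> = B * (\<kappa> * R ^ 3)"
      using R \<kappa>_pos by (simp add: measure_def emeasure_ball_vec3)
    finally show ?thesis .
  qed
qed

context transport
begin

text \<open>One \<open>B\<close> and one \<open>R\<close> for a whole compact time interval and for
  the derivatives as well: differentiating the interaction energy in time calls for a majorant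
  uniform in time.\<close>

lemma rho_densities:
  "\<exists>B R. \<forall>t\<in>{0..T}. bounded_density (rho (f t)) B R \<and> bounded_density (\<lambda>x. \<integral>v. ft t x v \<partial>lborel) B R \<and>
     (\<forall>a. bounded_density (\<lambda>x. \<integral>v. fx t x v \<bullet> a \<partial>lborel) (B * norm a) R)"
proof -
  obtain R where R: "0 < R" "\<forall>t\<in>{0..T}. \<forall>x v. R < norm x \<or> R < norm v \<longrightarrow>
      f t x v = 0 \<and> ft t x v = 0 \<and> fx t x v = 0 \<and> fv t x v = 0" using supp[of T] by blast
  have sub: "{0..T} \<times> UNIV \<subseteq> {0..} \<times> (UNIV :: (vec3 \<times> vec3) set)" by auto
  obtain B1 where B1: "0 \<le> B1" "\<forall>t\<in>{0..T}. \<forall>z. norm (f t (fst z) (snd z)) \<le> B1"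
    using compact_support_bounded[OF continuous_on_subset[OF cont_f sub], of R] R(2) by auto
  obtain B2 where B2: "0 \<le> B2" "\<forall>t\<in>{0..T}. \<forall>z. norm (ft t (fst z) (snd z)) \<le> B2"
    using compact_support_bounded[OF continuous_on_subset[OF cont_ft sub], of R] R(2) by auto
  obtain B3 where B3: "0 \<le> B3" "\<forall>t\<in>{0..T}. \<forall>z. norm (fx t (fst z) (snd z)) \<le> B3"
    using compact_support_bounded[OF continuous_on_subset[OF cont_fx sub], of R] R(2) by auto
  define B where "B = max B1 (max B2 B3)"
  have "bounded_density (rho (f t)) (B * (\<kappa> * R ^ 3)) R \<and> bounded_density (\<lambda>x. \<integral>v. ft t x v \<partial>lborel) (B * (\<kappa> * R ^ 3)) R \<and>
     (\<forall>a. bounded_density (\<lambda>x. \<integral>v. fx t x v \<bullet> a \<partial>lborel) (B * (\<kappa> * R ^ 3) * norm a) R)" if t: "t \<in> {0..T}" for t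
  proof (intro conjI allI)
    have t0: "0 \<le> t" using t by simp
    note m = borel_measurable_continuous_onI[OF cont_fixed(1)[OF t0]] borel_measurable_continuous_onI[OF cont_fixed(2)[OF t0]]
      borel_measurable_continuous_onI[OF cont_fixed(3)[OF t0]]
    have "bounded_density (\<lambda>x. \<integral>v. f t (fst (x, v)) (snd (x, v)) \<partial>lborel) (B * (\<kappa> * R ^ 3)) R"
      by (rule bounded_density_marginal[OF m(1)]) (use B1(2) R t in \<open>auto simp: B_def le_max_iff_disj\<close>)
    then show "bounded_density (rho (f t)) (B * (\<kappa> * R ^ 3)) R" by (simp add: rho_def[abs_def])
    have "bounded_density (\<lambda>x. \<integral>v. ft t (fst (x, v)) (snd (x, v)) \<partial>lborel) (B * (\<kappa> * R ^ 3)) R"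
      by (rule bounded_density_marginal[OF m(2)]) (use B2(2) R t in \<open>auto simp: B_def le_max_iff_disj\<close>)
    then show "bounded_density (\<lambda>x. \<integral>v. ft t x v \<partial>lborel) (B * (\<kappa> * R ^ 3)) R" by simp
    fix a
    have "bounded_density (\<lambda>x. \<integral>v. fx t (fst (x, v)) (snd (x, v)) \<bullet> a \<partial>lborel) ((B * norm a) * (\<kappa> * R ^ 3)) R"
    proof (rule bounded_density_marginal)
      show "(\<lambda>z. fx t (fst z) (snd z) \<bullet> a) \<in> borel_measurable borel" using m(3) by measurable
      show "\<bar>fx t (fst z) (snd z) \<bullet> a\<bar> \<le> B * norm a" for z
      proof -
        have "norm (fx t (fst z) (snd z)) \<le> B" using B3(2) t by (auto simp: B_def le_max_iff_disj)
        from mult_right_mono[OF this norm_ge_zero[of a]] show ?thesis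
          by (rule order_trans[OF Cauchy_Schwarz_ineq2])
      qed
    qed (use R t in auto)
    then show "bounded_density (\<lambda>x. \<integral>v. fx t x v \<bullet> a \<partial>lborel) (B * (\<kappa> * R ^ 3) * norm a) R" by (simp add: mult_ac)
  qed
  then show ?thesis by blast
qed

lemma integrable_v:
  assumes "0 \<le> t"
  shows "integrable lborel (f t x)"
proof -
  obtain R where R: "\<And>x v. R < norm x \<or> R < norm v \<Longrightarrow> f t x v = 0"
    using supp_at[OF assms] by blast
  have c: "continuous_on UNIV (f t x)"
  proof -
    have "continuous_on UNIV (\<lambda>v. (\<lambda>z. f t (fst z) (snd z)) (x, v))"
      by (rule continuous_on_compose2[OF cont_fixed(1)[OF assms]]) (auto intro!: continuous_intros)
    then show ?thesis by simp
  qed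
  show ?thesis by (rule integrable_continuous_support[OF c]) (use R in auto)
qed

lemma rho_time_deriv:
  assumes t: "0 \<le> t"
  shows "((\<lambda>s. rho (f s) x) has_real_derivative (\<integral>v. ft t x v \<partial>lborel)) (at t within {0..})"
proof -
  define T where "T = t + 1"
  have tT: "t \<in> {0..T}" "t < T" using t by (auto simp: T_def)
  obtain R where R: "0 < R" "\<forall>t\<in>{0..T}. \<forall>x v. R < norm x \<or> R < norm v \<longrightarrow>
      f t x v = 0 \<and> ft t x v = 0 \<and> fx t x v = 0 \<and> fv t x v = 0" using supp[of T] by blast
  have sub: "{0..T} \<times> UNIV \<subseteq> {0..} \<times> (UNIV :: (vec3 \<times> vec3) set)" by auto
  obtain B where B: "0 \<le> B" "\<forall>t\<in>{0..T}. \<forall>z. norm (ft t (fst z) (snd z)) \<le> B"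
    using compact_support_bounded[OF continuous_on_subset[OF cont_ft sub], of R] R(2) by auto
  have "((\<lambda>s. \<integral>v. f s x v \<partial>lborel) has_real_derivative (\<integral>v. ft t x v \<partial>lborel)) (at t within {0..T})"
  proof (rule has_real_derivative_integral(2)[where g="\<lambda>v. B * indicator (cball 0 R) v" and F'="\<lambda>s. ft s x"])
    show "convex {0..T}" by simp
    show "t \<in> {0..T}" by (rule tT)
    show "t islimpt {0..T}" using tT by (auto simp: islimpt_Icc)
    show "integrable lborel (f s x)" if "s \<in> {0..T}" for s using that by (intro integrable_v) simp
    show "((\<lambda>s. f s x v) has_real_derivative ft s x v) (at s within {0..T})" if "s \<in> {0..T}" for s v
      using der_t[of s x v] that by (auto intro: has_field_derivative_subset)
    show "\<bar>ft s x v\<bar> \<le> B * indicator (cball 0 R) v" if "s \<in> {0..T}" for s v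
      using B(2)[rule_format, OF that, of "(x, v)"] R(2)[rule_format, OF that, of x v] by (auto simp: indicator_def not_le)
    show "integrable lborel (\<lambda>v. B * indicator (cball 0 R) v)"
      using emeasure_lborel_cball_finite by (intro integrable_mult_right integrable_real_indicator) auto
  qed
  moreover have "at t within {0..T} = at t within {0..}"
    by (rule at_within_nhd[where S="{..<T}"]) (use tT in auto)
  ultimately show ?thesis by (simp add: rho_def)
qed

lemma rho_space_deriv:
  assumes t: "0 \<le> t"
  shows "((\<lambda>s. rho (f t) (x + s *\<^sub>R a)) has_real_derivative (\<integral>v. fx t x v \<bullet> a \<partial>lborel)) (at 0)"
proof -
  obtain R where R: "0 < R" "\<forall>x v. R < norm x \<or> R < norm v \<longrightarrow>
      f t x v = 0 \<and> ft t x v = 0 \<and> fx t x v = 0 \<and> fv t x v = 0" using supp_at[OF t] by blast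
  have c: "continuous_on ({0..0::real} \<times> UNIV) (\<lambda>(s, z). fx t (fst z) (snd z))"
    unfolding case_prod_unfold by (intro continuous_on_compose2[OF cont_fixed(3)[OF t]] continuous_intros) auto
  obtain B where B: "0 \<le> B" "\<forall>z. norm (fx t (fst z) (snd z)) \<le> B"
    using compact_support_bounded[OF c, of R] R(2) by auto
  let ?T = "{-1..1::real}"
  have d: "((\<lambda>s. f t (x + s *\<^sub>R a) v) has_real_derivative fx t (x + s *\<^sub>R a) v \<bullet> a) (at s within ?T)" for s v
  proof -
    have "((\<lambda>u. f t ((x + s *\<^sub>R a) + (u - s) *\<^sub>R a) v) has_real_derivative fx t (x + s *\<^sub>R a) v \<bullet> a) (at s)"
      using DERIV_shift[of "\<lambda>u. f t (x + s *\<^sub>R a + (u - s) *\<^sub>R a) v" _ 0 s] der_x[OF t, of "x + s *\<^sub>R a" a v]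
      by (simp add: add.commute)
    then have "((\<lambda>s. f t (x + s *\<^sub>R a) v) has_real_derivative fx t (x + s *\<^sub>R a) v \<bullet> a) (at s)"
      by (simp add: algebra_simps)
    then show ?thesis by (rule has_field_derivative_at_within)
  qed
  have "((\<lambda>s. \<integral>v. f t (x + s *\<^sub>R a) v \<partial>lborel) has_real_derivative (\<integral>v. fx t (x + 0 *\<^sub>R a) v \<bullet> a \<partial>lborel)) (at 0 within ?T)"
  proof (rule has_real_derivative_integral(2)[where g="\<lambda>v. B * norm a * indicator (cball 0 R) v" and F'="\<lambda>s v. fx t (x + s *\<^sub>R a) v \<bullet> a"])
    show "integrable lborel (f t (x + s *\<^sub>R a))" for s by (rule integrable_v[OF t])
    show "\<bar>fx t (x + s *\<^sub>R a) v \<bullet> a\<bar> \<le> B * norm a * indicator (cball 0 R) v" for s v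
    proof (cases "norm v \<le> R")
      case True
      have "norm (fx t (x + s *\<^sub>R a) v) * norm a \<le> B * norm a" using B(2)[rule_format, of "(x + s *\<^sub>R a, v)"] by (intro mult_right_mono) auto
      then show ?thesis using Cauchy_Schwarz_ineq2[of "fx t (x + s *\<^sub>R a) v" a] True by simp
    qed (use R in auto)
    show "integrable lborel (\<lambda>v. B * norm a * indicator (cball 0 R) v)"
      using emeasure_lborel_cball_finite by (intro integrable_mult_right integrable_real_indicator) auto
  qed (auto simp: islimpt_Icc intro: d)
  then show ?thesis by (simp add: rho_def at_within_Icc_at)
qed

lemma rho_integral:
  assumes t: "0 \<le> t" and c: "continuous_on UNIV w"
  shows "(\<integral>x. rho (f t) x * w x \<partial>lborel) = (\<integral>z. f t (fst z) (snd z) * w (fst z) \<partial>phase_space)"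
    and "(\<integral>x. (\<integral>v. ft t x v \<partial>lborel) * w x \<partial>lborel) = (\<integral>z. ft t (fst z) (snd z) * w (fst z) \<partial>phase_space)"
proof -
  obtain R where R: "0 < R" "\<forall>x v. R < norm x \<or> R < norm v \<longrightarrow>
      f t x v = 0 \<and> ft t x v = 0 \<and> fx t x v = 0 \<and> fv t x v = 0" using supp_at[OF t] by blast
  have w: "continuous_on UNIV (\<lambda>z::vec3 \<times> vec3. w (fst z))"
    by (rule continuous_on_compose2[OF c]) (auto intro!: continuous_intros)
  have "integrable phase_space (\<lambda>z. f t (fst z) (snd z) * w (fst z))"
    by (rule integrable_pair_continuous[where R=R]) (use R cont_fixed[OF t] w in \<open>auto intro!: continuous_intros\<close>)
  from lborel_pair.integral_fst'[OF this]
  show "(\<integral>x. rho (f t) x * w x \<partial>lborel) = (\<integral>z. f t (fst z) (snd z) * w (fst z) \<partial>phase_space)"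
    by (simp add: rho_def)
  have "integrable phase_space (\<lambda>z. ft t (fst z) (snd z) * w (fst z))"
    by (rule integrable_pair_continuous[where R=R]) (use R cont_fixed[OF t] w in \<open>auto intro!: continuous_intros\<close>)
  from lborel_pair.integral_fst'[OF this]
  show "(\<integral>x. (\<integral>v. ft t x v \<partial>lborel) * w x \<partial>lborel) = (\<integral>z. ft t (fst z) (snd z) * w (fst z) \<partial>phase_space)"
    by simp
qed

end

section \<open>The coupled system\<close>

lemma transport_of_C1:
  fixes f :: "real \<Rightarrow> density"
  assumes C1: "C1_on ({0..} \<times> UNIV \<times> UNIV) (\<lambda>(t, x, v). f t x v)"
    and lucs: "locally_uniform_compact_support {0..} f"
    and E: "\<And>t. 0 \<le> t \<Longrightarrow> continuous_on UNIV (E t)"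
    and pde: "\<And>t x v. 0 \<le> t \<Longrightarrow> dt f t x v + (v + c *\<^sub>R D t) \<bullet> gx f t x v + \<sigma> * (E t x \<bullet> gv f t x v) = 0"
  shows "transport f (dt f) (gx f) (gv f) c \<sigma> D E"
proof
  note reg = species_regular[OF C1 lucs]
  show "continuous_on ({0..} \<times> UNIV) (\<lambda>(t, z). f t (fst z) (snd z))"
    "continuous_on ({0..} \<times> UNIV) (\<lambda>(t, z). dt f t (fst z) (snd z))"
    "continuous_on ({0..} \<times> UNIV) (\<lambda>(t, z). gx f t (fst z) (snd z))"
    "continuous_on ({0..} \<times> UNIV) (\<lambda>(t, z). gv f t (fst z) (snd z))"
    by (fact reg(1) reg(2) reg(3) reg(4))+
  show "((\<lambda>s. f s x v) has_real_derivative dt f t x v) (at t within {0..})" if "0 \<le> t" for t x v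
    using that by (rule reg(5))
  show "((\<lambda>s. f t (x + s *\<^sub>R a) v) has_real_derivative gx f t x v \<bullet> a) (at 0)" if "0 \<le> t" for t x v a
    using GDERIV_direction[OF reg(6)[OF that]] by simp
  show "((\<lambda>s. f t x (v + s *\<^sub>R a)) has_real_derivative gv f t x v \<bullet> a) (at 0)" if "0 \<le> t" for t x v a
    using GDERIV_direction[OF reg(7)[OF that]] by simp
  show "continuous_on UNIV (E t)" if "0 \<le> t" for t using that by (rule E)
  show "dt f t x v + (v + c *\<^sub>R D t) \<bullet> gx f t x v + \<sigma> * (E t x \<bullet> gv f t x v) = 0" if "0 \<le> t" for t x v
    using that by (rule pde)
  show "\<exists>R>0. \<forall>t\<in>{0..T}. \<forall>x v. R < norm x \<or> R < norm v \<longrightarrow>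
      f t x v = 0 \<and> dt f t x v = 0 \<and> gx f t x v = 0 \<and> gv f t x v = 0" for T
  proof -
    obtain R where R: "R > 0" "\<forall>t\<in>{0..T}. \<forall>x v. R < norm x \<or> R < norm v \<longrightarrow>
      f t x v = 0 \<and> gx f t x v = 0 \<and> gv f t x v = 0" using reg(8)[of T] by (elim exE conjE)
    \<comment> \<open>The support of the time derivative is read off the equation: where both
      gradients vanish, it must vanish too.\<close>
    have "dt f t x v = 0" if "t \<in> {0..T}" "R < norm x \<or> R < norm v" for t x v
    proof -
      from R(2)[rule_format, OF that] have "gx f t x v = 0" "gv f t x v = 0" by auto
      then show ?thesis using pde[of t x v] that(1) by simp
    qed
    then show ?thesis using R by blast
  qed
qed

text \<open>Matches the component sum in \<open>laplacian\<close> with the basis sum in Green's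
  identity.\<close>

lemma sum_axis_eq_sum_Basis: "(\<Sum>i\<in>UNIV. h (axis i 1) $ i) = (\<Sum>b\<in>Basis. h b \<bullet> b)" for h :: "vec3 \<Rightarrow> vec3"
proof -
  have B: "(Basis :: vec3 set) = range (\<lambda>i. axis i 1)" by (auto simp: Basis_vec_def)
  have "inj (\<lambda>i::3. axis i (1::real))" by (auto simp: inj_def axis_eq_axis)
  then have "(\<Sum>b\<in>Basis. h b \<bullet> b) = (\<Sum>i\<in>UNIV. h (axis i 1) \<bullet> axis i 1)"
    unfolding B by (simp add: sum.reindex o_def)
  then show ?thesis by (simp add: inner_axis)
qed

section \<open>Field, charge and energy balance of a solution\<close>

locale vpd =
  fixes \<epsilon> :: real and fp fm :: "real \<Rightarrow> density"
  assumes sol: "VPD_solution \<epsilon> {0..} fp fm"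
begin

definition U where "U t = potential (fp t) (fm t)"
definition E where "E t = grad (U t)"
definition D where "D t = D2 (fp t) (fm t)"
definition r where "r t x = rho (fp t) x - rho (fm t) x"
definition dr where "dr t x = (\<integral>v. dt fp t x v \<partial>lborel) - (\<integral>v. dt fm t x v \<partial>lborel)"
definition drx where "drx t a x = (\<integral>v. gx fp t x v \<bullet> a \<partial>lborel) - (\<integral>v. gx fm t x v \<bullet> a \<partial>lborel)"

lemma sol':
  shows "C1_on ({0..} \<times> UNIV \<times> UNIV) (\<lambda>(t, x, v). fp t x v)" "C1_on ({0..} \<times> UNIV \<times> UNIV) (\<lambda>(t, x, v). fm t x v)"
    and "locally_uniform_compact_support {0..} fp" "locally_uniform_compact_support {0..} fm"
  using sol unfolding VPD_solution_def by simp_all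

lemma sol_at:
  assumes "0 \<le> t"
  shows "dt fp t x v + (v + \<epsilon> *\<^sub>R D t) \<bullet> gx fp t x v + E t x \<bullet> gv fp t x v = 0"
    and "dt fm t x v + (v - \<epsilon> *\<^sub>R D t) \<bullet> gx fm t x v - E t x \<bullet> gv fm t x v = 0"
    and "U t differentiable (at x)" and "E t differentiable (at x)"
    and "laplacian (U t) x = 4 * pi * r t x"
  using sol assms unfolding VPD_solution_def dt_def gx_def gv_def U_def E_def D_def r_def Let_def by auto

lemma cont_U: "0 \<le> t \<Longrightarrow> continuous_on UNIV (U t)" and cont_E: "0 \<le> t \<Longrightarrow> continuous_on UNIV (E t)"
  by (auto intro!: continuous_at_imp_continuous_on differentiable_imp_continuous_within sol_at)

sublocale p: transport fp "dt fp" "gx fp" "gv fp" \<epsilon> 1 D E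
  by (rule transport_of_C1[OF sol'(1,3)]) (use cont_E sol_at(1) in auto)

sublocale m: transport fm "dt fm" "gx fm" "gv fm" "- \<epsilon>" "- 1" D E
  by (rule transport_of_C1[OF sol'(2,4)]) (use cont_E sol_at(2) in auto)

lemma r_densities:
  "\<exists>B R. \<forall>t\<in>{0..T}. bounded_density (r t) B R \<and> bounded_density (dr t) B R \<and>
     (\<forall>a. bounded_density (drx t a) (B * norm a) R)
     \<and> bounded_density (rho (fp t)) B R \<and> bounded_density (rho (fm t)) B R"
proof -
  obtain B1 R1 where 1: "\<forall>t\<in>{0..T}. bounded_density (rho (fp t)) B1 R1 \<and> bounded_density (\<lambda>x. \<integral>v. dt fp t x v \<partial>lborel) B1 R1 \<and>
     (\<forall>a. bounded_density (\<lambda>x. \<integral>v. gx fp t x v \<bullet> a \<partial>lborel) (B1 * norm a) R1)"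
    using p.rho_densities[of T] by (elim exE)
  obtain B2 R2 where 2: "\<forall>t\<in>{0..T}. bounded_density (rho (fm t)) B2 R2 \<and> bounded_density (\<lambda>x. \<integral>v. dt fm t x v \<partial>lborel) B2 R2 \<and>
     (\<forall>a. bounded_density (\<lambda>x. \<integral>v. gx fm t x v \<bullet> a \<partial>lborel) (B2 * norm a) R2)"
    using m.rho_densities[of T] by (elim exE)
  define R where "R = max R1 R2"
  define B where "B = \<bar>B1\<bar> + \<bar>B2\<bar>"
  have R: "R1 \<le> R" "R2 \<le> R" by (auto simp: R_def)
  have "bounded_density (r t) B R \<and> bounded_density (dr t) B R \<and> (\<forall>a. bounded_density (drx t a) (B * norm a) R)
     \<and> bounded_density (rho (fp t)) B R \<and> bounded_density (rho (fm t)) B R"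
    if t: "t \<in> {0..T}" for t
  proof -
    note b = bspec[OF 1 t] bspec[OF 2 t]
    have p: "bounded_density (rho (fp t)) \<bar>B1\<bar> R" and p': "bounded_density (\<lambda>x. \<integral>v. dt fp t x v \<partial>lborel) \<bar>B1\<bar> R"
      and p'': "\<And>a. bounded_density (\<lambda>x. \<integral>v. gx fp t x v \<bullet> a \<partial>lborel) (\<bar>B1\<bar> * norm a) R"
    proof -
      show "bounded_density (rho (fp t)) \<bar>B1\<bar> R" "bounded_density (\<lambda>x. \<integral>v. dt fp t x v \<partial>lborel) \<bar>B1\<bar> R"
        using b(1) R by (auto elim!: bounded_density_mono)
      show "bounded_density (\<lambda>x. \<integral>v. gx fp t x v \<bullet> a \<partial>lborel) (\<bar>B1\<bar> * norm a) R" for a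
        by (rule bounded_density_mono[of _ "B1 * norm a" R1]) (use b(1) R in \<open>auto intro: mult_right_mono\<close>)
    qed
    have m: "bounded_density (rho (fm t)) \<bar>B2\<bar> R" and m': "bounded_density (\<lambda>x. \<integral>v. dt fm t x v \<partial>lborel) \<bar>B2\<bar> R"
      and m'': "\<And>a. bounded_density (\<lambda>x. \<integral>v. gx fm t x v \<bullet> a \<partial>lborel) (\<bar>B2\<bar> * norm a) R"
    proof -
      show "bounded_density (rho (fm t)) \<bar>B2\<bar> R" "bounded_density (\<lambda>x. \<integral>v. dt fm t x v \<partial>lborel) \<bar>B2\<bar> R"
        using b(2) R by (auto elim!: bounded_density_mono)
      show "bounded_density (\<lambda>x. \<integral>v. gx fm t x v \<bullet> a \<partial>lborel) (\<bar>B2\<bar> * norm a) R" for a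
        by (rule bounded_density_mono[of _ "B2 * norm a" R2]) (use b(2) R in \<open>auto intro: mult_right_mono\<close>)
    qed
    have "bounded_density (drx t a) (B * norm a) R" for a
      using bounded_density_diff[OF p'' m'', of a] by (simp add: drx_def[abs_def] B_def distrib_right)
    moreover have "bounded_density (rho (fp t)) B R" "bounded_density (rho (fm t)) B R"
      using bounded_density_mono[OF p, of B R] bounded_density_mono[OF m, of B R] by (auto simp: B_def)
    ultimately show ?thesis
      using bounded_density_diff[OF p m] bounded_density_diff[OF p' m'] by (simp add: r_def[abs_def] dr_def[abs_def] B_def)
  qed
  then show ?thesis by blast
qed

lemma charge_r:
  assumes t: "0 \<le> t"
  shows "\<exists>B R. charge (r t) B R (drx t) B"
proof -
  have tt: "t \<in> {0..t}" using t by simp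
  obtain B R where BR: "bounded_density (r t) B R" "\<And>a. bounded_density (drx t a) (B * norm a) R"
    using r_densities[of t] tt by blast
  interpret bounded_density "r t" B R by (rule BR)
  have "charge (r t) B R (drx t) B"
  proof
    fix a x
    interpret d: bounded_density "drx t a" "B * norm a" R by (rule BR)
    show "drx t a \<in> borel_measurable borel" by measurable
    show "((\<lambda>s. r t (x + s *\<^sub>R a)) has_real_derivative drx t a x) (at 0)"
      unfolding r_def drx_def by (intro DERIV_diff p.rho_space_deriv m.rho_space_deriv t)
    show "\<bar>drx t a x\<bar> \<le> B * norm a" by (rule d.bnd)
    show "drx t a x = 0" if "R < norm x" using that by (rule d.supp)
  qed
  then show ?thesis by blast
qed

lemma U_eq_newton:
  assumes t: "0 \<le> t"
  shows "U t = newton (r t)"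
proof -
  obtain B R where "charge (r t) B R (drx t) B" using charge_r[OF t] by blast
  then interpret charge "r t" B R "drx t" B .
  show ?thesis
  proof
    fix x
    have "conv (\<lambda>z. norm z powr - 1) (r t) x = (\<integral>y. norm (x - y) powr - 1 * r t y \<partial>lborel)"
      by (rule conv_eq[OF kernel_norm_1])
    also have "\<dots> = (\<integral>y. r t y / norm (x - y) \<partial>lborel)"
      by (intro Bochner_Integration.integral_cong refl) (simp add: powr_minus_divide)
    finally show "U t x = newton (r t) x" by (simp add: U_def potential_def newton_def r_def)
  qed
qed

lemma E_eq_field:
  assumes t: "0 \<le> t"
  shows "E t = field (r t)"
proof
  fix x
  obtain B R where "charge (r t) B R (drx t) B" using charge_r[OF t] by blast
  then interpret charge "r t" B R "drx t" B .
  show "E t x = field (r t) x"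
    unfolding E_def using sol_at(3)[OF t, of x] unfolding U_eq_newton[OF t]
    by (intro grad_eqI GDERIV_newton)
qed

lemma U_direction:
  assumes t: "0 \<le> t"
  shows "((\<lambda>s. U t (x + s *\<^sub>R a)) has_real_derivative E t x \<bullet> a) (at 0)"
proof -
  obtain B R where "charge (r t) B R (drx t) B" using charge_r[OF t] by blast
  then interpret charge "r t" B R "drx t" B .
  show ?thesis unfolding U_eq_newton[OF t] E_eq_field[OF t] by (rule newton_deriv)
qed

text \<open>The field energy in three guises. Green's identity gives the interaction form, an
  integral over the compact support of the charge, which can be differentiated in time; the virial
  identity gives the form with \<open>x \<bullet> E t x\<close>, which is the one that arises from
  the dispersion functional.\<close>

lemma potential_energy:
  assumes t: "0 \<le> t"
  shows "integrable lborel (\<lambda>x. norm (E t x) ^ 2)"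
    and "E_pot (fp t) (fm t) = - 1/2 * (\<integral>x. r t x * U t x \<partial>lborel)"
    and "E_pot (fp t) (fm t) = (\<integral>x. r t x * (x \<bullet> E t x) \<partial>lborel)"
    and "(\<integral>x. norm (E t x) ^ 2 \<partial>lborel) = 8 * pi * E_pot (fp t) (fm t)"
proof -
  obtain B R where "charge (r t) B R (drx t) B" using charge_r[OF t] by blast
  then interpret charge "r t" B R "drx t" B .
  have lap: "(\<Sum>b\<in>Basis. frechet_derivative (field (r t)) (at x) b \<bullet> b) = 4 * pi * r t x" for x
    using sol_at(5)[OF t, of x] E_eq_field[OF t]
    unfolding laplacian_def E_def[symmetric] by (simp add: sum_axis_eq_sum_Basis)
  have diff: "field (r t) differentiable (at x)" for x
    using sol_at(4)[OF t, of x] E_eq_field[OF t] by simp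
  note g = green_identity[OF diff lap]
  show "integrable lborel (\<lambda>x. norm (E t x) ^ 2)" unfolding E_eq_field[OF t] by (rule g(1))
  have pot: "E_pot (fp t) (fm t) = 1 / (8 * pi) * (\<integral>x. norm (E t x) ^ 2 \<partial>lborel)"
    by (simp add: E_pot_def E_def U_def)
  then show "(\<integral>x. norm (E t x) ^ 2 \<partial>lborel) = 8 * pi * E_pot (fp t) (fm t)" by simp
  show 1: "E_pot (fp t) (fm t) = - 1/2 * (\<integral>x. r t x * U t x \<partial>lborel)"
    unfolding pot unfolding E_eq_field[OF t] g(2) U_eq_newton[OF t] by simp
  show "E_pot (fp t) (fm t) = (\<integral>x. r t x * (x \<bullet> E t x) \<partial>lborel)"
    unfolding 1 unfolding E_eq_field[OF t] virial U_eq_newton[OF t] by simp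
qed

lemma E_pot_nonneg: "0 \<le> E_pot (fp t) (fm t)"
  unfolding E_pot_def by (intro mult_nonneg_nonneg) auto

text \<open>The power of the field on the particles. It is gained by the kinetic and lost by the
  potential energy and hence cancels from the total.\<close>

definition X where "X t = (\<integral>z. fp t (fst z) (snd z) * (snd z \<bullet> E t (fst z)) \<partial>phase_space)
   - (\<integral>z. fm t (fst z) (snd z) * (snd z \<bullet> E t (fst z)) \<partial>phase_space)"

lemma integrable_weight:
  fixes w :: "vec3 \<times> vec3 \<Rightarrow> real"
  assumes t: "0 \<le> t" and w: "continuous_on UNIV w"
  shows "integrable phase_space (\<lambda>z. fp t (fst z) (snd z) * w z)"
    and "integrable phase_space (\<lambda>z. fm t (fst z) (snd z) * w z)"
proof -
  obtain R where R: "\<And>x v. R < norm x \<or> R < norm v \<Longrightarrow> fp t x v = 0" using p.supp_at[OF t] by blast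
  show "integrable phase_space (\<lambda>z. fp t (fst z) (snd z) * w z)"
    by (rule integrable_pair_continuous[where R=R]) (use R w p.cont_fixed[OF t] in \<open>auto intro!: continuous_intros\<close>)
  obtain S where S: "\<And>x v. S < norm x \<or> S < norm v \<Longrightarrow> fm t x v = 0" using m.supp_at[OF t] by blast
  show "integrable phase_space (\<lambda>z. fm t (fst z) (snd z) * w z)"
    by (rule integrable_pair_continuous[where R=S]) (use S w m.cont_fixed[OF t] in \<open>auto intro!: continuous_intros\<close>)
qed

lemma cont_E_fst: "0 \<le> t \<Longrightarrow> continuous_on UNIV (\<lambda>z::vec3 \<times> vec3. E t (fst z))"
  by (rule continuous_on_compose2[OF cont_E]) (auto intro!: continuous_intros)

lemma cont_U_fst: "0 \<le> t \<Longrightarrow> continuous_on UNIV (\<lambda>z::vec3 \<times> vec3. U t (fst z))"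
  by (rule continuous_on_compose2[OF cont_U]) (auto intro!: continuous_intros)

text \<open>Both species enter with a plus sign, unlike in the charge. As a phase-space integral the
  damping vector can be recognized where opposite drifts meet opposite charges.\<close>

lemma D_inner:
  assumes t: "0 \<le> t"
  shows "D t \<bullet> a = (\<integral>z. fp t (fst z) (snd z) * (a \<bullet> E t (fst z)) \<partial>phase_space)
    + (\<integral>z. fm t (fst z) (snd z) * (a \<bullet> E t (fst z)) \<partial>phase_space)"
proof -
  have tt: "t \<in> {0..t}" using t by simp
  obtain B R where BR: "bounded_density (r t) B R" "bounded_density (rho (fp t)) B R" "bounded_density (rho (fm t)) B R"
    using r_densities[of t] tt by blast
  interpret bounded_density "r t" B R by (rule BR)
  interpret p: bounded_density "rho (fp t)" B R by (rule BR)
  interpret m: bounded_density "rho (fm t)" B R by (rule BR)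
  have Eb: "norm (E t x) \<le> B * kernel_mass R" for x unfolding E_eq_field[OF t] by (rule field_bound)
  have [measurable]: "E t \<in> borel_measurable borel" unfolding E_eq_field[OF t] by measurable
  have i: "integrable lborel (\<lambda>x. \<phi> x *\<^sub>R E t x)" if "bounded_density \<phi> B R" for \<phi>
  proof -
    interpret \<phi>: bounded_density \<phi> B R by fact
    show ?thesis
    proof (rule integrable_bounded_support[where R=R])
      show "norm (\<phi> x *\<^sub>R E t x) \<le> B * (B * kernel_mass R)" for x
        unfolding norm_scaleR using \<phi>.bnd[of x] Eb[of x] by (intro mult_mono) auto
    qed (use \<phi>.supp in auto)
  qed
  have "D t = (\<integral>x. rho (fp t) x *\<^sub>R E t x + rho (fm t) x *\<^sub>R E t x \<partial>lborel)"
    by (simp add: D_def D2_def E_def U_def scaleR_add_left)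
  also have "\<dots> = (\<integral>x. rho (fp t) x *\<^sub>R E t x \<partial>lborel) + (\<integral>x. rho (fm t) x *\<^sub>R E t x \<partial>lborel)"
    using i[OF BR(2)] i[OF BR(3)] by (rule Bochner_Integration.integral_add)
  finally have "D t \<bullet> a = (\<integral>x. rho (fp t) x * (a \<bullet> E t x) \<partial>lborel) + (\<integral>x. rho (fm t) x * (a \<bullet> E t x) \<partial>lborel)"
    using integral_inner_left[OF i[OF BR(2)], of a] integral_inner_left[OF i[OF BR(3)], of a]
    by (simp add: inner_add_left inner_add_right inner_commute)
  moreover have "continuous_on UNIV (\<lambda>x. a \<bullet> E t x)" by (intro continuous_intros cont_E t)
  ultimately show ?thesis using p.rho_integral(1)[OF t] m.rho_integral(1)[OF t] by simp
qed

text \<open>The potential at the fixed time \<open>t\<close> is inserted as weight into both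
  transport equations. The velocities contribute \<open>X t\<close>. The drifts of the two species
  have opposite signs, and so have their charges, so the drift contributions add up to
  \<open>\<epsilon> * (D t \<bullet> D t)\<close>.\<close>

lemma potential_energy_deriv:
  assumes t: "0 \<le> t"
  shows "((\<lambda>t. E_pot (fp t) (fm t)) has_real_derivative - X t - \<epsilon> * (norm (D t))\<^sup>2) (at t within {0..})"
proof -
  let ?M = "phase_space"
  define T where "T = t + 1"
  have tT: "t \<in> {0..T}" "t < T" using t by (auto simp: T_def)
  obtain B R where BR: "\<And>s. s \<in> {0..T} \<Longrightarrow> bounded_density (r s) B R \<and> bounded_density (dr s) B R"
    using r_densities[of T] by blast
  have "((\<lambda>s. \<integral>x. r s x * newton (r s) x \<partial>lborel) has_real_derivative
    2 * (\<integral>x. dr t x * newton (r t) x \<partial>lborel)) (at t within {0..T})"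
  proof (rule newton_energy_deriv)
    show "convex {0..T}" by simp
    show "t \<in> {0..T}" by (rule tT)
    show "t islimpt {0..T}" using tT by (auto simp: islimpt_Icc)
    show "bounded_density (r s) B R" "bounded_density (dr s) B R" if "s \<in> {0..T}" for s using BR[OF that] by auto
    show "((\<lambda>s. r s x) has_real_derivative dr s x) (at s within {0..T})" if "s \<in> {0..T}" for s x
    proof -
      have "((\<lambda>s. r s x) has_real_derivative dr s x) (at s within {0..})"
        unfolding r_def dr_def using that by (intro DERIV_diff p.rho_time_deriv m.rho_time_deriv) auto
      then show ?thesis by (rule has_field_derivative_subset) auto
    qed
  qed
  moreover have "at t within {0..T} = at t within {0..}"
    by (rule at_within_nhd[where S="{..<T}"]) (use tT in auto)
  ultimately have "((\<lambda>s. \<integral>x. r s x * newton (r s) x \<partial>lborel) has_real_derivative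
    2 * (\<integral>x. dr t x * newton (r t) x \<partial>lborel)) (at t within {0..})" by simp
  from DERIV_cmult[OF this, of "- 1/2"]
  have "((\<lambda>s. - 1/2 * (\<integral>x. r s x * newton (r s) x \<partial>lborel)) has_real_derivative
    - (\<integral>x. dr t x * U t x \<partial>lborel)) (at t within {0..})" by (simp add: U_eq_newton[OF t])
  then have *: "((\<lambda>s. E_pot (fp s) (fm s)) has_real_derivative - (\<integral>x. dr t x * U t x \<partial>lborel)) (at t within {0..})"
    by (rule has_field_derivative_transform_within[where d=1]) (use t potential_energy(2) U_eq_newton in auto)
  have tt: "t \<in> {0..t}" using t by simp
  have Z: "continuous_on UNIV (\<lambda>z::vec3 \<times> vec3. 0::vec3)" by simp
  have one: "continuous_on UNIV (\<lambda>u::real. 1::real)" "\<And>u::real. ((\<lambda>u. u) has_real_derivative 1) (at u)" by auto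
  have ip: "(\<integral>z. U t (fst z) * dt fp t (fst z) (snd z) \<partial>?M) = (\<integral>z. fp t (fst z) (snd z) * ((snd z + \<epsilon> *\<^sub>R D t) \<bullet> E t (fst z)) \<partial>?M)"
    using p.transport_identity[OF t cont_U_fst[OF t] cont_E_fst[OF t] Z _ _ one(2,1)] U_direction[OF t] by simp
  have im: "(\<integral>z. U t (fst z) * dt fm t (fst z) (snd z) \<partial>?M) = (\<integral>z. fm t (fst z) (snd z) * ((snd z + (- \<epsilon>) *\<^sub>R D t) \<bullet> E t (fst z)) \<partial>?M)"
    using m.transport_identity[OF t cont_U_fst[OF t] cont_E_fst[OF t] Z _ _ one(2,1)] U_direction[OF t] by simp
  have "(\<integral>x. dr t x * U t x \<partial>lborel) = (\<integral>x. (\<integral>v. dt fp t x v \<partial>lborel) * U t x \<partial>lborel) - (\<integral>x. (\<integral>v. dt fm t x v \<partial>lborel) * U t x \<partial>lborel)"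
  proof -
    have i: "integrable lborel (\<lambda>x. \<phi> x * U t x)" if \<phi>: "bounded_density \<phi> A S" for \<phi> A S
    proof -
      obtain B R where "bounded_density (r t) B R" using r_densities[of t] tt by blast
      then interpret bounded_density "r t" B R .
      interpret \<phi>: bounded_density \<phi> A S by fact
      have Ub: "\<bar>U t x\<bar> \<le> B * kernel_mass R" for x unfolding U_eq_newton[OF t] by (rule newton_bound)
      have [measurable]: "U t \<in> borel_measurable borel" unfolding U_eq_newton[OF t] by measurable
      show ?thesis
      proof (rule integrable_bounded_support[where R=S])
        show "norm (\<phi> x * U t x) \<le> A * (B * kernel_mass R)" for x
          unfolding real_norm_def abs_mult using \<phi>.bnd[of x] Ub[of x] by (intro mult_mono) auto
      qed (use \<phi>.supp in auto)
    qed
    obtain B1 R1 where 1: "bounded_density (\<lambda>x. \<integral>v. dt fp t x v \<partial>lborel) B1 R1" using p.rho_densities[of t] tt by blast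
    obtain B2 R2 where 2: "bounded_density (\<lambda>x. \<integral>v. dt fm t x v \<partial>lborel) B2 R2" using m.rho_densities[of t] tt by blast
    show ?thesis unfolding dr_def left_diff_distrib using i[OF 1] i[OF 2] by (rule Bochner_Integration.integral_diff)
  qed
  also have "\<dots> = (\<integral>z. fp t (fst z) (snd z) * ((snd z + \<epsilon> *\<^sub>R D t) \<bullet> E t (fst z)) \<partial>?M)
      - (\<integral>z. fm t (fst z) (snd z) * ((snd z + (- \<epsilon>) *\<^sub>R D t) \<bullet> E t (fst z)) \<partial>?M)"
    unfolding p.rho_integral(2)[OF t cont_U[OF t]] m.rho_integral(2)[OF t cont_U[OF t]] ip[symmetric] im[symmetric]
    by (simp only: mult.commute)
  also have "\<dots> = X t + \<epsilon> * (D t \<bullet> D t)"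
  proof -
    have c: "continuous_on UNIV (\<lambda>z::vec3 \<times> vec3. snd z \<bullet> E t (fst z))" "continuous_on UNIV (\<lambda>z::vec3 \<times> vec3. D t \<bullet> E t (fst z))"
      by (intro continuous_intros cont_E_fst t)+
    note i = integrable_weight[OF t c(1)] integrable_weight[OF t c(2)]
    have s: "h * ((v + e *\<^sub>R D t) \<bullet> y) = h * (v \<bullet> y) + e * (h * (D t \<bullet> y))" for h e and v y :: vec3
      by (simp add: inner_add_left algebra_simps)
    show ?thesis unfolding s X_def using i D_inner[OF t, of "D t"] by (simp add: algebra_simps)
  qed
  finally show ?thesis using * by (simp add: power2_norm_eq_inner algebra_simps)
qed

end

section \<open>Conservation laws and pointwise bounds\<close>

lemma continuous_nonneg_integral_0:
  fixes g :: "vec3 \<times> vec3 \<Rightarrow> real"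
  assumes c: "continuous_on UNIV g" and n: "\<And>z. 0 \<le> g z"
    and i: "integrable phase_space g" and z: "(\<integral>z. g z \<partial>phase_space) = 0"
  shows "g z = 0"
proof (rule ccontr)
  assume nz: "g z \<noteq> 0"
  have "AE z in phase_space. g z = 0"
    using integral_nonneg_eq_0_iff_AE[OF i] n z by auto
  then have "AE z in lborel. g z = 0" by (simp only: lborel_prod)
  moreover have o: "open {z. g z \<noteq> 0}" by (intro open_Collect_neq c continuous_on_const)
  ultimately have "{z. g z \<noteq> 0} \<in> null_sets lborel"
    by (subst (asm) AE_iff_null) auto
  then have "negligible {z. g z \<noteq> 0}"
    by (simp add: negligible_iff_null_sets null_sets_completionI)
  then show False using open_not_negligible[OF o] nz by blast
qed

lemma nonincreasing_from_0:
  fixes \<phi> :: "real \<Rightarrow> real"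
  assumes d: "\<And>t. 0 \<le> t \<Longrightarrow> (\<phi> has_real_derivative \<phi>' t) (at t within {0..})"
    and n: "\<And>t. 0 \<le> t \<Longrightarrow> \<phi>' t \<le> 0" and t: "0 \<le> a" "a \<le> b"
  shows "\<phi> b \<le> \<phi> a"
proof (rule DERIV_nonpos_imp_decreasing_open[OF t(2)])
  fix x assume "a < x" "x < b"
  then have "0 < x" using t by linarith
  then have "at x within {0..} = at x"
    by (intro at_within_interior) simp
  then show "\<exists>y. (\<phi> has_real_derivative y) (at x) \<and> y \<le> 0"
    using d[of x] n[of x] \<open>0 < x\<close> by (intro exI[of _ "\<phi>' x"]) simp
next
  have "continuous_on {0..} \<phi>"
    unfolding continuous_on_eq_continuous_within using d has_field_derivative_imp_has_derivative has_derivative_continuous by fastforce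
  then show "continuous_on {a..b} \<phi>" by (rule continuous_on_subset) (use t in auto)
qed

lemma DERIV_norm_sq: "((\<lambda>s. norm (y + s *\<^sub>R a) ^ 2 / 2) has_real_derivative y \<bullet> a) (at 0)" for y a :: vec3
proof -
  have eq: "norm (y + s *\<^sub>R a) ^ 2 / 2 = norm y ^ 2 / 2 + s * (y \<bullet> a) + s ^ 2 * (norm a ^ 2 / 2)" for s
    by (simp only: power2_norm_eq_inner)
       (simp add: inner_add_left inner_add_right inner_commute[of a y] power2_eq_square algebra_simps add_divide_distrib)
  show ?thesis unfolding eq by (auto intro!: derivative_eq_intros)
qed

context transport
begin

lemma integral_renormalized_const:
  assumes \<beta>: "\<And>u. (\<beta> has_real_derivative \<beta>' u) (at u)" "continuous_on UNIV \<beta>'" "\<beta> 0 = 0" and t: "0 \<le> t"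
  shows "(\<integral>z. \<beta> (f t (fst z) (snd z)) \<partial>phase_space) = (\<integral>z. \<beta> (f 0 (fst z) (snd z)) \<partial>phase_space)"
proof -
  have d: "((\<lambda>t. \<integral>z. \<beta> (f t (fst z) (snd z)) \<partial>phase_space) has_real_derivative 0) (at s within {0..})" if "0 \<le> s" for s
    using integral_weight_deriv[OF that, of "\<lambda>_ _ _. 1" "\<lambda>_ _ _. 0" "\<lambda>_ _. 0" "\<lambda>_ _. 0" \<beta> \<beta>', OF _ _ _ _ _ _ _ \<beta>]
    by (simp add: case_prod_unfold)
  obtain k where "\<forall>s\<in>{0..}. (\<integral>z. \<beta> (f s (fst z) (snd z)) \<partial>phase_space) = k"
    using has_field_derivative_zero_constant[of "{0..}" "\<lambda>t. \<integral>z. \<beta> (f t (fst z) (snd z)) \<partial>phase_space"] d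
    by auto
  then show ?thesis using t by simp
qed

text \<open>The integral of the renormalized density is conserved and starts at 0, and a continuous
  nonnegative function with integral 0 vanishes everywhere. This is a maximum principle once
  \<open>\<beta>\<close> penalizes the forbidden values.\<close>

lemma renormalized_eq_0:
  assumes \<beta>: "\<And>u. (\<beta> has_real_derivative \<beta>' u) (at u)" "continuous_on UNIV \<beta>'" "\<beta> 0 = 0"
    and nn: "\<And>u. 0 \<le> \<beta> u" and init: "\<And>x v. \<beta> (f 0 x v) = 0" and t: "0 \<le> t"
  shows "\<beta> (f t x v) = 0"
proof -
  have \<beta>c: "continuous_on UNIV \<beta>"
    using \<beta>(1) by (intro continuous_at_imp_continuous_on) (auto intro: DERIV_isCont)
  obtain R where R: "\<And>x v. R < norm x \<or> R < norm v \<Longrightarrow> f t x v = 0" using supp_at[OF t] by blast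
  have c: "continuous_on UNIV (\<lambda>z. \<beta> (f t (fst z) (snd z)))"
    by (rule continuous_on_compose2[OF \<beta>c cont_fixed(1)[OF t]]) simp
  have "\<beta> (f t (fst (x, v)) (snd (x, v))) = 0"
  proof (rule continuous_nonneg_integral_0[OF c])
    show "integrable phase_space (\<lambda>z. \<beta> (f t (fst z) (snd z)))"
      by (rule integrable_pair_continuous[OF c, of R]) (use R \<beta>(3) in simp)
    show "(\<integral>z. \<beta> (f t (fst z) (snd z)) \<partial>phase_space) = 0"
      unfolding integral_renormalized_const[OF \<beta> t] init by simp
  qed (rule nn)
  then show ?thesis by simp
qed

text \<open>The bounds \<open>0 \<le> f \<le> M\<close> are propagated by testing with \<open>\<beta> u = max(0, -u)\<^sup>2\<close> and
  \<open>\<beta> u = max(0, u - M)\<^sup>2\<close>, which needs no flow of characteristics.\<close>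

lemma nonneg:
  assumes init: "\<And>x v. 0 \<le> f 0 x v" and t: "0 \<le> t"
  shows "0 \<le> f t x v"
proof -
  have "(max 0 (- f t x v))\<^sup>2 = 0"
  proof (rule renormalized_eq_0[where \<beta>="\<lambda>u. (max 0 (- u))\<^sup>2" and \<beta>'="\<lambda>u. - (2 * max 0 (- u))"])
    show "((\<lambda>u. (max 0 (- u))\<^sup>2) has_real_derivative - (2 * max 0 (- u))) (at u)" for u :: real
    proof -
      have "((\<lambda>u. (max 0 (- u))\<^sup>2) has_real_derivative 2 * max 0 (- u) * (- 1)) (at u)"
        by (rule DERIV_chain2[where f="\<lambda>u. (max 0 u)\<^sup>2" and g="\<lambda>u. - u", OF DERIV_pos_part_sq])
           (auto intro!: derivative_eq_intros)
      then show ?thesis by simp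
    qed
  qed (use init t in \<open>auto intro!: continuous_intros\<close>)
  then show ?thesis by (simp add: max_def split: if_splits)
qed

lemma upper_bound:
  assumes init: "\<And>x v. f 0 x v \<le> M" and M: "0 \<le> M" and t: "0 \<le> t"
  shows "f t x v \<le> M"
proof -
  have "(max 0 (f t x v - M))\<^sup>2 = 0"
  proof (rule renormalized_eq_0[where \<beta>="\<lambda>u. (max 0 (u - M))\<^sup>2" and \<beta>'="\<lambda>u. 2 * max 0 (u - M)"])
    show "((\<lambda>u. (max 0 (u - M))\<^sup>2) has_real_derivative 2 * max 0 (u - M)) (at u)" for u :: real
    proof -
      have "((\<lambda>u. (max 0 (u - M))\<^sup>2) has_real_derivative 2 * max 0 (u - M) * 1) (at u)"
        by (rule DERIV_chain2[where f="\<lambda>u. (max 0 u)\<^sup>2" and g="\<lambda>u. u - M", OF DERIV_pos_part_sq])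
           (auto intro!: derivative_eq_intros)
      then show ?thesis by simp
    qed
  qed (use init M t in \<open>auto intro!: continuous_intros\<close>)
  then show ?thesis by (simp add: max_def split: if_splits)
qed

end

section \<open>The dispersion functional and its derivative\<close>

definition phase_integral :: "(vec3 \<Rightarrow> vec3 \<Rightarrow> real) \<Rightarrow> real" where
  "phase_integral F = (\<integral>z. F (fst z) (snd z) \<partial>phase_space)"

text \<open>The vector x - s v is constant under free streaming when \<open>s\<close> grows with
  unit speed, so only force and damping contribute to the derivative of this moment. Smallness
  relative to s^2 says that velocities concentrate near x / s.\<close>

definition dispersion :: "real \<Rightarrow> density \<Rightarrow> real" where
  "dispersion s f = phase_integral (\<lambda>x v. norm (x - s *\<^sub>R v) ^ 2 / 2 * f x v)"

context transport
begin

lemma kinetic_deriv: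
  assumes t: "0 \<le> t"
  shows "((\<lambda>t. phase_integral (\<lambda>x v. norm v ^ 2 / 2 * f t x v)) has_real_derivative
     phase_integral (\<lambda>x v. f t x v * (\<sigma> * (v \<bullet> E t x)))) (at t within {0..})"
proof -
  have "((\<lambda>t. \<integral>z. norm (snd z) ^ 2 / 2 * f t (fst z) (snd z) \<partial>phase_space) has_real_derivative
    (\<integral>z. f t (fst z) (snd z) * (0 + (snd z + c *\<^sub>R D t) \<bullet> 0 + \<sigma> * (E t (fst z) \<bullet> snd z)) \<partial>phase_space)) (at t within {0..})"
    by (rule integral_weight_deriv[OF t, where w="\<lambda>_ _ v. norm v ^ 2 / 2" and wt="\<lambda>_ _ _. 0" and wx="\<lambda>_ _. 0"
          and wv="\<lambda>_ v. v" and \<beta>="\<lambda>u. u" and \<beta>'="\<lambda>_. 1"])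
       (auto intro!: continuous_intros DERIV_norm_sq simp: case_prod_unfold)
  then show ?thesis by (simp add: phase_integral_def inner_commute)
qed

lemma dispersion_deriv:
  assumes t: "0 \<le> t"
  shows "((\<lambda>t. dispersion (1 + t) (f t)) has_real_derivative
     phase_integral (\<lambda>x v. f t x v * (c * (D t \<bullet> (x - (1 + t) *\<^sub>R v)) - \<sigma> * (1 + t) * (E t x \<bullet> (x - (1 + t) *\<^sub>R v))))) (at t within {0..})"
proof -
  let ?y = "\<lambda>t z. fst z - (1 + t) *\<^sub>R snd z :: vec3"
  have "((\<lambda>t. \<integral>z. norm (?y t z) ^ 2 / 2 * f t (fst z) (snd z) \<partial>phase_space) has_real_derivative
    (\<integral>z. f t (fst z) (snd z) * (- (?y t z \<bullet> snd z) + (snd z + c *\<^sub>R D t) \<bullet> ?y t z + \<sigma> * (E t (fst z) \<bullet> (- (1 + t) *\<^sub>R ?y t z))) \<partial>phase_space)) (at t within {0..})"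
  proof (rule integral_weight_deriv[OF t, where w="\<lambda>t x v. norm (x - (1 + t) *\<^sub>R v) ^ 2 / 2"
        and wt="\<lambda>t x v. - ((x - (1 + t) *\<^sub>R v) \<bullet> v)" and wx="\<lambda>x v. x - (1 + t) *\<^sub>R v"
        and wv="\<lambda>x v. - (1 + t) *\<^sub>R (x - (1 + t) *\<^sub>R v)" and \<beta>="\<lambda>u. u" and \<beta>'="\<lambda>_. 1"])
    show "((\<lambda>s. norm (x - (1 + s) *\<^sub>R v) ^ 2 / 2) has_real_derivative - ((x - (1 + s) *\<^sub>R v) \<bullet> v)) (at s within {0..})" for s :: real and x v :: vec3
    proof -
      have "((\<lambda>u. norm ((x - (1 + s) *\<^sub>R v) + (u - s) *\<^sub>R (- v)) ^ 2 / 2) has_real_derivative (x - (1 + s) *\<^sub>R v) \<bullet> (- v)) (at s)"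
        using DERIV_shift[of "\<lambda>u. norm ((x - (1 + s) *\<^sub>R v) + (u - s) *\<^sub>R (- v)) ^ 2 / 2" _ 0 s] DERIV_norm_sq[of "x - (1 + s) *\<^sub>R v" "- v"]
        by (simp add: add.commute)
      moreover have eq: "(x - (1 + s) *\<^sub>R v) + (u - s) *\<^sub>R (- v) = x - (1 + u) *\<^sub>R v" for u
        by (simp add: algebra_simps)
      ultimately have "((\<lambda>u. norm (x - (1 + u) *\<^sub>R v) ^ 2 / 2) has_real_derivative - ((x - (1 + s) *\<^sub>R v) \<bullet> v)) (at s)"
        by (simp only: eq inner_minus_right)
      then show ?thesis by (rule has_field_derivative_at_within)
    qed
    show "((\<lambda>s. norm (x + s *\<^sub>R a - (1 + t) *\<^sub>R v) ^ 2 / 2) has_real_derivative (x - (1 + t) *\<^sub>R v) \<bullet> a) (at 0)" for x v a :: vec3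
      using DERIV_norm_sq[of "x - (1 + t) *\<^sub>R v" a] by (simp add: diff_add_eq)
    show "((\<lambda>s. norm (x - (1 + t) *\<^sub>R (v + s *\<^sub>R a)) ^ 2 / 2) has_real_derivative (- (1 + t) *\<^sub>R (x - (1 + t) *\<^sub>R v)) \<bullet> a) (at 0)" for x v a :: vec3
    proof -
      have eq: "x - (1 + t) *\<^sub>R (v + s *\<^sub>R a) = (x - (1 + t) *\<^sub>R v) + s *\<^sub>R (- (1 + t) *\<^sub>R a)" for s
        by (simp add: algebra_simps)
      show ?thesis
        unfolding eq using DERIV_norm_sq[of "x - (1 + t) *\<^sub>R v" "- (1 + t) *\<^sub>R a"]
        by (simp only: inner_scaleR_left inner_scaleR_right)
    qed
  qed (auto intro!: continuous_intros simp: case_prod_unfold)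
  \<comment> \<open>The explicit time derivative cancels against the transport by \<open>v\<close>:
    this is the invariance under free streaming.\<close>
  moreover have "f t x v * (- ((x - (1 + t) *\<^sub>R v) \<bullet> v) + (v + c *\<^sub>R D t) \<bullet> (x - (1 + t) *\<^sub>R v) + \<sigma> * (E t x \<bullet> (- (1 + t) *\<^sub>R (x - (1 + t) *\<^sub>R v))))
     = f t x v * (c * (D t \<bullet> (x - (1 + t) *\<^sub>R v)) - \<sigma> * (1 + t) * (E t x \<bullet> (x - (1 + t) *\<^sub>R v)))" for x v
    by (simp only: inner_add_left inner_scaleR_left inner_scaleR_right inner_commute[of v]) algebra
  ultimately show ?thesis by (simp only: dispersion_def phase_integral_def)
qed

end

context vpd
begin

lemma E_kin_eq:
  assumes t: "0 \<le> t"
  shows "E_kin (fp t) (fm t) = phase_integral (\<lambda>x v. norm v ^ 2 / 2 * fp t x v) + phase_integral (\<lambda>x v. norm v ^ 2 / 2 * fm t x v)"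
proof -
  have c: "continuous_on UNIV (\<lambda>z::vec3 \<times> vec3. norm (snd z) ^ 2 / 2)" by (auto intro!: continuous_intros)
  note i = integrable_weight[OF t c]
  have ip: "integrable phase_space (\<lambda>(x, v). (norm v)\<^sup>2 * (fp t x v + fm t x v))"
    using Bochner_Integration.integrable_add[OF i]
      integrable_mult_right[of 2 "phase_space" "\<lambda>z. fp t (fst z) (snd z) * (norm (snd z) ^ 2 / 2) + fm t (fst z) (snd z) * (norm (snd z) ^ 2 / 2)"]
    by (simp add: case_prod_unfold algebra_simps)
  have "E_kin (fp t) (fm t) = 1 / 2 * (\<integral>z. (norm (snd z))\<^sup>2 * (fp t (fst z) (snd z) + fm t (fst z) (snd z)) \<partial>phase_space)"
    using lborel_pair.integral_snd[OF ip] by (simp add: E_kin_def case_prod_unfold)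
  also have "\<dots> = (\<integral>z. fp t (fst z) (snd z) * (norm (snd z) ^ 2 / 2) + fm t (fst z) (snd z) * (norm (snd z) ^ 2 / 2) \<partial>phase_space)"
    by (subst Bochner_Integration.integral_mult_right_zero[symmetric]) (simp add: algebra_simps)
  also have "\<dots> = phase_integral (\<lambda>x v. norm v ^ 2 / 2 * fp t x v) + phase_integral (\<lambda>x v. norm v ^ 2 / 2 * fm t x v)"
    using i by (simp add: phase_integral_def mult.commute)
  finally show ?thesis .
qed

lemma kinetic_energy_deriv:
  assumes t: "0 \<le> t"
  shows "((\<lambda>t. E_kin (fp t) (fm t)) has_real_derivative X t) (at t within {0..})"
proof -
  have "((\<lambda>t. phase_integral (\<lambda>x v. norm v ^ 2 / 2 * fp t x v) + phase_integral (\<lambda>x v. norm v ^ 2 / 2 * fm t x v)) has_real_derivative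
     phase_integral (\<lambda>x v. fp t x v * (1 * (v \<bullet> E t x))) + phase_integral (\<lambda>x v. fm t x v * (- 1 * (v \<bullet> E t x)))) (at t within {0..})"
    by (intro DERIV_add p.kinetic_deriv m.kinetic_deriv t)
  also have "phase_integral (\<lambda>x v. fp t x v * (1 * (v \<bullet> E t x))) + phase_integral (\<lambda>x v. fm t x v * (- 1 * (v \<bullet> E t x))) = X t"
    by (simp add: X_def phase_integral_def)
  finally show ?thesis
    by (rule has_field_derivative_transform_within[where d=1]) (use t E_kin_eq in auto)
qed

lemma energy_deriv:
  assumes t: "0 \<le> t"
  shows "((\<lambda>t. energy (fp t) (fm t)) has_real_derivative - \<epsilon> * (norm (D t))\<^sup>2) (at t within {0..})"
  using DERIV_add[OF kinetic_energy_deriv[OF t] potential_energy_deriv[OF t]] by (simp add: energy_def)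

definition G where "G t = dispersion (1 + t) (fp t) + dispersion (1 + t) (fm t)"
text \<open>The drifts push the two species in opposite directions, so the damping enters the
  dispersion through a difference, which has no sign.\<close>

definition Y where "Y t = phase_integral (\<lambda>x v. fp t x v * (D t \<bullet> (x - (1 + t) *\<^sub>R v))) - phase_integral (\<lambda>x v. fm t x v * (D t \<bullet> (x - (1 + t) *\<^sub>R v)))"
text \<open>The weight (1 + t)^2 is dictated by \<open>X\<close>, which occurs in the derivative of
  \<open>G\<close> with exactly this factor and cancels against the loss of potential
  energy.\<close>

definition h where "h t = G t + (1 + t) ^ 2 * E_pot (fp t) (fm t)"

text \<open>The force term pairs \<open>E\<close> with x - (1 + t) v and carries the factor -(1 +
  t). Its x-part is the virial form of the potential energy, its v-part is \<open>X t\<close> with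
  factor (1 + t)^2.\<close>

lemma G_deriv:
  assumes t: "0 \<le> t"
  shows "(G has_real_derivative \<epsilon> * Y t - (1 + t) * E_pot (fp t) (fm t) + (1 + t) ^ 2 * X t) (at t within {0..})"
proof -
  let ?M = "phase_space"
  let ?y = "\<lambda>z. fst z - (1 + t) *\<^sub>R snd z :: vec3"
  have c: "continuous_on UNIV (\<lambda>z::vec3 \<times> vec3. D t \<bullet> ?y z)" "continuous_on UNIV (\<lambda>z::vec3 \<times> vec3. fst z \<bullet> E t (fst z))"
    "continuous_on UNIV (\<lambda>z::vec3 \<times> vec3. snd z \<bullet> E t (fst z))"
    by (intro continuous_intros cont_E_fst t)+
  note i = integrable_weight[OF t c(1)] integrable_weight[OF t c(2)] integrable_weight[OF t c(3)]
  have s: "f * (e * (D t \<bullet> ?y z) - \<sigma> * (1 + t) * (E t (fst z) \<bullet> ?y z))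
     = e * (f * (D t \<bullet> ?y z)) - \<sigma> * (1 + t) * (f * (fst z \<bullet> E t (fst z))) + \<sigma> * (1 + t) ^ 2 * (f * (snd z \<bullet> E t (fst z)))" for f e \<sigma> z
    by (simp add: inner_diff_right inner_commute power2_eq_square algebra_simps)
  have ep: "(\<integral>z. fp t (fst z) (snd z) * (fst z \<bullet> E t (fst z)) \<partial>?M) - (\<integral>z. fm t (fst z) (snd z) * (fst z \<bullet> E t (fst z)) \<partial>?M)
      = E_pot (fp t) (fm t)"
  proof -
    have c': "continuous_on UNIV (\<lambda>x. x \<bullet> E t x)" by (intro continuous_intros cont_E t)
    have tt: "t \<in> {0..t}" using t by simp
    obtain B R where b: "bounded_density (rho (fp t)) B R" "bounded_density (rho (fm t)) B R" "bounded_density (r t) B R"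
      using r_densities[of t] tt by blast
    have j: "integrable lborel (\<lambda>x. \<phi> x * (x \<bullet> E t x))" if \<phi>: "bounded_density \<phi> B R" for \<phi>
    proof -
      interpret \<phi>: bounded_density \<phi> B R by fact
      interpret bounded_density "r t" B R by (rule b)
      have Eb: "norm (E t x) \<le> B * kernel_mass R" for x unfolding E_eq_field[OF t] by (rule field_bound)
      have [measurable]: "E t \<in> borel_measurable borel" unfolding E_eq_field[OF t] by measurable
      show ?thesis
      proof (rule integrable_bounded_support[where R=R])
        show "norm (\<phi> x * (x \<bullet> E t x)) \<le> B * (R * (B * kernel_mass R))" for x
        proof (cases "norm x \<le> R")
          case True
          have "norm x * norm (E t x) \<le> R * (B * kernel_mass R)" using True Eb[of x] R by (intro mult_mono) auto
          then have "\<bar>x \<bullet> E t x\<bar> \<le> R * (B * kernel_mass R)" using Cauchy_Schwarz_ineq2[of x "E t x"] by linarith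
          then show ?thesis unfolding real_norm_def abs_mult using \<phi>.bnd[of x] by (intro mult_mono) auto
        next
          case False
          then show ?thesis using \<phi>.supp[of x] R \<phi>.B_nonneg kernel_mass_nonneg[of R] by simp
        qed
      qed (use \<phi>.supp in auto)
    qed
    have "E_pot (fp t) (fm t) = (\<integral>x. rho (fp t) x * (x \<bullet> E t x) \<partial>lborel) - (\<integral>x. rho (fm t) x * (x \<bullet> E t x) \<partial>lborel)"
      unfolding potential_energy(3)[OF t] r_def left_diff_distrib
      using j[OF b(1)] j[OF b(2)] by (rule Bochner_Integration.integral_diff)
    then show ?thesis unfolding p.rho_integral(1)[OF t c'] m.rho_integral(1)[OF t c'] by simp
  qed
  have dG: "(G has_real_derivative
     phase_integral (\<lambda>x v. fp t x v * (\<epsilon> * (D t \<bullet> (x - (1 + t) *\<^sub>R v)) - 1 * (1 + t) * (E t x \<bullet> (x - (1 + t) *\<^sub>R v))))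
     + phase_integral (\<lambda>x v. fm t x v * (- \<epsilon> * (D t \<bullet> (x - (1 + t) *\<^sub>R v)) - - 1 * (1 + t) * (E t x \<bullet> (x - (1 + t) *\<^sub>R v))))) (at t within {0..})"
    unfolding G_def[abs_def] by (intro DERIV_add p.dispersion_deriv m.dispersion_deriv t)
  have ip: "phase_integral (\<lambda>x v. fp t x v * (\<epsilon> * (D t \<bullet> (x - (1 + t) *\<^sub>R v)) - 1 * (1 + t) * (E t x \<bullet> (x - (1 + t) *\<^sub>R v))))
      = \<epsilon> * phase_integral (\<lambda>x v. fp t x v * (D t \<bullet> (x - (1 + t) *\<^sub>R v)))
        - (1 + t) * (\<integral>z. fp t (fst z) (snd z) * (fst z \<bullet> E t (fst z)) \<partial>?M)
        + (1 + t) ^ 2 * (\<integral>z. fp t (fst z) (snd z) * (snd z \<bullet> E t (fst z)) \<partial>?M)"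
    unfolding phase_integral_def s using i by simp
  have im: "phase_integral (\<lambda>x v. fm t x v * (- \<epsilon> * (D t \<bullet> (x - (1 + t) *\<^sub>R v)) - - 1 * (1 + t) * (E t x \<bullet> (x - (1 + t) *\<^sub>R v))))
      = - \<epsilon> * phase_integral (\<lambda>x v. fm t x v * (D t \<bullet> (x - (1 + t) *\<^sub>R v)))
        + (1 + t) * (\<integral>z. fm t (fst z) (snd z) * (fst z \<bullet> E t (fst z)) \<partial>?M)
        - (1 + t) ^ 2 * (\<integral>z. fm t (fst z) (snd z) * (snd z \<bullet> E t (fst z)) \<partial>?M)"
    unfolding phase_integral_def s using i by simp (simp add: algebra_simps)
  show ?thesis
    by (rule back_subst[of "\<lambda>d. (G has_real_derivative d) (at t within {0..})", OF dG])
       (unfold ip im Y_def X_def ep[symmetric], algebra)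
qed

text \<open>The weight differentiates to 2 (1 + t) times the potential energy, of which the virial
  term removes half. The damping survives with the weight (1 + t)^2, ready to absorb
  \<open>Y\<close>.\<close>

lemma h_deriv:
  assumes t: "0 \<le> t"
  shows "(h has_real_derivative \<epsilon> * Y t + (1 + t) * E_pot (fp t) (fm t) - \<epsilon> * (1 + t) ^ 2 * (norm (D t)) ^ 2) (at t within {0..})"
proof -
  have "((\<lambda>t. (1 + t) ^ 2) has_real_derivative 2 * (1 + t)) (at t within {0..})"
    by (auto intro!: derivative_eq_intros)
  from DERIV_add[OF G_deriv[OF t] DERIV_mult[OF this potential_energy_deriv[OF t]]]
  show ?thesis unfolding h_def[abs_def] by (simp add: algebra_simps)
qed

end

section \<open>Linear growth of the dispersion functional\<close>

locale vpd_nonneg = vpd +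
  assumes eps: "0 < \<epsilon>" and init: "\<And>x v. 0 \<le> fp 0 x v" "\<And>x v. 0 \<le> fm 0 x v"
begin

lemma fp_nonneg: "0 \<le> t \<Longrightarrow> 0 \<le> fp t x v" and fm_nonneg: "0 \<le> t \<Longrightarrow> 0 \<le> fm t x v"
  using p.nonneg m.nonneg init by blast+

definition mass where "mass = phase_integral (fp 0) + phase_integral (fm 0)"

lemma mass_conservation:
  assumes t: "0 \<le> t"
  shows "phase_integral (fp t) = phase_integral (fp 0)" "phase_integral (fm t) = phase_integral (fm 0)"
  unfolding phase_integral_def
  by (rule p.integral_renormalized_const[where \<beta>="\<lambda>u. u" and \<beta>'="\<lambda>_. 1"], use t in auto)
     (rule m.integral_renormalized_const[where \<beta>="\<lambda>u. u" and \<beta>'="\<lambda>_. 1"], use t in auto)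

lemma phase_integral_nonneg: "0 \<le> t \<Longrightarrow> 0 \<le> phase_integral (fp t)" "0 \<le> t \<Longrightarrow> 0 \<le> phase_integral (fm t)"
  unfolding phase_integral_def using fp_nonneg fm_nonneg by (auto intro!: Bochner_Integration.integral_nonneg)

lemma mass_nonneg: "0 \<le> mass"
  unfolding mass_def using phase_integral_nonneg[of 0] by simp

lemma dispersion_nonneg: "0 \<le> t \<Longrightarrow> 0 \<le> dispersion s (fp t)" "0 \<le> t \<Longrightarrow> 0 \<le> dispersion s (fm t)"
  unfolding dispersion_def phase_integral_def using fp_nonneg fm_nonneg by (auto intro!: Bochner_Integration.integral_nonneg)

text \<open>Young's inequality is weighted with the total mass, so that after integration the
  coefficient of (1 + t)^2 |D|^2 is at most 1 and the damping in the derivative of \<open>h\<close>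
  pays for it completely.\<close>

lemma Y_bound:
  assumes t: "0 \<le> t"
  shows "Y t \<le> (1 + t) ^ 2 * (norm (D t)) ^ 2 + (mass + 1) / (2 * (1 + t) ^ 2) * G t"
proof -
  let ?M = "phase_space"
  let ?y = "\<lambda>z. fst z - (1 + t) *\<^sub>R snd z :: vec3"
  define s where "s = 1 + t"
  have s: "0 < s" using t by (simp add: s_def)
  \<comment> \<open>\<open>P\<close> divides by \<open>k\<close>; adding 1 keeps it positive even
    for vanishing data.\<close>
  define k where "k = mass + 1"
  have k: "0 < k" using mass_nonneg by (simp add: k_def)
  define P where "P = s ^ 2 * (norm (D t)) ^ 2 / k"
  define Q where "Q = k / (2 * s ^ 2)"
  have young: "\<bar>D t \<bullet> ?y z\<bar> \<le> P + Q * (norm (?y z) ^ 2 / 2)" for z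
  proof -
    let ?d = "norm (D t)" and ?n = "norm (?y z)"
    have "0 \<le> (2 * s ^ 2 * ?d - k * ?n) ^ 2" by simp
    then have "4 * s ^ 2 * k * (?d * ?n) \<le> 4 * s ^ 4 * ?d ^ 2 + k ^ 2 * ?n ^ 2"
      by (simp add: power2_eq_square power4_eq_xxxx algebra_simps)
    then have "?d * ?n \<le> (4 * s ^ 4 * ?d ^ 2 + k ^ 2 * ?n ^ 2) / (4 * s ^ 2 * k)"
      using s k by (simp add: pos_le_divide_eq mult_ac)
    also have "\<dots> = P + Q * (?n ^ 2 / 2)"
      using s k by (simp add: P_def Q_def field_simps power2_eq_square power4_eq_xxxx)
    finally show ?thesis using Cauchy_Schwarz_ineq2[of "D t" "?y z"] by linarith
  qed
  have c: "continuous_on UNIV (\<lambda>z::vec3 \<times> vec3. D t \<bullet> ?y z)" "continuous_on UNIV (\<lambda>z::vec3 \<times> vec3. norm (?y z) ^ 2 / 2)"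
     "continuous_on UNIV (\<lambda>z::vec3 \<times> vec3. 1 :: real)"
    by (auto intro!: continuous_intros)
  note i = integrable_weight[OF t c(1)] integrable_weight[OF t c(2)] integrable_weight[OF t c(3), simplified]
  have est: "(\<integral>z. \<sigma> * (f (fst z) (snd z) * (D t \<bullet> ?y z)) \<partial>?M) \<le> P * phase_integral f + Q * dispersion s f"
    if f: "\<And>x v. 0 \<le> f x v" and \<sigma>: "\<bar>\<sigma>\<bar> = 1"
      and fi: "integrable ?M (\<lambda>z. f (fst z) (snd z) * (D t \<bullet> ?y z))" "integrable ?M (\<lambda>z. f (fst z) (snd z) * (norm (?y z) ^ 2 / 2))"
         "integrable ?M (\<lambda>z. f (fst z) (snd z))" for f \<sigma>
  proof -
    have "(\<integral>z. \<sigma> * (f (fst z) (snd z) * (D t \<bullet> ?y z)) \<partial>?M)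
       \<le> (\<integral>z. P * f (fst z) (snd z) + Q * (f (fst z) (snd z) * (norm (?y z) ^ 2 / 2)) \<partial>?M)"
    proof (rule integral_mono)
      fix z
      have "\<sigma> * (f (fst z) (snd z) * (D t \<bullet> ?y z)) \<le> \<bar>\<sigma> * (f (fst z) (snd z) * (D t \<bullet> ?y z))\<bar>" by simp
      also have "\<dots> = f (fst z) (snd z) * \<bar>D t \<bullet> ?y z\<bar>" unfolding abs_mult \<sigma> using f by simp
      also have "\<dots> \<le> f (fst z) (snd z) * (P + Q * (norm (?y z) ^ 2 / 2))" by (intro mult_left_mono young f)
      finally show "\<sigma> * (f (fst z) (snd z) * (D t \<bullet> ?y z)) \<le> P * f (fst z) (snd z) + Q * (f (fst z) (snd z) * (norm (?y z) ^ 2 / 2))"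
        by (simp add: algebra_simps)
    qed (intro Bochner_Integration.integrable_add integrable_mult_right fi)+
    also have "\<dots> = P * phase_integral f + Q * dispersion s f"
    proof -
      have "(\<integral>z. P * f (fst z) (snd z) + Q * (f (fst z) (snd z) * (norm (?y z) ^ 2 / 2)) \<partial>?M)
        = (\<integral>z. P * f (fst z) (snd z) \<partial>?M) + (\<integral>z. Q * (f (fst z) (snd z) * (norm (?y z) ^ 2 / 2)) \<partial>?M)"
        by (intro Bochner_Integration.integral_add integrable_mult_right fi)
      then show ?thesis
        unfolding phase_integral_def dispersion_def s_def
        by (simp only: integral_mult_right_zero mult.commute[of "norm _ ^ 2 / 2"])
    qed
    finally show ?thesis .
  qed
  have "Y t \<le> (P * phase_integral (fp t) + Q * dispersion s (fp t)) + (P * phase_integral (fm t) + Q * dispersion s (fm t))"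
    using est[of "fp t" 1, OF fp_nonneg[OF t] _ i(1,3,5)] est[of "fm t" "- 1", OF fm_nonneg[OF t] _ i(2,4,6)]
    by (simp add: Y_def phase_integral_def)
  also have "\<dots> = P * mass + Q * G t"
    unfolding mass_conservation[OF t] by (simp add: mass_def G_def s_def algebra_simps)
  also have "P * mass \<le> s ^ 2 * (norm (D t)) ^ 2"
  proof -
    have "P * mass \<le> P * k" using s k by (intro mult_left_mono) (auto simp: k_def P_def)
    also have "\<dots> = s ^ 2 * (norm (D t)) ^ 2" using k by (simp add: P_def)
    finally show ?thesis .
  qed
  finally show ?thesis by (simp add: Q_def k_def s_def)
qed

text \<open>The inequality h' \<le> h / s + a h / s^2 has the integrating factor exp(a / s) / s. As
  1 / s^2 is integrable from s = 1 on, the exponential stays between 1 and exp a and costs only a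
  constant.\<close>

lemma h_bound:
  assumes t: "0 \<le> t"
  shows "h t \<le> h 0 * exp (\<epsilon> * (mass + 1) / 2) * (1 + t)"
proof -
  define a where "a = \<epsilon> * (mass + 1) / 2"
  have a: "0 < a" using eps mass_nonneg by (simp add: a_def)
  define \<phi> where "\<phi> t = h t / (1 + t) * exp (a / (1 + t))" for t
  define h' where "h' t = \<epsilon> * Y t + (1 + t) * E_pot (fp t) (fm t) - \<epsilon> * (1 + t) ^ 2 * (norm (D t)) ^ 2" for t
  have h': "h' t \<le> h t / (1 + t) + a * h t / (1 + t) ^ 2" if t: "0 \<le> t" for t
  proof -
    define s where "s = 1 + t"
    have s: "0 < s" using t by (simp add: s_def)
    have g: "0 \<le> G t" unfolding G_def using dispersion_nonneg[OF t] by simp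
    have e: "0 \<le> E_pot (fp t) (fm t)" by (rule E_pot_nonneg)
    have hG: "G t \<le> h t" using e by (simp add: h_def)
    have hE: "s ^ 2 * E_pot (fp t) (fm t) \<le> h t" using g by (simp add: h_def s_def)
    have "\<epsilon> * Y t \<le> \<epsilon> * (s ^ 2 * (norm (D t)) ^ 2 + (mass + 1) / (2 * s ^ 2) * G t)"
      using Y_bound[OF t] eps by (simp add: s_def)
    also have "\<dots> = \<epsilon> * s ^ 2 * (norm (D t)) ^ 2 + a * G t / s ^ 2" by (simp add: a_def algebra_simps)
    also have "a * G t / s ^ 2 \<le> a * h t / s ^ 2" using hG a s by (intro divide_right_mono mult_left_mono) auto
    finally have 1: "\<epsilon> * Y t \<le> \<epsilon> * s ^ 2 * (norm (D t)) ^ 2 + a * h t / s ^ 2" by simp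
    have 2: "s * E_pot (fp t) (fm t) \<le> h t / s" using hE s by (simp add: pos_le_divide_eq power2_eq_square mult_ac)
    show ?thesis using 1 2 unfolding h'_def s_def by linarith
  qed
  have d: "(\<phi> has_real_derivative (h' t - h t / (1 + t) - a * h t / (1 + t) ^ 2) / (1 + t) * exp (a / (1 + t))) (at t within {0..})"
    if t: "0 \<le> t" for t
  proof -
    have s: "1 + t \<noteq> 0" using t by simp
    have "(h has_real_derivative h' t) (at t within {0..})" unfolding h'_def by (rule h_deriv[OF t])
    then show ?thesis unfolding \<phi>_def[abs_def] using s
      by (auto intro!: derivative_eq_intros) (simp add: field_simps power2_eq_square power3_eq_cube)
  qed
  have "\<phi> t \<le> \<phi> 0"
  proof (rule nonincreasing_from_0[OF d])
    show "(h' t - h t / (1 + t) - a * h t / (1 + t) ^ 2) / (1 + t) * exp (a / (1 + t)) \<le> 0" if "0 \<le> t" for t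
      using h'[OF that] that by (intro mult_nonpos_nonneg divide_nonpos_nonneg) auto
  qed (use t in auto)
  then have 1: "h t / (1 + t) * exp (a / (1 + t)) \<le> h 0 * exp a" by (simp add: \<phi>_def)
  have "0 \<le> h t" unfolding h_def G_def using dispersion_nonneg[OF t] E_pot_nonneg[of t] by simp
  moreover have "1 \<le> exp (a / (1 + t))" using a t by simp
  ultimately have "h t / (1 + t) * 1 \<le> h t / (1 + t) * exp (a / (1 + t))" using t by (intro mult_left_mono) auto
  then have "h t / (1 + t) \<le> h 0 * exp a" using 1 by simp
  then show ?thesis using t by (simp add: a_def pos_divide_le_eq)
qed

end

section \<open>Decay estimates\<close>

text \<open>Log-convexity of the power integrals, done pointwise: Young's inequality is applied to
  the two powers after weighting them with s^a0 and s^a1, which makes the decay rates interpolate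
  linearly. The constant A + B is crude but the same for all exponents in between.\<close>

lemma interpolation:
  fixes u :: "vec3 \<Rightarrow> real"
  assumes m: "u \<in> borel_measurable borel" and u: "\<And>x. 0 \<le> u x"
    and i0: "integrable lborel (\<lambda>x. u x powr p0)" and i1: "integrable lborel (\<lambda>x. u x powr p1)"
    and b0: "(\<integral>x. u x powr p0 \<partial>lborel) \<le> A * s powr - a0" and b1: "(\<integral>x. u x powr p1 \<partial>lborel) \<le> B * s powr - a1"
    and s: "0 < s" and \<theta>: "0 \<le> \<theta>" "\<theta> \<le> 1"
    and p: "p = (1 - \<theta>) * p0 + \<theta> * p1" and a: "a = (1 - \<theta>) * a0 + \<theta> * a1"
  shows "integrable lborel (\<lambda>x. u x powr p)" and "(\<integral>x. u x powr p \<partial>lborel) \<le> (A + B) * s powr - a"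
proof -
  let ?g = "\<lambda>x. s powr - a * (s powr a0 * u x powr p0 + s powr a1 * u x powr p1)"
  have le: "u x powr p \<le> ?g x" for x
  proof (cases "u x = 0")
    case False
    then have ux: "0 < u x" using u[of x] by simp
    let ?X = "s powr a0 * u x powr p0" and ?Y = "s powr a1 * u x powr p1"
    have "?X powr (1 - \<theta>) * ?Y powr \<theta> \<le> (1 - \<theta>) * ?X + \<theta> * ?Y"
      by (rule Youngs_inequality_0) (use s ux \<theta> in auto)
    also have "\<dots> \<le> 1 * ?X + 1 * ?Y" using \<theta> by (intro add_mono mult_right_mono) auto
    finally have 1: "?X powr (1 - \<theta>) * ?Y powr \<theta> \<le> ?X + ?Y" by simp
    have "?X powr (1 - \<theta>) * ?Y powr \<theta> = (s powr (a0 * (1 - \<theta>)) * s powr (a1 * \<theta>)) * (u x powr (p0 * (1 - \<theta>)) * u x powr (p1 * \<theta>))"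
      by (simp add: powr_mult powr_powr)
    also have "\<dots> = s powr a * u x powr p"
      by (simp only: powr_add[symmetric] a p mult.commute[of _ "1 - \<theta>"] mult.commute[of _ \<theta>])
    finally have "s powr - a * (s powr a * u x powr p) \<le> ?g x" using 1 by (intro mult_left_mono) auto
    moreover have "s powr - a * s powr a = 1" using s by (simp add: powr_add[symmetric])
    ultimately show ?thesis by (simp only: mult.assoc[symmetric] mult_1_left)
  qed simp
  have gi: "integrable lborel ?g" using i0 i1 by simp
  show pi: "integrable lborel (\<lambda>x. u x powr p)"
    by (rule Bochner_Integration.integrable_bound[OF gi])
       (use m le in \<open>auto intro!: AE_I2 order_trans[OF le abs_ge_self]\<close>)
  have "(\<integral>x. u x powr p \<partial>lborel) \<le> (\<integral>x. ?g x \<partial>lborel)"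
    by (rule integral_mono[OF pi gi le])
  also have "\<dots> = s powr - a * (s powr a0 * (\<integral>x. u x powr p0 \<partial>lborel) + s powr a1 * (\<integral>x. u x powr p1 \<partial>lborel))"
    using i0 i1 by simp
  also have "\<dots> \<le> s powr - a * (s powr a0 * (A * s powr - a0) + s powr a1 * (B * s powr - a1))"
    using b0 b1 by (intro mult_left_mono add_mono) auto
  also have "\<dots> = (A + B) * s powr - a"
  proof -
    have e: "s powr a0 * (A * s powr - a0) = A" "s powr a1 * (B * s powr - a1) = B"
      using s by (simp_all add: powr_minus field_simps)
    show ?thesis unfolding e by (rule mult.commute)
  qed
  finally show "(\<integral>x. u x powr p \<partial>lborel) \<le> (A + B) * s powr - a" .
qed

lemma Lp_norm_le:
  assumes m: "\<phi> \<in> borel_measurable borel" and i: "integrable lborel (\<lambda>x. norm (\<phi> x) powr p)"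
    and b: "(\<integral>x. norm (\<phi> x) powr p \<partial>lborel) \<le> K * s powr - a" and p: "0 < p" and K: "0 \<le> K"
  shows "Lp_norm p \<phi> \<le> ennreal (K powr (1 / p) * s powr - (a / p))"
proof -
  have "Lp_norm p \<phi> = ennreal ((\<integral>x. norm (\<phi> x) powr p \<partial>lborel) powr (1 / p))"
    using m i by (simp add: Lp_norm_def)
  also have "\<dots> \<le> ennreal ((K * s powr - a) powr (1 / p))"
    using b p by (intro ennreal_leI powr_mono2) (auto intro!: Bochner_Integration.integral_nonneg)
  also have "(K * s powr - a) powr (1 / p) = K powr (1 / p) * s powr - (a / p)"
    using K by (simp add: powr_mult powr_powr)
  finally show ?thesis .
qed

context transport
begin

text \<open>Splitting the velocity integral at distance \<open>q\<close> from \<open>x / s\<close> and optimizing in \<open>q\<close>.\<close>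

lemma rho_pointwise:
  assumes t: "0 \<le> t" and f: "\<And>x v. 0 \<le> f t x v" "\<And>x v. f t x v \<le> M" and s: "0 < s"
  shows "rho (f t) x powr (5/3) \<le> (M * \<kappa> + 1) powr (5/3) * (\<integral>v. norm (x - s *\<^sub>R v) ^ 2 / s ^ 2 * f t x v \<partial>lborel)"
proof -
  define m where "m = (\<integral>v. norm (x - s *\<^sub>R v) ^ 2 / s ^ 2 * f t x v \<partial>lborel)"
  define \<rho> where "\<rho> = rho (f t) x"
  have M: "0 \<le> M" using f[of 0 0] by linarith
  have \<rho>0: "0 \<le> \<rho>" and m0: "0 \<le> m"
    unfolding \<rho>_def rho_def m_def using f by (auto intro!: Bochner_Integration.integral_nonneg)
  obtain R where R: "\<And>x v. R < norm x \<or> R < norm v \<Longrightarrow> f t x v = 0" using supp_at[OF t] by blast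
  have c: "continuous_on UNIV (\<lambda>v. f t x v)"
  proof -
    have "continuous_on UNIV (\<lambda>v. (\<lambda>z. f t (fst z) (snd z)) (x, v))"
      by (rule continuous_on_compose2[OF cont_fixed(1)[OF t]]) (auto intro!: continuous_intros)
    then show ?thesis by simp
  qed
  have i1: "integrable lborel (\<lambda>v. f t x v)" by (rule integrable_continuous_support[OF c]) (use R in auto)
  have i2: "integrable lborel (\<lambda>v. norm (x - s *\<^sub>R v) ^ 2 / s ^ 2 * f t x v)"
    by (rule integrable_continuous_support) (use R s in \<open>auto intro!: continuous_intros c\<close>)
  have split: "\<rho> \<le> M * (\<kappa> * q ^ 3) + m / q ^ 2" if q: "0 < q" for q
  proof -
    have iI: "integrable lborel (\<lambda>v. M * indicator (ball ((1 / s) *\<^sub>R x) q) v)"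
      using emeasure_lborel_ball_finite by (intro integrable_mult_right integrable_real_indicator) auto
    have "\<rho> \<le> (\<integral>v. M * indicator (ball ((1 / s) *\<^sub>R x) q) v + norm (x - s *\<^sub>R v) ^ 2 / s ^ 2 * f t x v / q ^ 2 \<partial>lborel)"
      unfolding \<rho>_def rho_def
    proof (rule integral_mono[OF i1])
      show "integrable lborel (\<lambda>v. M * indicator (ball ((1 / s) *\<^sub>R x) q) v + norm (x - s *\<^sub>R v) ^ 2 / s ^ 2 * f t x v / q ^ 2)"
        using iI i2 by (intro Bochner_Integration.integrable_add integrable_divide)
      fix v
      show "f t x v \<le> M * indicator (ball ((1 / s) *\<^sub>R x) q) v + norm (x - s *\<^sub>R v) ^ 2 / s ^ 2 * f t x v / q ^ 2"
      proof (cases "v \<in> ball ((1 / s) *\<^sub>R x) q")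
        case True
        then show ?thesis using f[of x v] by (simp add: add_increasing2)
      next
        case False
        have "x - s *\<^sub>R v = s *\<^sub>R ((1 / s) *\<^sub>R x - v)" using s by (simp add: algebra_simps)
        then have "norm (x - s *\<^sub>R v) = s * norm ((1 / s) *\<^sub>R x - v)" using s by simp
        then have "norm (x - s *\<^sub>R v) ^ 2 / s ^ 2 = norm ((1 / s) *\<^sub>R x - v) ^ 2" using s by (simp add: power_mult_distrib)
        moreover have "q ^ 2 \<le> norm ((1 / s) *\<^sub>R x - v) ^ 2" using False q by (intro power_mono) (auto simp: dist_norm)
        ultimately have "q ^ 2 * f t x v \<le> norm (x - s *\<^sub>R v) ^ 2 / s ^ 2 * f t x v" using f by (simp add: mult_right_mono)
        then have "f t x v \<le> norm (x - s *\<^sub>R v) ^ 2 / s ^ 2 * f t x v / q ^ 2" using q by (subst pos_le_divide_eq) (simp_all add: mult.commute)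
        then show ?thesis using False by simp
      qed
    qed
    also have "\<dots> = (\<integral>v. M * indicator (ball ((1 / s) *\<^sub>R x) q) v \<partial>lborel) + (\<integral>v. norm (x - s *\<^sub>R v) ^ 2 / s ^ 2 * f t x v / q ^ 2 \<partial>lborel)"
      using iI i2 by (intro Bochner_Integration.integral_add integrable_divide)
    also have "(\<integral>v. M * indicator (ball ((1 / s) *\<^sub>R x) q) v \<partial>lborel) = M * (\<kappa> * q ^ 3)"
      using q \<kappa>_pos by (simp add: measure_def emeasure_ball_vec3)
    finally show ?thesis by (simp add: m_def)
  qed
  \<comment> \<open>The choice q = m^(1/5) balances q^3 against m / q^2. For m = 0 it would not be
    positive, and \<open>q\<close> tends to 0 instead.\<close>
  have "\<rho> \<le> (M * \<kappa> + 1) * m powr (3/5)"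
  proof (cases "m = 0")
    case True
    have "((\<lambda>q. M * (\<kappa> * q ^ 3)) \<longlongrightarrow> M * (\<kappa> * 0 ^ 3)) (at_right 0)" by (intro tendsto_intros)
    then have "((\<lambda>q. M * (\<kappa> * q ^ 3)) \<longlongrightarrow> 0) (at_right 0)" by simp
    moreover have "\<forall>\<^sub>F q in at_right 0. \<rho> \<le> M * (\<kappa> * q ^ 3)"
      using split True by (auto simp: eventually_at_right_field intro!: exI[of _ 1])
    ultimately have "\<rho> \<le> 0" by (rule tendsto_lowerbound) simp
    then show ?thesis using True by simp
  next
    case False
    then have mp: "0 < m" using m0 by simp
    have "(m powr (1/5)) ^ 3 = m powr (3/5)" "(m powr (1/5)) ^ 2 = m powr (2/5)"
      using mp by (simp_all add: powr_powr flip: powr_numeral)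
    moreover have "m / m powr (2/5) = m powr (3/5)" using mp powr_diff[of m 1 "2/5"] by simp
    ultimately have "\<rho> \<le> M * (\<kappa> * m powr (3/5)) + m powr (3/5)"
      using split[of "m powr (1/5)"] mp by simp
    then show ?thesis by (simp add: algebra_simps)
  qed
  then have "\<rho> powr (5/3) \<le> ((M * \<kappa> + 1) * m powr (3/5)) powr (5/3)" using \<rho>0 by (intro powr_mono2) auto
  also have "\<dots> = (M * \<kappa> + 1) powr (5/3) * m" using M m0 \<kappa>_pos by (simp add: powr_mult powr_powr)
  finally show ?thesis by (simp add: \<rho>_def m_def)
qed

lemma rho_53_integral:
  assumes t: "0 \<le> t" and f: "\<And>x v. 0 \<le> f t x v" "\<And>x v. f t x v \<le> M" and s: "0 < s"
  shows "integrable lborel (\<lambda>x. rho (f t) x powr (5/3))"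
    and "(\<integral>x. rho (f t) x powr (5/3) \<partial>lborel) \<le> (M * \<kappa> + 1) powr (5/3) * 2 * dispersion s (f t) / s ^ 2"
proof -
  have tt: "t \<in> {0..t}" using t by simp
  obtain B R where "bounded_density (rho (f t)) B R" using rho_densities[of t] tt by blast
  then interpret bounded_density "rho (f t)" B R .
  show i: "integrable lborel (\<lambda>x. rho (f t) x powr (5/3))"
  proof (rule integrable_bounded_support[where B="B powr (5/3)" and R=R])
    have "0 \<le> rho (f t) x" for x unfolding rho_def using f by (auto intro!: Bochner_Integration.integral_nonneg)
    then show "norm (rho (f t) x powr (5/3)) \<le> B powr (5/3)" for x
      using bnd[of x] by (auto intro!: powr_mono2)
  qed (use supp in auto)
  obtain R' where R': "\<And>x v. R' < norm x \<or> R' < norm v \<Longrightarrow> f t x v = 0" using supp_at[OF t] by blast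
  have j: "integrable phase_space (\<lambda>z. norm (fst z - s *\<^sub>R snd z) ^ 2 / s ^ 2 * f t (fst z) (snd z))"
    by (rule integrable_pair_continuous[where R=R']) (use R' s in \<open>auto intro!: continuous_intros cont_fixed[OF t]\<close>)
  have "(\<integral>x. rho (f t) x powr (5/3) \<partial>lborel) \<le> (\<integral>x. (M * \<kappa> + 1) powr (5/3) * (\<integral>v. norm (x - s *\<^sub>R v) ^ 2 / s ^ 2 * f t x v \<partial>lborel) \<partial>lborel)"
    using lborel_pair.integrable_fst'[OF j] by (intro integral_mono[OF i] integrable_mult_right rho_pointwise[OF t f s]) simp
  also have "\<dots> = (M * \<kappa> + 1) powr (5/3) * (\<integral>z. norm (fst z - s *\<^sub>R snd z) ^ 2 / s ^ 2 * f t (fst z) (snd z) \<partial>phase_space)"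
    using lborel_pair.integral_fst'[OF j] by auto
  also have "(\<integral>z. norm (fst z - s *\<^sub>R snd z) ^ 2 / s ^ 2 * f t (fst z) (snd z) \<partial>phase_space) = 2 / s ^ 2 * dispersion s (f t)"
    unfolding dispersion_def phase_integral_def
    by (subst Bochner_Integration.integral_mult_right_zero[symmetric]) (simp add: algebra_simps)
  finally show "(\<integral>x. rho (f t) x powr (5/3) \<partial>lborel) \<le> (M * \<kappa> + 1) powr (5/3) * 2 * dispersion s (f t) / s ^ 2"
    by (simp add: mult_ac)
qed

end

text \<open>The numbers \<open>M\<close>, \<open>H\<close> and \<open>C\<close> are parameters, so
  that the constants \<open>N\<close> and \<open>K\<close> built from them do not mention the
  solution and can be shared by all solutions with the same data and \<epsilon>.\<close>

locale vpd_est = vpd_nonneg +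
  fixes M H C :: real
  assumes M: "0 \<le> M" "\<And>x v. fp 0 x v \<le> M" "\<And>x v. fm 0 x v \<le> M"
    and H: "h 0 * exp (\<epsilon> * (mass + 1) / 2) \<le> H"
    and C: "0 < C" "HLS_bound C"
begin

text \<open>The factor 2 undoes the 1/2 in \<open>dispersion\<close>. The added 1 provides the
  strict positivity on which the use of \<open>HLS_bound\<close> and the argument for static
  solutions rely.\<close>

definition N where "N = (M * \<kappa> + 1) powr (5/3) * 2 * H + 1"

lemma fp_le: "0 \<le> t \<Longrightarrow> fp t x v \<le> M" and fm_le: "0 \<le> t \<Longrightarrow> fm t x v \<le> M"
  using p.upper_bound[OF M(2,1)] m.upper_bound[OF M(3,1)] by blast+

lemma h_le: "0 \<le> t \<Longrightarrow> h t \<le> H * (1 + t)"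
  using h_bound[of t] H mult_right_mono[of "h 0 * exp (\<epsilon> * (mass + 1) / 2)" H "1 + t"] by linarith

lemma dispersion_le:
  assumes t: "0 \<le> t"
  shows "dispersion (1 + t) (fp t) \<le> H * (1 + t)" "dispersion (1 + t) (fm t) \<le> H * (1 + t)"
    and "E_pot (fp t) (fm t) \<le> H * (1 + t) powr - 1"
proof -
  note nn = dispersion_nonneg[OF t, of "1 + t"] E_pot_nonneg[of t]
  have e: "0 \<le> (1 + t) ^ 2 * E_pot (fp t) (fm t)" using nn by simp
  show "dispersion (1 + t) (fp t) \<le> H * (1 + t)" "dispersion (1 + t) (fm t) \<le> H * (1 + t)"
    using h_le[OF t] nn e unfolding h_def G_def by linarith+
  have "(1 + t) ^ 2 * E_pot (fp t) (fm t) \<le> H * (1 + t)"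
    using h_le[OF t] nn unfolding h_def G_def by linarith
  then have "(1 + t) * E_pot (fp t) (fm t) \<le> H" using t by (simp add: power2_eq_square mult.assoc mult.commute[of H])
  then show "E_pot (fp t) (fm t) \<le> H * (1 + t) powr - 1"
    using t by (simp add: powr_minus_divide pos_le_divide_eq mult.commute)
qed

lemma H_nonneg: "0 \<le> H"
  using dispersion_le(1)[of 0] dispersion_nonneg(1)[of 0 1] by simp

lemma N_pos: "0 < N" "1 \<le> N"
  using H_nonneg by (simp_all add: N_def add_nonneg_pos)

lemma rho_nonneg: "0 \<le> t \<Longrightarrow> 0 \<le> rho (fp t) x" "0 \<le> t \<Longrightarrow> 0 \<le> rho (fm t) x"
  unfolding rho_def using fp_nonneg fm_nonneg by (auto intro!: Bochner_Integration.integral_nonneg)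

lemma rho_53:
  assumes t: "0 \<le> t"
  shows "integrable lborel (\<lambda>x. rho (fp t) x powr (5/3))" "integrable lborel (\<lambda>x. rho (fm t) x powr (5/3))"
    and "(\<integral>x. rho (fp t) x powr (5/3) \<partial>lborel) \<le> N * (1 + t) powr - 1"
    and "(\<integral>x. rho (fm t) x powr (5/3) \<partial>lborel) \<le> N * (1 + t) powr - 1"
proof -
  have s: "0 < 1 + t" using t by simp
  define Q where "Q = (M * \<kappa> + 1) powr (5/3) * 2"
  have *: "Q * V / (1 + t) ^ 2 \<le> N * (1 + t) powr - 1" if "V \<le> H * (1 + t)" for V
  proof -
    have "Q * V / (1 + t) ^ 2 \<le> Q * (H * (1 + t)) / (1 + t) ^ 2"
      using that by (intro divide_right_mono mult_left_mono) (auto simp: Q_def)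
    also have "\<dots> = Q * H * (1 + t) powr - 1" using s by (simp add: powr_minus_divide power2_eq_square)
    also have "\<dots> \<le> N * (1 + t) powr - 1" by (intro mult_right_mono) (auto simp: N_def Q_def)
    finally show ?thesis .
  qed
  note p = p.rho_53_integral[OF t fp_nonneg[OF t] fp_le[OF t] s]
  note m = m.rho_53_integral[OF t fm_nonneg[OF t] fm_le[OF t] s]
  show "integrable lborel (\<lambda>x. rho (fp t) x powr (5/3))" "integrable lborel (\<lambda>x. rho (fm t) x powr (5/3))"
    by (fact p(1) m(1))+
  show "(\<integral>x. rho (fp t) x powr (5/3) \<partial>lborel) \<le> N * (1 + t) powr - 1"
    using p(2) *[OF dispersion_le(1)[OF t]] unfolding Q_def by linarith
  show "(\<integral>x. rho (fm t) x powr (5/3) \<partial>lborel) \<le> N * (1 + t) powr - 1"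
    using m(2) *[OF dispersion_le(2)[OF t]] unfolding Q_def by linarith
qed

lemma rho_mass:
  assumes t: "0 \<le> t"
  shows "rho (fp t) \<in> borel_measurable borel" "rho (fm t) \<in> borel_measurable borel"
    and "integrable lborel (rho (fp t))" "integrable lborel (rho (fm t))"
    and "(\<integral>x. rho (fp t) x \<partial>lborel) \<le> mass" "(\<integral>x. rho (fm t) x \<partial>lborel) \<le> mass"
proof -
  have tt: "t \<in> {0..t}" using t by simp
  obtain B R where b: "bounded_density (rho (fp t)) B R" "bounded_density (rho (fm t)) B R"
    using r_densities[of t] tt by blast
  interpret p: bounded_density "rho (fp t)" B R by (rule b)
  interpret m: bounded_density "rho (fm t)" B R by (rule b)
  show "rho (fp t) \<in> borel_measurable borel" "rho (fm t) \<in> borel_measurable borel" by measurable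
  show "integrable lborel (rho (fp t))" "integrable lborel (rho (fm t))" by (fact p.integrable m.integrable)+
  have "(\<integral>x. rho (fp t) x \<partial>lborel) = phase_integral (fp t)" "(\<integral>x. rho (fm t) x \<partial>lborel) = phase_integral (fm t)"
    using p.rho_integral(1)[OF t continuous_on_const[of UNIV 1]] m.rho_integral(1)[OF t continuous_on_const[of UNIV 1]]
    by (simp_all add: phase_integral_def)
  then show "(\<integral>x. rho (fp t) x \<partial>lborel) \<le> mass" "(\<integral>x. rho (fm t) x \<partial>lborel) \<le> mass"
    using mass_conservation[OF t] phase_integral_nonneg[of 0] by (simp_all add: mass_def)
qed

lemma estimate_a:
  assumes t: "0 \<le> t" and p: "p \<in> {1..5/3}"
  shows "Lp_norm p (rho (fp t)) \<le> ennreal ((mass + N) powr (1 / p) * (1 + t) powr - (3 * (p - 1) / (2 * p)))"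
    and "Lp_norm p (rho (fm t)) \<le> ennreal ((mass + N) powr (1 / p) * (1 + t) powr - (3 * (p - 1) / (2 * p)))"
proof -
  \<comment> \<open>The power integrals interpolate between rate 0 at p = 1, which is mass
    conservation, and rate 1 at p = 5/3.\<close>
  define \<theta> where "\<theta> = 3 * (p - 1) / 2"
  have \<theta>: "0 \<le> \<theta>" "\<theta> \<le> 1" "p = (1 - \<theta>) * 1 + \<theta> * (5/3)" "\<theta> = (1 - \<theta>) * 0 + \<theta> * 1"
    using p by (auto simp: \<theta>_def field_simps)
  have s: "0 < 1 + t" using t by simp
  have e: "3 * (p - 1) / (2 * p) = \<theta> / p" by (simp add: \<theta>_def)
  have *: "Lp_norm p \<rho> \<le> ennreal ((mass + N) powr (1 / p) * (1 + t) powr - (3 * (p - 1) / (2 * p)))"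
    if \<rho>: "\<rho> \<in> borel_measurable borel" "\<And>x. 0 \<le> \<rho> x" "integrable lborel \<rho>" "(\<integral>x. \<rho> x \<partial>lborel) \<le> mass"
      "integrable lborel (\<lambda>x. \<rho> x powr (5/3))" "(\<integral>x. \<rho> x powr (5/3) \<partial>lborel) \<le> N * (1 + t) powr - 1" for \<rho> :: "vec3 \<Rightarrow> real"
  proof -
    have 1: "\<rho> x powr 1 = \<rho> x" "norm (\<rho> x) = \<rho> x" for x using \<rho>(2) by auto
    have i: "integrable lborel (\<lambda>x. \<rho> x powr 1)" "(\<integral>x. \<rho> x powr 1 \<partial>lborel) \<le> mass * (1 + t) powr - 0"
      unfolding 1 using \<rho>(3,4) s by auto
    note ip = interpolation[OF \<rho>(1,2) i(1) \<rho>(5) i(2) \<rho>(6) s \<theta>]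
    show ?thesis unfolding e
      by (rule Lp_norm_le) (use \<rho>(1) ip p mass_nonneg N_pos in \<open>auto simp: 1 abs_of_nonneg[OF \<rho>(2)]\<close>)
  qed
  show "Lp_norm p (rho (fp t)) \<le> ennreal ((mass + N) powr (1 / p) * (1 + t) powr - (3 * (p - 1) / (2 * p)))"
    by (rule *[OF rho_mass(1)[OF t] rho_nonneg(1)[OF t] rho_mass(3,5)[OF t] rho_53(1,3)[OF t]])
  show "Lp_norm p (rho (fm t)) \<le> ennreal ((mass + N) powr (1 / p) * (1 + t) powr - (3 * (p - 1) / (2 * p)))"
    by (rule *[OF rho_mass(2)[OF t] rho_nonneg(2)[OF t] rho_mass(4,6)[OF t] rho_53(2,4)[OF t]])
qed

text \<open>The sum of the endpoint constants at exponents 2 and 15/4, as the interpolation produces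
  it.\<close>

definition K where "K = 8 * pi * H + C * (2 * N) powr (9/4)"

lemma K_nonneg: "0 \<le> K"
  using H_nonneg C by (simp add: K_def)

lemma E_measurable: "0 \<le> t \<Longrightarrow> E t \<in> borel_measurable borel"
  by (intro borel_measurable_continuous_onI cont_E)

lemma E_2:
  assumes t: "0 \<le> t"
  shows "integrable lborel (\<lambda>x. norm (E t x) powr 2)"
    and "(\<integral>x. norm (E t x) powr 2 \<partial>lborel) \<le> 8 * pi * H * (1 + t) powr - 1"
proof -
  have e: "norm (E t x) powr 2 = norm (E t x) ^ 2" for x
    by (cases "E t x = 0") (auto simp: powr_numeral)
  show "integrable lborel (\<lambda>x. norm (E t x) powr 2)" unfolding e by (rule potential_energy(1)[OF t])
  have "(\<integral>x. norm (E t x) powr 2 \<partial>lborel) = 8 * pi * E_pot (fp t) (fm t)"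
    unfolding e by (rule potential_energy(4)[OF t])
  also have "\<dots> \<le> 8 * pi * (H * (1 + t) powr - 1)" using dispersion_le(3)[OF t] by (intro mult_left_mono) auto
  finally show "(\<integral>x. norm (E t x) powr 2 \<partial>lborel) \<le> 8 * pi * H * (1 + t) powr - 1" by (simp add: mult.assoc)
qed

text \<open>In three dimensions a kernel |z|^(-2) gains 1/3 in the reciprocal exponent, and 3/5 -
  1/3 = 4/15. The rate 9/4 is the rate 1 of the densities raised to the power in
  \<open>HLS_bound\<close>.\<close>

lemma E_15_4:
  assumes t: "0 \<le> t"
  shows "integrable lborel (\<lambda>x. norm (E t x) powr (15/4))"
    and "(\<integral>x. norm (E t x) powr (15/4) \<partial>lborel) \<le> C * (2 * N) powr (9/4) * (1 + t) powr - (9/4)"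
proof -
  have tt: "t \<in> {0..t}" using t by simp
  obtain B R where b: "bounded_density (r t) B R" using r_densities[of t] tt by blast
  interpret bounded_density "r t" B R by (rule b)
  have [measurable]: "E t \<in> borel_measurable borel" by (rule E_measurable[OF t])
  define N' where "N' = 2 * N * (1 + t) powr - 1"
  have N': "0 < N'" using N_pos t by (simp add: N'_def)
  note ii = rho_53[OF t]
  have "(\<integral>\<^sup>+y. ennreal (\<bar>r t y\<bar> powr (5/3)) \<partial>lborel) \<le> (\<integral>\<^sup>+y. ennreal (rho (fp t) y powr (5/3) + rho (fm t) y powr (5/3)) \<partial>lborel)"
  proof (intro nn_integral_mono ennreal_leI)
    fix y
    have nn: "0 \<le> rho (fp t) y" "0 \<le> rho (fm t) y" by (rule rho_nonneg[OF t])+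
    \<comment> \<open>Both densities are nonnegative, so the charge is bounded by their maximum;
      cancellation between the species is not exploited.\<close>
    then have "\<bar>r t y\<bar> \<le> max (rho (fp t) y) (rho (fm t) y)" by (auto simp: r_def)
    then have "\<bar>r t y\<bar> powr (5/3) \<le> max (rho (fp t) y) (rho (fm t) y) powr (5/3)" by (intro powr_mono2) auto
    also have "\<dots> \<le> rho (fp t) y powr (5/3) + rho (fm t) y powr (5/3)" by (simp add: max_def)
    finally show "\<bar>r t y\<bar> powr (5/3) \<le> rho (fp t) y powr (5/3) + rho (fm t) y powr (5/3)" .
  qed
  also have "\<dots> = ennreal (\<integral>y. rho (fp t) y powr (5/3) + rho (fm t) y powr (5/3) \<partial>lborel)"
    by (rule nn_integral_eq_integral) (use ii in auto)
  also have "\<dots> \<le> ennreal N'"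
    using ii by (intro ennreal_leI) (simp add: N'_def)
  finally have rN: "(\<integral>\<^sup>+y. ennreal (\<bar>r t y\<bar> powr (5/3)) \<partial>lborel) \<le> ennreal N'" .
  have le: "(\<integral>\<^sup>+x. ennreal (norm (E t x) powr (15/4)) \<partial>lborel) \<le> ennreal (C * N' powr (9/4))"
    by (rule C(2)[unfolded HLS_bound_def, rule_format, of "\<lambda>y. \<bar>r t y\<bar>"])
       (use N' rN field_le_riesz E_eq_field[OF t] in auto)
  show i: "integrable lborel (\<lambda>x. norm (E t x) powr (15/4))"
    by (rule integrableI_bounded) (use le in \<open>auto intro: le_less_trans\<close>)
  have "(\<integral>x. norm (E t x) powr (15/4) \<partial>lborel) \<le> C * N' powr (9/4)"
    using le C nn_integral_eq_integral[OF i] by simp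
  also have "N' powr (9/4) = (2 * N) powr (9/4) * (1 + t) powr - (9/4)"
    using N_pos t by (simp only: N'_def powr_mult powr_powr) simp
  finally show "(\<integral>x. norm (E t x) powr (15/4) \<partial>lborel) \<le> C * (2 * N) powr (9/4) * (1 + t) powr - (9/4)"
    by (simp add: mult.assoc)
qed

text \<open>The rate (5 p - 3) / 7 is the affine function of \<open>p\<close> with value 1 at p = 2,
  from the field energy, and 9/4 at p = 15/4.\<close>

lemma E_p:
  assumes t: "0 \<le> t" and p: "p \<in> {2..15/4}"
  shows "integrable lborel (\<lambda>x. norm (E t x) powr p)"
    and "(\<integral>x. norm (E t x) powr p \<partial>lborel) \<le> K * (1 + t) powr - ((5 * p - 3) / 7)"
proof -
  define \<theta> where "\<theta> = 4 * (p - 2) / 7"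
  have \<theta>: "0 \<le> \<theta>" "\<theta> \<le> 1" "p = (1 - \<theta>) * 2 + \<theta> * (15/4)" "(5 * p - 3) / 7 = (1 - \<theta>) * 1 + \<theta> * (9/4)"
    using p by (auto simp: \<theta>_def field_simps)
  have [measurable]: "E t \<in> borel_measurable borel" by (rule E_measurable[OF t])
  have m: "(\<lambda>x. norm (E t x)) \<in> borel_measurable borel" "\<And>x. 0 \<le> norm (E t x)" "0 < 1 + t" using t by auto
  note ip = interpolation[OF m(1,2) E_2(1)[OF t] E_15_4(1)[OF t] E_2(2)[OF t] E_15_4(2)[OF t] m(3) \<theta>]
  show "integrable lborel (\<lambda>x. norm (E t x) powr p)" by (rule ip(1))
  show "(\<integral>x. norm (E t x) powr p \<partial>lborel) \<le> K * (1 + t) powr - ((5 * p - 3) / 7)" unfolding K_def by (rule ip(2))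
qed

lemma estimate_b:
  assumes t: "0 \<le> t" and p: "p \<in> {2..15/4}"
  shows "Lp_norm p (grad (potential (fp t) (fm t))) \<le> ennreal (K powr (1 / p) * (1 + t) powr - ((5 * p - 3) / (7 * p)))"
proof -
  have "Lp_norm p (E t) \<le> ennreal (K powr (1 / p) * (1 + t) powr - ((5 * p - 3) / 7 / p))"
    by (rule Lp_norm_le[OF E_measurable[OF t] E_p[OF t p]]) (use p K_nonneg in auto)
  then show ?thesis by (simp add: E_def U_def)
qed

text \<open>The field in L^(5/2) is paired with the densities in the conjugate space L^(5/3). The
  norms decay with rates 19/35 and 3/5, which add up to 8/7. Young's inequality with powers of
  \<open>s\<close> as weights again takes the role of Hoelder's.\<close>

lemma estimate_c:
  assumes t: "0 \<le> t"
  shows "norm (D t) \<le> 2 * (K + N) * (1 + t) powr - (8/7)"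
proof -
  define s where "s = 1 + t"
  have s: "0 < s" using t by (simp add: s_def)
  have ep: "integrable lborel (\<lambda>x. norm (E t x) powr (5/2))" "(\<integral>x. norm (E t x) powr (5/2) \<partial>lborel) \<le> K * s powr - (19/14)"
    using E_p[OF t, of "5/2"] by (auto simp: s_def)
  note r53 = rho_53[OF t, folded s_def]
  have [measurable]: "E t \<in> borel_measurable borel" by (rule E_measurable[OF t])
  have [measurable]: "rho (fp t) \<in> borel_measurable borel" "rho (fm t) \<in> borel_measurable borel" by (rule rho_mass[OF t])+
  let ?w = "\<lambda>x. s powr - (8/7) * (2 * (s powr (19/14) * norm (E t x) powr (5/2)) + s * rho (fp t) x powr (5/3) + s * rho (fm t) x powr (5/3))"
  have young: "\<rho> * e \<le> s powr - (8/7) * (s powr (19/14) * e powr (5/2) + s * \<rho> powr (5/3))" if "0 \<le> \<rho>" "0 \<le> e" for \<rho> e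
  proof -
    have "(s powr (19/35) * e) * (s powr (3/5) * \<rho>) \<le> (s powr (19/35) * e) powr (5/2) / (5/2) + (s powr (3/5) * \<rho>) powr (5/3) / (5/3)"
      by (rule Youngs_inequality) (use that in auto)
    also have "(s powr (19/35) * e) powr (5/2) = s powr (19/14) * e powr (5/2)" using that by (simp add: powr_mult powr_powr)
    also have "(s powr (3/5) * \<rho>) powr (5/3) = s * \<rho> powr (5/3)" using that s by (simp add: powr_mult powr_powr)
    also have "s powr (19/14) * e powr (5/2) / (5/2) + s * \<rho> powr (5/3) / (5/3) \<le> s powr (19/14) * e powr (5/2) + s * \<rho> powr (5/3)"
      using s by (intro add_mono) (auto simp: divide_le_eq)
    finally have 1: "s powr - (8/7) * ((s powr (19/35) * e) * (s powr (3/5) * \<rho>)) \<le> s powr - (8/7) * (s powr (19/14) * e powr (5/2) + s * \<rho> powr (5/3))"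
      by (intro mult_left_mono) auto
    have "s powr - (8/7) * ((s powr (19/35) * e) * (s powr (3/5) * \<rho>)) = (s powr - (8/7) * s powr (19/35) * s powr (3/5)) * (\<rho> * e)"
      by (simp only: mult_ac)
    also have "s powr - (8/7) * s powr (19/35) * s powr (3/5) = s powr (- (8/7) + 19/35 + 3/5)"
      by (simp only: powr_add)
    also have "\<dots> = 1" using s by simp
    finally have "s powr - (8/7) * ((s powr (19/35) * e) * (s powr (3/5) * \<rho>)) = \<rho> * e" by (simp only: mult_1_left)
    with 1 show ?thesis by (simp only:)
  qed
  have wi: "integrable lborel ?w" using ep r53 by simp
  have nb: "norm ((rho (fp t) x + rho (fm t) x) *\<^sub>R E t x) \<le> ?w x" for x
  proof -
    have nn: "0 \<le> rho (fp t) x" "0 \<le> rho (fm t) x" by (rule rho_nonneg[OF t])+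
    have "norm ((rho (fp t) x + rho (fm t) x) *\<^sub>R E t x) = rho (fp t) x * norm (E t x) + rho (fm t) x * norm (E t x)"
      using nn by (simp add: distrib_right)
    also have "\<dots> \<le> ?w x" using young[OF nn(1) norm_ge_zero[of "E t x"]] young[OF nn(2) norm_ge_zero[of "E t x"]]
      by (simp add: distrib_left)
    finally show ?thesis .
  qed
  have wnn: "norm (?w x) = ?w x" for x using s by simp
  have Di: "integrable lborel (\<lambda>x. (rho (fp t) x + rho (fm t) x) *\<^sub>R E t x)"
    by (rule Bochner_Integration.integrable_bound[OF wi]) (use nb in \<open>auto simp only: wnn intro!: AE_I2, measurable\<close>)
  have "norm (D t) \<le> (\<integral>x. norm ((rho (fp t) x + rho (fm t) x) *\<^sub>R E t x) \<partial>lborel)"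
    unfolding D_def D2_def E_def U_def by (rule integral_norm_bound)
  also have "\<dots> \<le> (\<integral>x. ?w x \<partial>lborel)"
    by (rule integral_mono[OF integrable_norm[OF Di] wi nb])
  also have "\<dots> = s powr - (8/7) * (2 * (s powr (19/14) * (\<integral>x. norm (E t x) powr (5/2) \<partial>lborel))
      + s * (\<integral>x. rho (fp t) x powr (5/3) \<partial>lborel) + s * (\<integral>x. rho (fm t) x powr (5/3) \<partial>lborel))"
    using ep r53 by simp
  also have "\<dots> \<le> s powr - (8/7) * (2 * (s powr (19/14) * (K * s powr - (19/14))) + s * (N * s powr - 1) + s * (N * s powr - 1))"
    using ep r53 s by (intro mult_left_mono add_mono) auto
  also have "\<dots> = 2 * (K + N) * s powr - (8/7)"
  proof -
    have e: "s powr (19/14) * (K * s powr - (19/14)) = K" "s * (N * s powr - 1) = N"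
      using s by (simp_all add: powr_minus field_simps)
    show ?thesis unfolding e by (simp add: algebra_simps)
  qed
  finally show ?thesis by (simp add: s_def)
qed

end

section \<open>Long-time behaviour\<close>

lemma decreasing_converges:
  fixes e :: "real \<Rightarrow> real"
  assumes mono: "\<And>a b. 0 \<le> a \<Longrightarrow> a \<le> b \<Longrightarrow> e b \<le> e a" and low: "\<And>t. 0 \<le> t \<Longrightarrow> l \<le> e t"
  shows "\<exists>L. (e \<longlongrightarrow> L) at_top \<and> l \<le> L"
proof -
  define L where "L = Inf (e ` {0..})"
  have bdd: "bdd_below (e ` {0..})" using low by (intro bdd_belowI[of _ l]) auto
  have Le: "L \<le> e t" if "0 \<le> t" for t unfolding L_def using that bdd by (intro cInf_lower) auto
  have "(e \<longlongrightarrow> L) at_top"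
  proof (rule decreasing_tendsto)
    show "\<forall>\<^sub>F t in at_top. L \<le> e t" using eventually_ge_at_top[of 0] by eventually_elim (rule Le)
    fix y assume "L < y"
    then obtain t where t: "0 \<le> t" "e t < y"
      unfolding L_def using cInf_lessD[of "e ` {0..}" y] by auto
    show "\<forall>\<^sub>F s in at_top. e s < y"
      using eventually_ge_at_top[of t] by eventually_elim (use mono[OF t(1)] t(2) in \<open>auto intro: le_less_trans\<close>)
  qed
  moreover have "l \<le> L" unfolding L_def using low by (intro cInf_greatest) auto
  ultimately show ?thesis by blast
qed

context vpd_est
begin

text \<open>The total energy decreases and the potential energy tends to 0, so the kinetic energy
  has the limit of the total one. The lower bound is the initial energy minus a bound for the whole
  dissipation, which carries a factor \<epsilon>.\<close>

lemma E_kin_converges: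
  "\<exists>L. ((\<lambda>t. E_kin (fp t) (fm t)) \<longlongrightarrow> L) at_top \<and> 0 \<le> L \<and> energy (fp 0) (fm 0) - \<epsilon> * (2 * (K + N)) ^ 2 \<le> L"
proof -
  let ?e = "\<lambda>t. energy (fp t) (fm t)"
  let ?c = "\<epsilon> * (2 * (K + N)) ^ 2"
  have mono: "?e b \<le> ?e a" if "0 \<le> a" "a \<le> b" for a b
    by (rule nonincreasing_from_0[OF energy_deriv]) (use eps that in auto)
  have kin: "0 \<le> E_kin (fp t) (fm t)" if "0 \<le> t" for t
    unfolding E_kin_eq[OF that] phase_integral_def using fp_nonneg[OF that] fm_nonneg[OF that]
    by (auto intro!: add_nonneg_nonneg Bochner_Integration.integral_nonneg)
  have low0: "0 \<le> ?e t" if "0 \<le> t" for t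
    using kin[OF that] E_pot_nonneg[of t] by (simp add: energy_def)
  have low: "?e 0 - ?c \<le> ?e t" if t: "0 \<le> t" for t
  proof -
    \<comment> \<open>The decay of |D|^2 with rate 16/7 is weakened to rate 2, whose primitive is
      elementary. Monotonicity of this combination shows that the dissipated energy never exceeds
      \<open>?c\<close>.\<close>
    have "- ?e t + ?c * inverse (1 + t) \<le> - ?e 0 + ?c * inverse (1 + 0)"
    proof (rule nonincreasing_from_0[where \<phi>="\<lambda>t. - ?e t + ?c * inverse (1 + t)"
          and \<phi>'="\<lambda>u. - (- \<epsilon> * (norm (D u))\<^sup>2) + ?c * (- (inverse (1 + u) ^ 2))"])
      show "((\<lambda>t. - ?e t + ?c * inverse (1 + t)) has_real_derivative
          - (- \<epsilon> * (norm (D u))\<^sup>2) + ?c * (- (inverse (1 + u) ^ 2))) (at u within {0..})" if u: "0 \<le> u" for u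
        using u by (intro DERIV_add DERIV_minus DERIV_cmult energy_deriv)
                   (auto intro!: derivative_eq_intros simp: power2_eq_square)
      show "- (- \<epsilon> * (norm (D u))\<^sup>2) + ?c * (- (inverse (1 + u) ^ 2)) \<le> 0" if u: "0 \<le> u" for u
      proof -
        have "norm (D u) \<le> 2 * (K + N) * (1 + u) powr - (8/7)" by (rule estimate_c[OF u])
        also have "\<dots> \<le> 2 * (K + N) * (1 + u) powr - 1"
          using u K_nonneg N_pos by (intro mult_left_mono powr_mono) auto
        also have "(1 + u) powr - 1 = inverse (1 + u)" using u by (simp add: powr_minus)
        finally have "(norm (D u))\<^sup>2 \<le> (2 * (K + N) * inverse (1 + u))\<^sup>2" by (intro power_mono) auto
        then have "\<epsilon> * (norm (D u))\<^sup>2 \<le> \<epsilon> * (2 * (K + N) * inverse (1 + u))\<^sup>2"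
          using eps by (intro mult_left_mono) auto
        then show ?thesis by (simp only: power_mult_distrib mult.assoc)
      qed
    qed (use t in auto)
    moreover have "0 \<le> ?c * inverse (1 + t)" using eps t by simp
    ultimately show ?thesis by simp
  qed
  define l where "l = max 0 (?e 0 - ?c)"
  have "l \<le> ?e t" if "0 \<le> t" for t using low[OF that] low0[OF that] by (simp add: l_def)
  from decreasing_converges[of ?e, OF mono this]
  obtain L where L: "(?e \<longlongrightarrow> L) at_top" "l \<le> L" by blast
  have "((\<lambda>t. E_pot (fp t) (fm t)) \<longlongrightarrow> 0) at_top"
  proof (rule tendsto_sandwich[where f="\<lambda>_. 0" and h="\<lambda>t. H * (1 + t) powr - 1"])
    show "((\<lambda>t. H * (1 + t) powr - 1) \<longlongrightarrow> 0) at_top"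
    proof -
      have "((\<lambda>t. (1 + t) powr - 1) \<longlongrightarrow> (0::real)) at_top"
        by (intro tendsto_neg_powr filterlim_tendsto_add_at_top[OF tendsto_const filterlim_ident]) simp
      from tendsto_mult[OF tendsto_const this, of H] show ?thesis by simp
    qed
    show "\<forall>\<^sub>F t in at_top. E_pot (fp t) (fm t) \<le> H * (1 + t) powr - 1"
      using eventually_ge_at_top[of 0] by eventually_elim (rule dispersion_le(3))
  qed (auto intro!: always_eventually E_pot_nonneg)
  from tendsto_diff[OF L(1) this] have "((\<lambda>t. E_kin (fp t) (fm t)) \<longlongrightarrow> L) at_top"
    by (simp add: energy_def)
  then show ?thesis using L(2) by (auto simp: l_def)
qed

text \<open>For a static solution the decaying \<open>L\<^bsup>5/3\<^esup>\<close>-norm of the densities is constant, hence zero.\<close>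

lemma static_vanishes:
  assumes static: "\<And>t. 0 \<le> t \<Longrightarrow> fp t = fp 0" "\<And>t. 0 \<le> t \<Longrightarrow> fm t = fm 0"
  shows "fp 0 x v = 0" "fm 0 x v = 0"
proof -
  have zero: "c \<le> 0" if "\<And>t. 0 \<le> t \<Longrightarrow> c \<le> N * (1 + t) powr - 1" for c
  proof (rule ccontr)
    assume "\<not> c \<le> 0"
    then have c: "0 < c" by simp
    \<comment> \<open>At t = N / c the bound reads c \<le> N c / (c + N), and the right-hand side is
      smaller than \<open>c\<close>.\<close>
    have "c \<le> N * (1 + N / c) powr - 1" using that[of "N / c"] c N_pos by simp
    also have "\<dots> = N * c / (c + N)" using c N_pos by (simp add: powr_minus_divide field_simps)
    finally show False using c N_pos by (simp add: pos_le_divide_eq)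
  qed
  have int0: "(\<integral>x. \<rho> x \<partial>lborel) = 0"
    if "\<And>x. 0 \<le> \<rho> x" "integrable lborel (\<lambda>x. \<rho> x powr (5/3))" "(\<integral>x. \<rho> x powr (5/3) \<partial>lborel) \<le> 0" for \<rho> :: "vec3 \<Rightarrow> real"
  proof -
    have "(\<integral>x. \<rho> x powr (5/3) \<partial>lborel) = 0"
      by (rule antisym[OF that(3)]) (auto intro!: Bochner_Integration.integral_nonneg)
    then have "AE x in lborel. \<rho> x powr (5/3) = 0"
      using integral_nonneg_eq_0_iff_AE[OF that(2)] by simp
    then have "AE x in lborel. \<rho> x = 0" by simp
    then show ?thesis by (rule integral_eq_zero_AE)
  qed
  have m: "phase_integral (fp 0) = (\<integral>x. rho (fp 0) x \<partial>lborel)" "phase_integral (fm 0) = (\<integral>x. rho (fm 0) x \<partial>lborel)"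
    using p.rho_integral(1)[OF order_refl continuous_on_const[of UNIV 1]] m.rho_integral(1)[OF order_refl continuous_on_const[of UNIV 1]]
    by (simp_all add: phase_integral_def)
  have 1: "phase_integral (fp 0) = 0"
    unfolding m by (rule int0[OF rho_nonneg(1)[OF order_refl] rho_53(1)[OF order_refl] zero]) (use rho_53(3) static in metis)
  have 2: "phase_integral (fm 0) = 0"
    unfolding m by (rule int0[OF rho_nonneg(2)[OF order_refl] rho_53(2)[OF order_refl] zero]) (use rho_53(4) static in metis)
  have i: "integrable phase_space (\<lambda>z. fp 0 (fst z) (snd z))" "integrable phase_space (\<lambda>z. fm 0 (fst z) (snd z))"
    using integrable_weight[OF order_refl continuous_on_const[of UNIV 1]] by simp_all
  show "fp 0 x v = 0"
    using continuous_nonneg_integral_0[OF p.cont_fixed(1)[OF order_refl] init(1) i(1), of "(x, v)"] 1 by (simp add: phase_integral_def)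
  show "fm 0 x v = 0"
    using continuous_nonneg_integral_0[OF m.cont_fixed(1)[OF order_refl] init(2) i(2), of "(x, v)"] 2 by (simp add: phase_integral_def)
qed

end

section \<open>Constants determined by the data\<close>

lemma Cc_infinity_bounded:
  assumes "Cc_infinity g"
  shows "\<exists>M\<ge>0. \<forall>z. g z \<le> M"
proof -
  let ?K = "closure {x. g x \<noteq> 0}"
  have "Ck 0 g" and K: "compact ?K" using assms unfolding Cc_infinity_def by simp_all
  then have "compact (g ` ?K)" by (intro compact_continuous_image) (auto intro: continuous_on_subset)
  then obtain B where B: "\<And>y. y \<in> g ` ?K \<Longrightarrow> norm y \<le> B"
    using compact_imp_bounded bounded_iff by metis
  have "g z \<le> max 0 B" for z
  proof (cases "g z = 0")
    case False
    then have "z \<in> ?K" using closure_subset[of "{x. g x \<noteq> 0}"] by (auto simp: subset_iff)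
    then show ?thesis using B[of "g z"] by simp
  qed simp
  then show ?thesis by (intro exI[of _ "max 0 B"]) simp
qed

lemma VPD_data_bounded:
  assumes "VPD_data f0p f0m"
  shows "\<exists>M\<ge>0. \<forall>x v. f0p x v \<le> M \<and> f0m x v \<le> M"
proof -
  have cc: "Cc_infinity (\<lambda>(x, v). f0p x v)" "Cc_infinity (\<lambda>(x, v). f0m x v)"
    using assms by (simp_all add: VPD_data_def)
  from Cc_infinity_bounded[OF cc(1)] obtain M1
    where M1: "0 \<le> M1" "\<forall>z. (case z of (x, v) \<Rightarrow> f0p x v) \<le> M1" by (elim exE conjE)
  from Cc_infinity_bounded[OF cc(2)] obtain M2
    where M2: "0 \<le> M2" "\<forall>z. (case z of (x, v) \<Rightarrow> f0m x v) \<le> M2" by (elim exE conjE)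
  have "f0p x v \<le> max M1 M2 \<and> f0m x v \<le> max M1 M2" for x v
    using spec[OF M1(2), of "(x, v)"] spec[OF M2(2), of "(x, v)"] by auto
  then show ?thesis using M1(1) by (intro exI[of _ "max M1 M2"]) auto
qed

text \<open>The growth bound of \<open>h\<close> in terms of the data; the parameter of
  \<open>dispersion\<close> is 1 because 1 + t is 1 initially. The argument \<open>e\<close> will be
  \<open>max 1 \<epsilon>\<close>, which makes the value one and the same for all \<epsilon> \<le>
  1.\<close>

definition growth_const :: "density \<Rightarrow> density \<Rightarrow> real \<Rightarrow> real" where
  "growth_const f0p f0m e =
     (dispersion 1 f0p + dispersion 1 f0m + E_pot f0p f0m) * exp (e * (phase_integral f0p + phase_integral f0m + 1) / 2)"

lemma vpd_est_ivp:
  assumes data: "VPD_data f0p f0m" and eps: "0 < \<epsilon>" and ivp: "VPD_ivp \<epsilon> f0p f0m fp fm"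
    and M: "0 \<le> M" "\<forall>x v. f0p x v \<le> M \<and> f0m x v \<le> M" and C: "0 < C" "HLS_bound C"
  shows "vpd_est \<epsilon> fp fm M (growth_const f0p f0m (max 1 \<epsilon>)) C"
proof -
  have i: "fp 0 = f0p" "fm 0 = f0m" "VPD_solution \<epsilon> {0..} fp fm" using ivp by (auto simp: VPD_ivp_def)
  interpret vpd_nonneg \<epsilon> fp fm
    by unfold_locales (use i eps data in \<open>auto simp: VPD_data_def\<close>)
  have h0: "h 0 = dispersion 1 f0p + dispersion 1 f0m + E_pot f0p f0m"
    by (simp add: h_def G_def i)
  have "0 \<le> h 0" unfolding h_def G_def using dispersion_nonneg[of 0] E_pot_nonneg[of 0] by simp
  moreover have "exp (\<epsilon> * (mass + 1) / 2) \<le> exp (max 1 \<epsilon> * (mass + 1) / 2)"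
    using mass_nonneg by (intro exp_le_cancel_iff[THEN iffD2] divide_right_mono mult_right_mono) auto
  ultimately have "h 0 * exp (\<epsilon> * (mass + 1) / 2) \<le> growth_const f0p f0m (max 1 \<epsilon>)"
    unfolding growth_const_def h0[symmetric] using i by (intro mult_left_mono) (auto simp: mass_def)
  then show ?thesis
    by unfold_locales (use M C i in auto)
qed

theorem theorem2:
  fixes f0p f0m :: density
  assumes data: "VPD_data f0p f0m"
  shows
    "(\<forall>\<epsilon>>0. \<forall>fp fm. VPD_ivp \<epsilon> f0p f0m fp fm \<longrightarrow>
        (\<forall>t\<ge>0. ((\<lambda>s. energy (fp s) (fm s)) has_real_derivative
                  - \<epsilon> * (norm (D2 (fp t) (fm t)))\<^sup>2) (at t within {0..})))
     \<and>
     (\<forall>p\<in>{1..5/3}. \<exists>C. admissible_constant C \<and>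
        (\<forall>\<epsilon>>0. \<forall>fp fm. VPD_ivp \<epsilon> f0p f0m fp fm \<longrightarrow>
          (\<forall>t\<ge>0.
             Lp_norm p (rho (fp t)) \<le> ennreal (C \<epsilon> * (1 + t) powr - (3 * (p - 1) / (2 * p))) \<and>
             Lp_norm p (rho (fm t)) \<le> ennreal (C \<epsilon> * (1 + t) powr - (3 * (p - 1) / (2 * p))))))
     \<and>
     (\<forall>p\<in>{2..15/4}. \<exists>C. admissible_constant C \<and>
        (\<forall>\<epsilon>>0. \<forall>fp fm. VPD_ivp \<epsilon> f0p f0m fp fm \<longrightarrow>
          (\<forall>t\<ge>0.
             Lp_norm p (grad (potential (fp t) (fm t)))
               \<le> ennreal (C \<epsilon> * (1 + t) powr - ((5 * p - 3) / (7 * p))))))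
     \<and>
     (\<exists>C. admissible_constant C \<and>
        (\<forall>\<epsilon>>0. \<forall>fp fm. VPD_ivp \<epsilon> f0p f0m fp fm \<longrightarrow>
          (\<forall>t\<ge>0. norm (D2 (fp t) (fm t)) \<le> C \<epsilon> * (1 + t) powr - (8 / 7))))
     \<and>
     (\<forall>\<epsilon>>0. \<forall>gp gm. VPD_data gp gm \<and> VPD_solution \<epsilon> {0..} (\<lambda>t. gp) (\<lambda>t. gm) \<longrightarrow>
        (\<forall>x v. gp x v = 0 \<and> gm x v = 0))
     \<and>
     (\<forall>\<epsilon>>0. \<forall>fp fm. VPD_ivp \<epsilon> f0p f0m fp fm \<longrightarrow>
        (\<exists>E_inf\<ge>0. ((\<lambda>t. E_kin (fp t) (fm t)) \<longlongrightarrow> E_inf) at_top))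
     \<and>
     (energy f0p f0m > 0 \<longrightarrow>
        (\<exists>\<epsilon>0>0. \<forall>\<epsilon>. 0 < \<epsilon> \<and> \<epsilon> < \<epsilon>0 \<longrightarrow>
          (\<forall>fp fm. VPD_ivp \<epsilon> f0p f0m fp fm \<longrightarrow>
            (\<exists>E_inf>0. ((\<lambda>t. E_kin (fp t) (fm t)) \<longlongrightarrow> E_inf) at_top))))"
proof -
  obtain M where M: "0 \<le> M" "\<forall>x v. f0p x v \<le> M \<and> f0m x v \<le> M" using VPD_data_bounded[OF data] by blast
  obtain C where C: "0 < C" "HLS_bound C" using HLS by blast
  define Hc where "Hc \<epsilon> = growth_const f0p f0m (max 1 \<epsilon>)" for \<epsilon>
  define mc where "mc = phase_integral f0p + phase_integral f0m"
  define Nc where "Nc \<epsilon> = (M * \<kappa> + 1) powr (5/3) * 2 * Hc \<epsilon> + 1" for \<epsilon>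
  define Kc where "Kc \<epsilon> = 8 * pi * Hc \<epsilon> + C * (2 * Nc \<epsilon>) powr (9/4)" for \<epsilon>
  \<comment> \<open>\<open>Nc\<close> and \<open>Kc\<close> depend on \<epsilon> only through
    \<open>max 1 \<epsilon>\<close>, so whatever is computed from them is constant on ]0,
    1].\<close>
  have adm: "admissible_constant (\<lambda>\<epsilon>. F (Nc \<epsilon>) (Kc \<epsilon>))" for F
    by (auto simp: admissible_constant_def Kc_def Nc_def Hc_def)
  have est: "vpd_est \<epsilon> fp fm M (Hc \<epsilon>) C" if "0 < \<epsilon>" "VPD_ivp \<epsilon> f0p f0m fp fm" for \<epsilon> fp fm
    unfolding Hc_def by (rule vpd_est_ivp[OF data that M C])
  \<comment> \<open>The constants exported from the locales are identified with functions of
    \<epsilon> alone, so that the witnesses can be chosen before the solution.\<close>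
  have Neq: "vpd_est.N M (Hc \<epsilon>) = Nc \<epsilon>" and Keq: "vpd_est.K M (Hc \<epsilon>) C = Kc \<epsilon>"
    and meq: "vpd_nonneg.mass fp fm = mc" and Deq: "vpd.D fp fm = (\<lambda>t. D2 (fp t) (fm t))"
    if "0 < \<epsilon>" "VPD_ivp \<epsilon> f0p f0m fp fm" for \<epsilon> fp fm
  proof -
    interpret vpd_est \<epsilon> fp fm M "Hc \<epsilon>" C by (rule est[OF that])
    show N: "vpd_est.N M (Hc \<epsilon>) = Nc \<epsilon>" by (simp add: Nc_def N_def)
    show "vpd_est.K M (Hc \<epsilon>) C = Kc \<epsilon>" unfolding K_def N by (simp add: Kc_def)
    show "vpd_nonneg.mass fp fm = mc" using that(2) by (simp add: mass_def mc_def VPD_ivp_def)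
    show "vpd.D fp fm = (\<lambda>t. D2 (fp t) (fm t))" by (rule ext) (rule D_def)
  qed
  show ?thesis
  proof (intro conjI ballI allI impI)
    fix \<epsilon> :: real and fp fm and t :: real
    assume *: "0 < \<epsilon>" "VPD_ivp \<epsilon> f0p f0m fp fm" and t: "0 \<le> t"
    interpret vpd_est \<epsilon> fp fm M "Hc \<epsilon>" C by (rule est[OF *])
    show "((\<lambda>s. energy (fp s) (fm s)) has_real_derivative - \<epsilon> * (norm (D2 (fp t) (fm t)))\<^sup>2) (at t within {0..})"
      using energy_deriv[OF t] by (simp add: D_def)
  next
    fix p :: real assume p: "p \<in> {1..5/3}"
    show "\<exists>C. admissible_constant C \<and> (\<forall>\<epsilon>>0. \<forall>fp fm. VPD_ivp \<epsilon> f0p f0m fp fm \<longrightarrow> (\<forall>t\<ge>0.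
             Lp_norm p (rho (fp t)) \<le> ennreal (C \<epsilon> * (1 + t) powr - (3 * (p - 1) / (2 * p))) \<and>
             Lp_norm p (rho (fm t)) \<le> ennreal (C \<epsilon> * (1 + t) powr - (3 * (p - 1) / (2 * p)))))"
    proof (intro exI[of _ "\<lambda>\<epsilon>. (mc + Nc \<epsilon>) powr (1 / p)"] conjI allI impI)
      fix \<epsilon> :: real and fp fm and t :: real
      assume *: "0 < \<epsilon>" "VPD_ivp \<epsilon> f0p f0m fp fm" and t: "0 \<le> t"
      note e = vpd_est.estimate_a[OF est[OF *] t p, unfolded Neq[OF *] meq[OF *]]
      show "Lp_norm p (rho (fp t)) \<le> ennreal ((mc + Nc \<epsilon>) powr (1 / p) * (1 + t) powr - (3 * (p - 1) / (2 * p)))"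
        by (rule e)
      show "Lp_norm p (rho (fm t)) \<le> ennreal ((mc + Nc \<epsilon>) powr (1 / p) * (1 + t) powr - (3 * (p - 1) / (2 * p)))"
        by (rule e)
    qed (rule adm)
  next
    fix p :: real assume p: "p \<in> {2..15/4}"
    show "\<exists>C. admissible_constant C \<and> (\<forall>\<epsilon>>0. \<forall>fp fm. VPD_ivp \<epsilon> f0p f0m fp fm \<longrightarrow> (\<forall>t\<ge>0.
             Lp_norm p (grad (potential (fp t) (fm t))) \<le> ennreal (C \<epsilon> * (1 + t) powr - ((5 * p - 3) / (7 * p)))))"
    proof (intro exI[of _ "\<lambda>\<epsilon>. Kc \<epsilon> powr (1 / p)"] conjI allI impI)
      fix \<epsilon> :: real and fp fm and t :: real
      assume *: "0 < \<epsilon>" "VPD_ivp \<epsilon> f0p f0m fp fm" and t: "0 \<le> t"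
      show "Lp_norm p (grad (potential (fp t) (fm t))) \<le> ennreal (Kc \<epsilon> powr (1 / p) * (1 + t) powr - ((5 * p - 3) / (7 * p)))"
        by (rule vpd_est.estimate_b[OF est[OF *] t p, unfolded Keq[OF *]])
    qed (rule adm)
  next
    show "\<exists>C. admissible_constant C \<and> (\<forall>\<epsilon>>0. \<forall>fp fm. VPD_ivp \<epsilon> f0p f0m fp fm \<longrightarrow>
          (\<forall>t\<ge>0. norm (D2 (fp t) (fm t)) \<le> C \<epsilon> * (1 + t) powr - (8 / 7)))"
    proof (intro exI[of _ "\<lambda>\<epsilon>. 2 * (Kc \<epsilon> + Nc \<epsilon>)"] conjI allI impI)
      fix \<epsilon> :: real and fp fm and t :: real
      assume *: "0 < \<epsilon>" "VPD_ivp \<epsilon> f0p f0m fp fm" and t: "0 \<le> t"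
      show "norm (D2 (fp t) (fm t)) \<le> 2 * (Kc \<epsilon> + Nc \<epsilon>) * (1 + t) powr - (8 / 7)"
        by (rule vpd_est.estimate_c[OF est[OF *] t, unfolded Keq[OF *] Neq[OF *] Deq[OF *]])
    qed (rule adm)
  next
    fix \<epsilon> :: real and gp gm x v
    assume eps: "0 < \<epsilon>" and g: "VPD_data gp gm \<and> VPD_solution \<epsilon> {0..} (\<lambda>t. gp) (\<lambda>t. gm)"
    \<comment> \<open>A static pair solves the initial value problem with itself as data. These may
      differ from the data fixed in the theorem, hence a bound of their own.\<close>
    obtain M' where M': "0 \<le> M'" "\<forall>x v. gp x v \<le> M' \<and> gm x v \<le> M'" using VPD_data_bounded g by blast
    interpret g: vpd_est \<epsilon> "\<lambda>t. gp" "\<lambda>t. gm" M' "growth_const gp gm (max 1 \<epsilon>)" C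
      by (rule vpd_est_ivp[OF _ eps _ M' C]) (use g in \<open>auto simp: VPD_ivp_def\<close>)
    show "gp x v = 0" by (rule g.static_vanishes(1)) auto
    show "gm x v = 0" by (rule g.static_vanishes(2)) auto
  next
    fix \<epsilon> :: real and fp fm
    assume *: "0 < \<epsilon>" "VPD_ivp \<epsilon> f0p f0m fp fm"
    show "\<exists>E_inf\<ge>0. ((\<lambda>t. E_kin (fp t) (fm t)) \<longlongrightarrow> E_inf) at_top"
      using vpd_est.E_kin_converges[OF est[OF *]] by blast
  next
    assume pos: "0 < energy f0p f0m"
    define c where "c = (2 * (Kc 1 + Nc 1)) ^ 2"
    \<comment> \<open>The minimum with 1 freezes the constants at their value for \<epsilon> = 1, so
      \<open>c\<close> does not depend on the \<epsilon> to be restricted. The second entry keeps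
      \<epsilon> c below the initial energy; c + 1 avoids a division by 0.\<close>
    define \<epsilon>0 where "\<epsilon>0 = min 1 (energy f0p f0m / (c + 1))"
    have c: "0 \<le> c" by (simp add: c_def)
    have "0 < \<epsilon>0" using pos c by (simp add: \<epsilon>0_def)
    moreover have "\<exists>E_inf>0. ((\<lambda>t. E_kin (fp t) (fm t)) \<longlongrightarrow> E_inf) at_top"
      if e: "0 < \<epsilon>" "\<epsilon> < \<epsilon>0" and ivp: "VPD_ivp \<epsilon> f0p f0m fp fm" for \<epsilon> fp fm
    proof -
      have "max 1 \<epsilon> = 1" using e by (simp add: \<epsilon>0_def)
      then have KN: "Kc \<epsilon> = Kc 1" "Nc \<epsilon> = Nc 1" by (simp_all add: Kc_def Nc_def Hc_def)
      have i: "fp 0 = f0p" "fm 0 = f0m" using ivp by (simp_all add: VPD_ivp_def)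
      obtain L where L: "((\<lambda>t. E_kin (fp t) (fm t)) \<longlongrightarrow> L) at_top" "energy f0p f0m - \<epsilon> * c \<le> L"
        using vpd_est.E_kin_converges[OF est[OF e(1) ivp], unfolded Keq[OF e(1) ivp] Neq[OF e(1) ivp] KN i, folded c_def] by blast
      have "\<epsilon> * (c + 1) < energy f0p f0m" using e c by (simp add: \<epsilon>0_def pos_less_divide_eq)
      then have "0 < energy f0p f0m - \<epsilon> * c" using e(1) by (simp add: algebra_simps)
      then show ?thesis using L by (intro exI[of _ L]) auto
    qed
    ultimately show "\<exists>\<epsilon>0>0. \<forall>\<epsilon>. 0 < \<epsilon> \<and> \<epsilon> < \<epsilon>0 \<longrightarrow> (\<forall>fp fm. VPD_ivp \<epsilon> f0p f0m fp fm \<longrightarrow>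
            (\<exists>E_inf>0. ((\<lambda>t. E_kin (fp t) (fm t)) \<longlongrightarrow> E_inf) at_top))"
      by blast
  qed
qed

end
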